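(* Let $2\le r\le C\ell$ and $0\le s\le r-1$, and let $\mathbf x[s]$ be a fixed perfect sequence. Then \[ P_{\mathrm{red},r}(\mathbf x[s])\le(1+2^{-C\ell})P^{\mathrm{per}}_{\mathrm{red},r}(\mathbf x[s])\quad\text{and}\quad \overline P_{\mathrm{blue},r}(\mathbf x[s])\le(1+2^{-C\ell})\overline P^{\mathrm{per}}_{\mathrm{blue},r}(\mathbf x[s]). \]
   Context: Parameters: fix $C>1$; $p_C\in(0,1/2)$ is the unique solution of $C=\frac{\log p_C}{\log(1-p_C)}$; $\alpha_C:=\max\{1000,20\sqrt{C\log(10/p_C)}\}$. $D,\ell_0$ constants with $\ell_0\gg D\gg C$ ($D$ sufficiently large in terms of $C$, $\ell_0$ sufficiently large in terms of $D,C$); $\ell\ge\ell_0$ integer, $k=D^2\ell^2$, $p\in(p_C,1/2)$ fixed. Quantities like $C\ell$ are treated as integers. $S^k$ is the unit sphere in $\mathbb R^{k+1}$ with uniform probability. $c_{k,p}\ge0$ is defined by $\mathbb P(\langle\mathbf x,\mathbf e\rangle\le-c_{k,p}/\sqrt k)=p$ for $\mathbf x$ uniform on $S^k$, $\mathbf e$ a fixed unit vector. $G_p(\mathbf x[r])$ is the complete graph on $\mathbf x_1,\dots,\mathbf x_r$ with edge $\mathbf x_i\mathbf x_j$ red iff $\langle\mathbf x_i,\mathbf x_j\rangle\le-c_{k,p}/\sqrt k$, blue otherwise. $\pi_{[i]}$ is orthogonal projection onto $\mathrm{span}(\mathbf x_1,\dots,\mathbf x_i)$. A sequence is perfect if $|\pi_{[i]}(\mathbf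 x_{i+1})|\le\alpha_C\sqrt\ell/\sqrt k$ for all $i\ge1$ for which $\mathbf x_{i+1}$ exists (the empty sequence and single points are perfect). Given the fixed perfect sequence $\mathbf x[s]$ (empty if $s=0$), let $\mathbf x_{s+1},\dots,\mathbf x_r$ be independent uniform points of $S^k$. $P_{\mathrm{red},r}(\mathbf x[s])$ is the probability that $G_p(\mathbf x[r])$ is a red clique, and $P^{\mathrm{per}}_{\mathrm{red},r}(\mathbf x[s])$ the probability that $G_p(\mathbf x[r])$ is a red clique and $\mathbf x[r]$ is perfect; $\overline P_{\mathrm{blue},r}(\mathbf x[s])$, $\overline P^{\mathrm{per}}_{\mathrm{blue},r}(\mathbf x[s])$ are defined likewise with blue cliques. *)

theory Defs
  imports "HOL-Probability.Probability"
begin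

(* The dimension k depends on l, which is quantified inside the theorem, so R^(k+1) cannot be a
   type here.  It is represented by the extensional functions on {..k}, i.e. by the space of
   PiM {..k} (\<lambda>_. borel); functions outside this set are not points of R^(k+1). *)

definition p_of :: "real \<Rightarrow> real" where
  "p_of C = (THE p. 0 < p \<and> p < 1/2 \<and> C = ln p / ln (1 - p))"

definition alpha_of :: "real \<Rightarrow> real" where
  "alpha_of C = max 1000 (20 * sqrt (C * ln (10 / p_of C)))"

definition dot :: "nat \<Rightarrow> (nat \<Rightarrow> real) \<Rightarrow> (nat \<Rightarrow> real) \<Rightarrow> real" where
  "dot k x y = (\<Sum>j\<le>k. x j * y j)"

definition unit_sphere :: "nat \<Rightarrow> (nat \<Rightarrow> real) set" where
  "unit_sphere k = {x \<in> extensional {..k}. L2_set x {..k} = 1}"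

(* Uniform probability on S^k as the cone measure: the law of u/|u| for u uniform in the unit ball
   of R^(k+1).  It lives on the Borel sets of R^(k+1) and is concentrated on unit_sphere k.
   The null set u = 0 is irrelevant. *)
definition sphere_unif :: "nat \<Rightarrow> (nat \<Rightarrow> real) measure" where
  "sphere_unif k =
     distr (uniform_measure (PiM {..k} (\<lambda>_. lborel)) {u \<in> extensional {..k}. L2_set u {..k} \<le> 1})
           (PiM {..k} (\<lambda>_. borel))
           (\<lambda>u. \<lambda>j\<in>{..k}. u j / L2_set u {..k})"

(* The fixed unit vector e in the definition of c_{k,p} (first basis vector); by rotation invariance of sphere_unif
   its choice is immaterial. *)
definition e_zero :: "nat \<Rightarrow> nat \<Rightarrow> real" where
  "e_zero k = (\<lambda>j\<in>{..k}. if j = 0 then 1 else 0)"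

definition c_thr :: "nat \<Rightarrow> real \<Rightarrow> real" where
  "c_thr k p = (THE c. 0 \<le> c \<and>
     measure (sphere_unif k) {x \<in> space (sphere_unif k). dot k x (e_zero k) \<le> - c / sqrt (real k)} = p)"

(* Sequences x[n] = (x_1,...,x_n) are functions nat => R^(k+1) of which only the
   values at 1..n matter. *)

definition red_edge :: "nat \<Rightarrow> real \<Rightarrow> (nat \<Rightarrow> nat \<Rightarrow> real) \<Rightarrow> nat \<Rightarrow> nat \<Rightarrow> bool" where
  "red_edge k p x i j \<longleftrightarrow> dot k (x i) (x j) \<le> - c_thr k p / sqrt (real k)"

definition red_clique :: "nat \<Rightarrow> real \<Rightarrow> nat \<Rightarrow> (nat \<Rightarrow> nat \<Rightarrow> real) \<Rightarrow> bool" where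
  "red_clique k p n x \<longleftrightarrow> (\<forall>i\<in>{1..n}. \<forall>j\<in>{1..n}. i \<noteq> j \<longrightarrow> red_edge k p x i j)"

definition blue_clique :: "nat \<Rightarrow> real \<Rightarrow> nat \<Rightarrow> (nat \<Rightarrow> nat \<Rightarrow> real) \<Rightarrow> bool" where
  "blue_clique k p n x \<longleftrightarrow> (\<forall>i\<in>{1..n}. \<forall>j\<in>{1..n}. i \<noteq> j \<longrightarrow> \<not> red_edge k p x i j)"

definition span_of :: "nat \<Rightarrow> (nat \<Rightarrow> nat \<Rightarrow> real) \<Rightarrow> nat \<Rightarrow> (nat \<Rightarrow> real) set" where
  "span_of k x i = {y. \<exists>a :: nat \<Rightarrow> real. y = (\<lambda>j\<in>{..k}. \<Sum>m=1..i. a m * x m j)}"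

definition proj :: "nat \<Rightarrow> (nat \<Rightarrow> nat \<Rightarrow> real) \<Rightarrow> nat \<Rightarrow> (nat \<Rightarrow> real) \<Rightarrow> nat \<Rightarrow> real" where
  "proj k x i v = (THE y. y \<in> span_of k x i \<and> (\<forall>z \<in> span_of k x i. dot k (\<lambda>j. v j - y j) z = 0))"

definition perfect :: "real \<Rightarrow> nat \<Rightarrow> nat \<Rightarrow> nat \<Rightarrow> (nat \<Rightarrow> nat \<Rightarrow> real) \<Rightarrow> bool" where
  "perfect C l k n x \<longleftrightarrow>
     (\<forall>i. 1 \<le> i \<and> i + 1 \<le> n \<longrightarrow>
        L2_set (proj k x i (x (i + 1))) {..k} \<le> alpha_of C * sqrt (real l) / sqrt (real k))"

(* Law of the independent uniform points x_{s+1},...,x_r. *)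
definition points_law :: "nat \<Rightarrow> nat \<Rightarrow> nat \<Rightarrow> (nat \<Rightarrow> nat \<Rightarrow> real) measure" where
  "points_law k s r = PiM {s+1..r} (\<lambda>_. sphere_unif k)"

definition extend :: "nat \<Rightarrow> (nat \<Rightarrow> nat \<Rightarrow> real) \<Rightarrow> (nat \<Rightarrow> nat \<Rightarrow> real) \<Rightarrow> nat \<Rightarrow> nat \<Rightarrow> real" where
  "extend s x \<omega> = (\<lambda>i. if i \<le> s then x i else \<omega> i)"

definition P_red :: "nat \<Rightarrow> real \<Rightarrow> nat \<Rightarrow> nat \<Rightarrow> (nat \<Rightarrow> nat \<Rightarrow> real) \<Rightarrow> real" where
  "P_red k p r s x = measure (points_law k s r)
     {\<omega> \<in> space (points_law k s r). red_clique k p r (extend s x \<omega>)}"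

definition P_red_per :: "real \<Rightarrow> nat \<Rightarrow> nat \<Rightarrow> real \<Rightarrow> nat \<Rightarrow> nat \<Rightarrow> (nat \<Rightarrow> nat \<Rightarrow> real) \<Rightarrow> real" where
  "P_red_per C l k p r s x = measure (points_law k s r)
     {\<omega> \<in> space (points_law k s r). red_clique k p r (extend s x \<omega>) \<and> perfect C l k r (extend s x \<omega>)}"

definition P_blue :: "nat \<Rightarrow> real \<Rightarrow> nat \<Rightarrow> nat \<Rightarrow> (nat \<Rightarrow> nat \<Rightarrow> real) \<Rightarrow> real" where
  "P_blue k p r s x = measure (points_law k s r)
     {\<omega> \<in> space (points_law k s r). blue_clique k p r (extend s x \<omega>)}"

definition P_blue_per :: "real \<Rightarrow> nat \<Rightarrow> nat \<Rightarrow> real \<Rightarrow> nat \<Rightarrow> nat \<Rightarrow> (nat \<Rightarrow> nat \<Rightarrow> real) \<Rightarrow> real" where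
  "P_blue_per C l k p r s x = measure (points_law k s r)
     {\<omega> \<in> space (points_law k s r). blue_clique k p r (extend s x \<omega>) \<and> perfect C l k r (extend s x \<omega>)}"

end

theory Submission
  imports Defs "HOL-Real_Asymp.Real_Asymp"
begin

text \<open>A clique on \<open>n + 1\<close> points is perfect, or there is a first point that is too close to the span of its
  predecessors.  Deleting that point leaves a clique on \<open>n\<close> points, and the deleted point is bad with
  probability at most \<open>\<epsilon>\<close> given its predecessors, so \<open>P (n + 1) \<le> Pper (n + 1) + n \<epsilon> P n\<close>.
  Conversely a perfect clique extends by one point to a perfect clique with probability at least \<open>\<delta>\<close>, so
  \<open>\<delta> Pper n \<le> Pper (n + 1)\<close>.  As \<open>\<epsilon> / \<delta>\<close> is exponentially small compared with \<open>2 powr (- C l)\<close>, the claim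
  follows by induction on \<open>n\<close>.

  The bounds for \<open>\<epsilon>\<close> and \<open>\<delta>\<close> are computed with a Gaussian vector, whose direction is uniform on the sphere.
  For \<open>\<delta>\<close> one forces all coordinates of the new point with respect to the Gram-Schmidt basis of the
  perfect sequence into a fixed unit interval; since the basis is close to the sequence itself, this
  determines the colours of all new edges.\<close>

text \<open>Both rates are exponential in \<open>l\<close>, so constants decide. Write
  \<open>L = ln (10 / p_C)\<close> and \<open>B = C l\<close>. A new point must meet conditions
  against up to \<open>B\<close> predecessors, each at a constant price, which leaves
  \<open>\<delta>\<close> of order at least \<open>exp (- 19 L B)\<close>. A large projection costs
  about \<open>exp (- \<alpha>^2 l / 8)\<close>, and this is at most \<open>exp (- 50 L B)\<close>
  because \<open>\<alpha>\<close> is at least \<open>20 sqrt (C L)\<close>. \<open>L\<close> enters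
  because \<open>p > p_C\<close> bounds the threshold by \<open>2 sqrt L\<close>, uniformly in
  \<open>p\<close>. A large \<open>D\<close> makes the projections of a perfect sequence so short,
  of order \<open>\<alpha> / (D sqrt l)\<close>, that their accumulated effect over \<open>B\<close>
  points stays bounded; for a sequence that is not perfect, the coordinates would not control the
  inner products. Forcing a whole box of coordinates at once avoids estimating correlations between
  edges. The edges at a bad point are given up entirely, since its badness would be correlated with
  them.\<close>

section \<open>The equation defining \<open>p_C\<close>\<close>

text \<open>\<open>p_of C\<close> is a definite description, so existence and uniqueness come first.
  Clearing the denominator turns the equation into a zero of the strictly increasing function
  \<open>f\<close>.\<close>

lemma p_of_bounds:
  assumes "C > 1"
  shows "0 < p_of C" "p_of C < 1/2"
proof -
  define f where "f p = ln p - C * ln (1 - p)" for p :: real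
  have mono: "f a < f b" if "0 < a" "a < b" "b < 1/2" for a b
  proof -
    have "ln a < ln b" "ln (1 - b) < ln (1 - a)" using that by auto
    then show ?thesis using assms unfolding f_def
      by (smt (verit) mult_less_cancel_left_pos)
  qed
  have equiv: "C = ln p / ln (1 - p) \<longleftrightarrow> f p = 0" if "0 < p" "p < 1/2" for p
  proof -
    have "ln (1 - p) < 0" using that by simp
    then show ?thesis unfolding f_def by (auto simp: field_simps)
  qed
  \<comment> \<open>This is \<open>2 powr (- C)\<close>: there \<open>ln a = - C ln 2\<close>, while
    \<open>1 - a > 1/2\<close> makes \<open>- C ln (1 - a)\<close> smaller than
    \<open>C ln 2\<close>, so \<open>f a < 0\<close>.\<close>
  define a where "a = exp (- (C * ln 2))"
  have "C * ln 2 > 1 * ln 2" using assms by (intro mult_strict_right_mono) auto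
  then have "a < exp (- ln 2)" unfolding a_def by simp
  then have a: "0 < a" "a < 1/2" by (auto simp: a_def exp_minus)
  have "ln (1 - a) > - ln 2"
  proof -
    have "ln (1/2) < ln (1 - a)" using a by (intro ln_less_cancel_iff[THEN iffD2]) auto
    then show ?thesis by (simp add: ln_div)
  qed
  then have "C * ln (1 - a) > C * (- ln 2)" using assms by (intro mult_strict_left_mono) auto
  then have fa: "f a < 0" unfolding f_def a_def by simp
  have fh: "f (1/2) > 0" using assms unfolding f_def by (simp add: ln_div)
  have "\<exists>p\<ge>a. p \<le> 1/2 \<and> f p = 0"
    using a fa fh unfolding f_def
    by (intro IVT' continuous_intros) auto
  then obtain p where p: "a \<le> p" "p \<le> 1/2" "f p = 0" by blast
  have "p \<noteq> 1/2" using p(3) fh by (metis less_irrefl)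
  with a p have p': "0 < p" "p < 1/2" by linarith+
  have "\<exists>!p. 0 < p \<and> p < 1/2 \<and> C = ln p / ln (1 - p)"
    using p p' equiv mono by (metis less_irrefl linorder_neqE_linordered_idom)
  then have "0 < p_of C \<and> p_of C < 1/2 \<and> C = ln (p_of C) / ln (1 - p_of C)"
    unfolding p_of_def by (rule theI')
  then show "0 < p_of C" "p_of C < 1/2" by auto
qed

section \<open>Gaussian measures on products\<close>

interpretation lb: product_sigma_finite "\<lambda>_::nat. lborel :: real measure"
  by standard

abbreviation lebp :: "nat set \<Rightarrow> (nat \<Rightarrow> real) measure" where
  "lebp I \<equiv> PiM I (\<lambda>_. lborel)"

lemma sets_lebp: "sets (lebp I) = sets (PiM I (\<lambda>_. borel))"
  by (intro sets_PiM_cong) auto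

text \<open>Fubini splits off one coordinate at a time. It serves for scaling (cones), for
  \<open>c = - 1\<close> (reflection) and for \<open>c = 1\<close> (translation).\<close>

lemma nn_integral_lebp_affine:
  fixes f :: "(nat \<Rightarrow> real) \<Rightarrow> ennreal"
  assumes "finite I" "c \<noteq> 0" "f \<in> borel_measurable (lebp I)"
  shows "(\<integral>\<^sup>+u. f u \<partial>lebp I) = ennreal (\<bar>c\<bar> ^ card I) * (\<integral>\<^sup>+u. f (\<lambda>i\<in>I. t i + c * u i) \<partial>lebp I)"
  using assms(1,3)
proof (induction I arbitrary: f rule: finite_induct)
  case empty
  have "(\<lambda>i\<in>{}. t i + c * u i) = (\<lambda>_. undefined)" for u :: "nat \<Rightarrow> real" by auto
  then show ?case by (simp add: PiM_empty nn_integral_count_space_finite)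
next
  case (insert i I)
  note [simp] = insert.hyps
  note [measurable] = insert.prems
  let ?a = "\<lambda>x. \<lambda>i\<in>I. t i + c * x i"
  have 1: "(\<lambda>j\<in>insert i I. t j + c * (x(i := y)) j) = (?a x)(i := t i + c * y)" for x y
    by (auto simp: restrict_def fun_eq_iff)
  have "(\<integral>\<^sup>+u. f u \<partial>lebp (insert i I)) = (\<integral>\<^sup>+x. \<integral>\<^sup>+y. f (x(i := y)) \<partial>lborel \<partial>lebp I)"
    by (intro lb.product_nn_integral_insert) auto
  also have "\<dots> = ennreal (\<bar>c\<bar> ^ card I) * (\<integral>\<^sup>+x. \<integral>\<^sup>+y. f ((?a x)(i := y)) \<partial>lborel \<partial>lebp I)"
    by (intro insert.IH) measurable
  also have "(\<integral>\<^sup>+x. \<integral>\<^sup>+y. f ((?a x)(i := y)) \<partial>lborel \<partial>lebp I) =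
     (\<integral>\<^sup>+x. ennreal \<bar>c\<bar> * (\<integral>\<^sup>+y. f ((?a x)(i := t i + c * y)) \<partial>lborel) \<partial>lebp I)"
  proof (intro nn_integral_cong)
    fix x assume x: "x \<in> space (lebp I)"
    have [measurable]: "?a x \<in> space (lebp I)" by (auto simp: space_PiM)
    have "(\<lambda>y. f ((?a x)(i := y))) \<in> borel_measurable lborel"
      by (measurable)
    then show "(\<integral>\<^sup>+y. f ((?a x)(i := y)) \<partial>lborel) = ennreal \<bar>c\<bar> * (\<integral>\<^sup>+y. f ((?a x)(i := t i + c * y)) \<partial>lborel)"
      using assms(2) by (intro nn_integral_real_affine) auto
  qed
  also have "\<dots> = ennreal \<bar>c\<bar> * (\<integral>\<^sup>+x. \<integral>\<^sup>+y. f ((?a x)(i := t i + c * y)) \<partial>lborel \<partial>lebp I)"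
    by (intro nn_integral_cmult) measurable
  also have "(\<integral>\<^sup>+x. \<integral>\<^sup>+y. f ((?a x)(i := t i + c * y)) \<partial>lborel \<partial>lebp I) =
     (\<integral>\<^sup>+u. f (\<lambda>j\<in>insert i I. t j + c * u j) \<partial>lebp (insert i I))"
    unfolding 1[symmetric]
    by (rule lb.product_nn_integral_insert[symmetric]) (auto, measurable)
  finally show ?case
    by (simp only: card_insert_disjoint[OF insert.hyps] power_Suc ennreal_mult abs_ge_zero zero_le_power_abs mult_ac)
qed

text \<open>Encoded as a density over the Lebesgue product, not as a product of normal laws, so that
  changes of variables for Lebesgue measure apply directly.\<close>

definition gauss :: "nat set \<Rightarrow> (nat \<Rightarrow> real) measure" where
  "gauss I = density (lebp I) (\<lambda>u. ennreal (\<Prod>i\<in>I. std_normal_density (u i)))"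

lemma sets_gauss [measurable_cong]: "sets (gauss I) = sets (PiM I (\<lambda>_. borel))"
  unfolding gauss_def by (simp add: sets_lebp)

lemma space_gauss: "space (gauss I) = extensional I"
  unfolding gauss_def by (simp add: space_PiM PiE_UNIV_domain PiE_def)

lemma nn_integral_gauss:
  assumes "f \<in> borel_measurable (PiM I (\<lambda>_. borel))"
  shows "(\<integral>\<^sup>+u. f u \<partial>gauss I) = (\<integral>\<^sup>+u. ennreal (\<Prod>i\<in>I. std_normal_density (u i)) * f u \<partial>lebp I)"
proof -
  have [measurable]: "f \<in> borel_measurable (lebp I)"
    using assms by (simp cong: measurable_cong_sets add: sets_lebp)
  show ?thesis unfolding gauss_def
    by (intro nn_integral_density) measurable
qed

lemma nn_integral_gauss_prod:
  assumes "finite I" "\<And>i x. i \<in> I \<Longrightarrow> f i x \<ge> 0" and [measurable]: "\<And>i. i \<in> I \<Longrightarrow> f i \<in> borel_measurable borel"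
  shows "(\<integral>\<^sup>+u. ennreal (\<Prod>i\<in>I. f i (u i)) \<partial>gauss I)
    = (\<Prod>i\<in>I. \<integral>\<^sup>+x. ennreal (std_normal_density x * f i x) \<partial>lborel)"
proof -
  have "(\<integral>\<^sup>+u. ennreal (\<Prod>i\<in>I. f i (u i)) \<partial>gauss I)
     = (\<integral>\<^sup>+u. ennreal (\<Prod>i\<in>I. std_normal_density (u i)) * ennreal (\<Prod>i\<in>I. f i (u i)) \<partial>lebp I)"
    by (intro nn_integral_gauss) measurable
  also have "\<dots> = (\<integral>\<^sup>+u. (\<Prod>i\<in>I. ennreal (std_normal_density (u i) * f i (u i))) \<partial>lebp I)"
    using assms(2)
    by (intro nn_integral_cong) (simp add: prod_ennreal prod.distrib ennreal_mult[symmetric] prod_nonneg)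
  also have "\<dots> = (\<Prod>i\<in>I. \<integral>\<^sup>+x. ennreal (std_normal_density x * f i x) \<partial>lborel)"
    using assms(1) by (intro lb.product_nn_integral_prod) auto
  finally show ?thesis .
qed

lemma nn_integral_normal_density:
  assumes "\<sigma> > 0"
  shows "(\<integral>\<^sup>+x. ennreal (normal_density \<mu> \<sigma> x) \<partial>lborel) = 1"
  using assms by (subst nn_integral_eq_integral) auto

lemma prob_space_gauss:
  assumes "finite I" shows "prob_space (gauss I)"
proof
  have "emeasure (gauss I) (space (gauss I)) = (\<integral>\<^sup>+u. ennreal (\<Prod>i\<in>I. 1) \<partial>gauss I)"
    by simp
  also have "\<dots> = 1"
    using nn_integral_gauss_prod[OF assms, of "\<lambda>_ _. 1"] by (simp add: nn_integral_normal_density)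
  finally show "emeasure (gauss I) (space (gauss I)) = 1" .
qed

text \<open>Completing the square: tilting the standard normal density by \<open>exp (v x)\<close>
  gives \<open>exp (v^2 / 2)\<close> times the normal density with mean \<open>v\<close>.\<close>

lemma nn_integral_gauss_exp_linear:
  assumes "finite I"
  shows "(\<integral>\<^sup>+u. ennreal (exp (\<Sum>i\<in>I. w i * u i)) \<partial>gauss I) = ennreal (exp ((\<Sum>i\<in>I. (w i)\<^sup>2) / 2))"
proof -
  have "std_normal_density x * exp (v * x) = exp (v\<^sup>2 / 2) * normal_density v 1 x" for v x :: real
    by (simp add: normal_density_def exp_add[symmetric] power2_eq_square field_simps flip: exp_add)
  then have *: "(\<integral>\<^sup>+x. ennreal (std_normal_density x * exp (v * x)) \<partial>lborel) = ennreal (exp (v\<^sup>2 / 2))" for v :: real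
    by (simp add: ennreal_mult nn_integral_cmult nn_integral_normal_density)
  show ?thesis
    using nn_integral_gauss_prod[OF assms, of "\<lambda>i x. exp (w i * x)"] assms
    by (simp add: exp_sum * prod_ennreal sum_divide_distrib)
qed

text \<open>Tilting by \<open>exp (t x^2)\<close> gives \<open>s\<close> times the centred normal
  density of variance \<open>s^2 = 1 / (1 - 2 t)\<close>; each coordinate contributes one factor
  \<open>s\<close>.\<close>

lemma nn_integral_gauss_exp_square:
  assumes "finite I" "t < 1/2"
  shows "(\<integral>\<^sup>+u. ennreal (exp (t * (\<Sum>i\<in>I. (u i)\<^sup>2))) \<partial>gauss I) = ennreal ((1 / sqrt (1 - 2 * t)) ^ card I)"
proof -
  define s where "s = 1 / sqrt (1 - 2 * t)"
  have s: "s > 0" "s\<^sup>2 = 1 / (1 - 2 * t)" using assms(2) by (auto simp: power_divide s_def)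
  have "std_normal_density x * exp (t * x\<^sup>2) = s * normal_density 0 s x" for x :: real
  proof -
    have 1: "exp (- x\<^sup>2 / 2) * exp (t * x\<^sup>2) = exp (- x\<^sup>2 / (2 * s\<^sup>2))"
      using assms(2) by (simp add: s(2) field_simps flip: exp_add)
    have 2: "sqrt (2 * pi * s\<^sup>2) = sqrt (2 * pi) * s"
      using s(1) by (simp only: real_sqrt_mult real_sqrt_abs abs_of_pos)
    show ?thesis
      unfolding normal_density_def 2 using 1 s(1) by simp
  qed
  then have *: "(\<integral>\<^sup>+x. ennreal (std_normal_density x * exp (t * x\<^sup>2)) \<partial>lborel) = ennreal s"
    using s(1) nn_integral_normal_density[OF s(1)] by (simp add: ennreal_mult nn_integral_cmult)
  show ?thesis
    using nn_integral_gauss_prod[OF assms(1), of "\<lambda>i x. exp (t * x\<^sup>2)"] assms(1) s(1)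
    by (simp add: exp_sum sum_distrib_left * prod_ennreal ennreal_power flip: s_def)
qed

section \<open>The uniform measure on the sphere\<close>

abbreviation to_sphere :: "nat \<Rightarrow> (nat \<Rightarrow> real) \<Rightarrow> nat \<Rightarrow> real" where
  "to_sphere k \<equiv> \<lambda>u. \<lambda>j\<in>{..k}. u j / L2_set u {..k}"

abbreviation Rk :: "nat \<Rightarrow> (nat \<Rightarrow> real) measure" where
  "Rk k \<equiv> PiM {..k} (\<lambda>_. borel)"

lemma measurable_L2_set [measurable (raw)]:
  assumes "\<And>i. i \<in> I \<Longrightarrow> (\<lambda>x. f x i) \<in> borel_measurable M"
  shows "(\<lambda>x. L2_set (f x) I) \<in> borel_measurable M"
  unfolding L2_set_def using assms by measurable

text \<open>Taken at the norm of a vector, this represents the Gaussian density as a mixture of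
  indicators of balls.\<close>

lemma nn_integral_Rayleigh_tail:
  assumes "0 \<le> \<rho>"
  shows "(\<integral>\<^sup>+s. ennreal (s * exp (- (s\<^sup>2 / 2))) * indicator {\<rho>..} s \<partial>lborel) = ennreal (exp (- (\<rho>\<^sup>2 / 2)))"
proof -
  have "(\<integral>\<^sup>+s. ennreal (s * exp (- (s\<^sup>2 / 2))) * indicator {\<rho>..} s \<partial>lborel) = ennreal (0 - (- exp (- (\<rho>\<^sup>2 / 2))))"
  proof (rule nn_integral_FTC_atLeast)
    show "((\<lambda>s::real. - exp (- (s\<^sup>2 / 2))) \<longlongrightarrow> 0) at_top" by real_asymp
    show "((\<lambda>s. - exp (- (s\<^sup>2 / 2))) has_real_derivative s * exp (- (s\<^sup>2 / 2))) (at s)" for s :: real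
      by (auto intro!: derivative_eq_intros)
    show "0 \<le> s * exp (- (s\<^sup>2 / 2))" if "\<rho> \<le> s" for s using assms that by simp
  qed auto
  then show ?thesis by simp
qed

lemma prod_std_normal_density:
  assumes "finite I"
  shows "(\<Prod>i\<in>I. std_normal_density (u i)) = (1 / sqrt (2 * pi)) ^ card I * exp (- (L2_set u I)\<^sup>2 / 2)"
  by (simp add: std_normal_density_def L2_set_def sum_nonneg prod.distrib exp_sum[OF assms, symmetric]
      sum_negf sum_divide_distrib power_one_over prod_dividef)

lemma L2_set_scale:
  "L2_set (\<lambda>i\<in>I. c * u i) I = \<bar>c\<bar> * L2_set u I"
proof -
  have "L2_set (\<lambda>i\<in>I. c * u i) I = sqrt (c\<^sup>2 * (\<Sum>i\<in>I. (u i)\<^sup>2))"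
    by (simp add: L2_set_def power_mult_distrib sum_distrib_left)
  then show ?thesis by (simp add: L2_set_def real_sqrt_mult)
qed

text \<open>Both measures assign to a cone the Lebesgue measure of its part in the unit ball, up to a constant:
  for the Gaussian measure this is the layer-cake formula.\<close>

lemma sphere_unif_eq_gauss: "sphere_unif k = distr (gauss {..k}) (Rk k) (to_sphere k)"
proof -
  let ?I = "{..k}"
  let ?K = "(1 / sqrt (2 * pi)) ^ card ?I"
  let ?g = "\<lambda>s::real. ennreal (s * exp (- s\<^sup>2 / 2))"
  define Bl where "Bl = {u \<in> extensional ?I. L2_set u ?I \<le> 1}"
  have nm: "to_sphere k \<in> measurable (lebp ?I) (Rk k)" by measurable
  note [measurable] = nm
  have spl: "space (lebp ?I) = extensional ?I" by (simp add: space_PiM PiE_UNIV_domain PiE_def)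
  have Bl: "Bl = {u \<in> space (lebp ?I). L2_set u ?I \<le> 1}" unfolding Bl_def spl ..
  have [measurable]: "Bl \<in> sets (lebp ?I)" unfolding Bl by measurable
  have g: "emeasure (distr (gauss ?I) (Rk k) (to_sphere k)) A =
    ennreal ?K * (\<integral>\<^sup>+s. ennreal (s ^ card ?I) * (?g s * indicator {0..} s) \<partial>lborel) *
      emeasure (lebp ?I) (Bl \<inter> (to_sphere k -` A \<inter> space (lebp ?I)))" if A[measurable]: "A \<in> sets (Rk k)" for A
  proof -
    let ?h = "\<lambda>u. indicator A (to_sphere k u) :: ennreal"
    have "emeasure (distr (gauss ?I) (Rk k) (to_sphere k)) A = (\<integral>\<^sup>+u. indicator A u \<partial>distr (gauss ?I) (Rk k) (to_sphere k))"
      by (simp add: A)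
    also have "\<dots> = (\<integral>\<^sup>+u. ?h u \<partial>gauss ?I)"
      by (rule nn_integral_distr) (measurable)
    also have "\<dots> = (\<integral>\<^sup>+u. ennreal (?K * exp (- (L2_set u ?I)\<^sup>2 / 2)) * ?h u \<partial>lebp ?I)"
      by (subst nn_integral_gauss) (auto simp: prod_std_normal_density)
    also have "\<dots> = (\<integral>\<^sup>+u. \<integral>\<^sup>+s. ennreal ?K * (?g s * indicator {0..} s * (indicator {..s} (L2_set u ?I) * ?h u)) \<partial>lborel \<partial>lebp ?I)"
    proof (intro nn_integral_cong)
      fix u
      have "(\<integral>\<^sup>+s. ennreal ?K * (?g s * indicator {0..} s * (indicator {..s} (L2_set u ?I) * ?h u)) \<partial>lborel)
        = (\<integral>\<^sup>+s. ennreal ?K * (?g s * indicator {L2_set u ?I..} s * ?h u) \<partial>lborel)"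
        by (intro nn_integral_cong) (auto simp: indicator_def dest: order_trans[OF L2_set_nonneg])
      also have "\<dots> = ennreal ?K * (ennreal (exp (- (L2_set u ?I)\<^sup>2 / 2)) * ?h u)"
        by (simp add: nn_integral_cmult nn_integral_multc nn_integral_Rayleigh_tail)
      also have "\<dots> = ennreal (?K * exp (- (L2_set u ?I)\<^sup>2 / 2)) * ?h u"
        by (subst ennreal_mult) (simp_all add: mult.assoc)
      finally show "ennreal (?K * exp (- (L2_set u ?I)\<^sup>2 / 2)) * ?h u = (\<integral>\<^sup>+s. ennreal ?K * (?g s * indicator {0..} s * (indicator {..s} (L2_set u ?I) * ?h u)) \<partial>lborel)"
        by (rule sym)
    qed
    also have "\<dots> = (\<integral>\<^sup>+s. \<integral>\<^sup>+u. ennreal ?K * (?g s * indicator {0..} s * (indicator {..s} (L2_set u ?I) * ?h u)) \<partial>lebp ?I \<partial>lborel)"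
    proof (rule pair_sigma_finite.Fubini')
      show "pair_sigma_finite lborel (lebp ?I)"
        by (intro pair_sigma_finite.intro lb.sigma_finite sigma_finite_lborel) auto
      have [measurable]: "(\<lambda>x. L2_set (snd x) ?I) \<in> borel_measurable (lborel \<Otimes>\<^sub>M lebp ?I)"
        by (intro measurable_L2_set measurable_compose[OF measurable_snd]) simp
      have "Measurable.pred (lborel \<Otimes>\<^sub>M lebp ?I) (\<lambda>x. L2_set (snd x) ?I \<le> fst x)"
        unfolding pred_def by (intro borel_measurable_le) auto
      then show "(\<lambda>(s, u). ennreal ?K * (?g s * indicator {0..} s * (indicator {..s} (L2_set u ?I) * ?h u)))
        \<in> borel_measurable (lborel \<Otimes>\<^sub>M lebp ?I)"
        unfolding indicator_def[abs_def] atMost_iff by measurable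
    qed
    also have "\<dots> = (\<integral>\<^sup>+s. ennreal ?K * (?g s * indicator {0..} s) * (ennreal (s ^ card ?I) *
       emeasure (lebp ?I) (Bl \<inter> (to_sphere k -` A \<inter> space (lebp ?I)))) \<partial>lborel)"
    \<comment> \<open>Radius 0 is discarded because the substitution by \<open>s u\<close> must be
      invertible; negative radii have weight 0.\<close>
    proof (rule nn_integral_cong_AE, use AE_lborel_singleton[of "0::real"] in eventually_elim)
      fix s :: real assume "s \<noteq> 0"
      show "(\<integral>\<^sup>+u. ennreal ?K * (?g s * indicator {0..} s * (indicator {..s} (L2_set u ?I) * ?h u)) \<partial>lebp ?I)
        = ennreal ?K * (?g s * indicator {0..} s) * (ennreal (s ^ card ?I) *
       emeasure (lebp ?I) (Bl \<inter> (to_sphere k -` A \<inter> space (lebp ?I))))"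
      proof (cases "s > 0")
        case True
        have "(\<integral>\<^sup>+u. indicator {..s} (L2_set u ?I) * ?h u \<partial>lebp ?I) =
          ennreal (\<bar>s\<bar> ^ card ?I) * (\<integral>\<^sup>+u. indicator {..s} (L2_set (\<lambda>i\<in>?I. 0 + s * u i) ?I) * ?h (\<lambda>i\<in>?I. 0 + s * u i) \<partial>lebp ?I)"
          using \<open>s \<noteq> 0\<close> by (intro nn_integral_lebp_affine) (auto simp del: restrict_apply)
        also have "(\<integral>\<^sup>+u. indicator {..s} (L2_set (\<lambda>i\<in>?I. 0 + s * u i) ?I) * ?h (\<lambda>i\<in>?I. 0 + s * u i) \<partial>lebp ?I)
          = (\<integral>\<^sup>+u. indicator (Bl \<inter> (to_sphere k -` A \<inter> space (lebp ?I))) u \<partial>lebp ?I)"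
        proof (intro nn_integral_cong)
          fix u assume u: "u \<in> space (lebp ?I)"
          have L: "L2_set (\<lambda>i\<in>?I. 0 + s * u i) ?I = s * L2_set u ?I"
            using True L2_set_scale[of s u ?I] by simp
          \<comment> \<open>The direction is invariant under positive scaling, so only the radius
            constraint changes: the ball of radius \<open>s\<close> becomes
            \<open>Bl\<close>.\<close>
          have 1: "to_sphere k (\<lambda>i\<in>?I. 0 + s * u i) = to_sphere k u"
            unfolding L using True by (intro restrict_ext) simp
          have 2: "L2_set (\<lambda>i\<in>?I. 0 + s * u i) ?I \<le> s \<longleftrightarrow> L2_set u ?I \<le> 1"
            unfolding L using True by simp
          show "indicator {..s} (L2_set (\<lambda>i\<in>?I. 0 + s * u i) ?I) * ?h (\<lambda>i\<in>?I. 0 + s * u i)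
            = indicator (Bl \<inter> (to_sphere k -` A \<inter> space (lebp ?I))) u"
            unfolding 1 using u 2 by (auto simp: indicator_def Bl)
        qed
        also have "\<dots> = emeasure (lebp ?I) (Bl \<inter> (to_sphere k -` A \<inter> space (lebp ?I)))"
          by (intro nn_integral_indicator sets.Int measurable_sets[OF nm A]) measurable
        finally have *: "(\<integral>\<^sup>+u. indicator {..s} (L2_set u ?I) * ?h u \<partial>lebp ?I) = ennreal (s ^ card ?I) *
          emeasure (lebp ?I) (Bl \<inter> (to_sphere k -` A \<inter> space (lebp ?I)))" unfolding abs_of_pos[OF True] .
        have "(\<integral>\<^sup>+u. ennreal ?K * (?g s * indicator {0..} s * (indicator {..s} (L2_set u ?I) * ?h u)) \<partial>lebp ?I)
          = (\<integral>\<^sup>+u. (ennreal ?K * (?g s * indicator {0..} s)) * (indicator {..s} (L2_set u ?I) * ?h u) \<partial>lebp ?I)"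
          by (simp only: mult.assoc)
        also have "\<dots> = (ennreal ?K * (?g s * indicator {0..} s)) * (\<integral>\<^sup>+u. indicator {..s} (L2_set u ?I) * ?h u \<partial>lebp ?I)"
          by (intro nn_integral_cmult) measurable
        finally show ?thesis unfolding * .
      qed (use \<open>s \<noteq> 0\<close> in simp)
    qed
    also have "\<dots> = (\<integral>\<^sup>+s. (ennreal ?K * emeasure (lebp ?I) (Bl \<inter> (to_sphere k -` A \<inter> space (lebp ?I)))) *
         (ennreal (s ^ card ?I) * (?g s * indicator {0..} s)) \<partial>lborel)"
      by (simp add: mult_ac)
    also have "\<dots> = ennreal ?K * (\<integral>\<^sup>+s. ennreal (s ^ card ?I) * (?g s * indicator {0..} s) \<partial>lborel) *
      emeasure (lebp ?I) (Bl \<inter> (to_sphere k -` A \<inter> space (lebp ?I)))"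
      by (subst nn_integral_cmult) (measurable, simp add: mult_ac)
    finally show ?thesis .
  qed
  define Kc where "Kc = ennreal ?K * (\<integral>\<^sup>+s. ennreal (s ^ card ?I) * (?g s * indicator {0..} s) \<partial>lborel)"
  interpret G: prob_space "distr (gauss ?I) (Rk k) (to_sphere k)"
    by (intro prob_space.prob_space_distr prob_space_gauss) auto
  have "to_sphere k -` space (Rk k) \<inter> space (lebp ?I) = space (lebp ?I)"
    using measurable_space[OF nm] by auto
  then have "Bl \<inter> (to_sphere k -` space (Rk k) \<inter> space (lebp ?I)) = Bl" by (auto simp: Bl)
  \<comment> \<open>The constant is never computed. Total mass 1 identifies it as the reciprocal of
    the volume of the ball and shows on the way that this volume is neither zero nor
    infinite.\<close>
  with g[of "space (Rk k)"] G.emeasure_space_1 have 1: "Kc * emeasure (lebp ?I) Bl = 1"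
    by (simp add: Kc_def)
  have fin: "emeasure (lebp ?I) Bl \<noteq> 0" "emeasure (lebp ?I) Bl \<noteq> \<infinity>"
    using 1 by (auto simp: ennreal_mult_top split: if_splits)
  have cancel: "a * b * v / b = a * v" if "b \<noteq> 0" "b \<noteq> \<infinity>" for a b v :: ennreal
  proof -
    have "a * b * v = a * v * b" by (simp only: mult_ac)
    then show ?thesis using that by (simp add: ennreal_mult_divide_eq)
  qed
  show ?thesis
  proof (rule measure_eqI)
    show "sets (sphere_unif k) = sets (distr (gauss ?I) (Rk k) (to_sphere k))"
      by (simp add: sphere_unif_def)
    fix A assume "A \<in> sets (sphere_unif k)"
    then have A: "A \<in> sets (Rk k)" by (simp add: sphere_unif_def)
    have "emeasure (sphere_unif k) A = emeasure (lebp ?I) (Bl \<inter> (to_sphere k -` A \<inter> space (lebp ?I))) / emeasure (lebp ?I) Bl"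
      unfolding sphere_unif_def Bl_def[symmetric]
      using measurable_sets[OF nm A] A by (subst emeasure_distr) (auto cong: measurable_cong_sets)
    also have "\<dots> = Kc * emeasure (lebp ?I) Bl * emeasure (lebp ?I) (Bl \<inter> (to_sphere k -` A \<inter> space (lebp ?I))) / emeasure (lebp ?I) Bl"
      by (simp add: 1)
    also have "\<dots> = Kc * emeasure (lebp ?I) (Bl \<inter> (to_sphere k -` A \<inter> space (lebp ?I)))"
      using fin by (intro cancel) auto
    also have "\<dots> = emeasure (distr (gauss ?I) (Rk k) (to_sphere k)) A"
      using g[OF A] by (simp add: Kc_def)
    finally show "emeasure (sphere_unif k) A = emeasure (distr (gauss ?I) (Rk k) (to_sphere k)) A" .
  qed
qed

lemma space_sphere_unif: "space (sphere_unif k) = extensional {..k}"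
  by (simp add: sphere_unif_def space_PiM PiE_UNIV_domain PiE_def)

lemma sets_sphere_unif [measurable_cong]: "sets (sphere_unif k) = sets (Rk k)"
  by (simp add: sphere_unif_def)

lemma measurable_to_sphere [measurable]: "to_sphere k \<in> measurable (Rk k) (Rk k)"
  by measurable

lemma prob_space_sphere_unif: "prob_space (sphere_unif k)"
  unfolding sphere_unif_eq_gauss by (intro prob_space.prob_space_distr prob_space_gauss) auto

lemma measure_sphere_unif:
  assumes "A \<in> sets (Rk k)"
  shows "measure (sphere_unif k) A = measure (gauss {..k}) {u \<in> space (gauss {..k}). to_sphere k u \<in> A}"
proof -
  have "to_sphere k -` A \<inter> space (gauss {..k}) = {u \<in> space (gauss {..k}). to_sphere k u \<in> A}" by auto
  then show ?thesis unfolding sphere_unif_eq_gauss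
    using assms by (subst measure_distr) auto
qed

text \<open>The density is strictly positive, so both measures have the same null sets.\<close>

lemma AE_gauss_iff:
  assumes "finite I" and [measurable]: "Measurable.pred (PiM I (\<lambda>_. borel)) P"
  shows "(AE u in gauss I. P u) \<longleftrightarrow> (AE u in lebp I. P u)"
proof -
  have [measurable]: "Measurable.pred (lebp I) P"
    using assms(2) by (simp cong: measurable_cong_sets add: sets_lebp)
  have "0 < (\<Prod>i\<in>I. std_normal_density (u i))" for u
    by (intro prod_pos) (auto intro: normal_density_pos)
  then show ?thesis unfolding gauss_def
    by (subst AE_density) auto
qed

lemma AE_lebp_coordinate_nonzero:
  assumes "finite I" "i \<in> I"
  shows "AE u in lebp I. u i \<noteq> 0"
proof -
  have "(PiE I (\<lambda>j. if j = i then {0} else UNIV)) \<in> null_sets (lebp I)"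
  proof
    show "emeasure (lebp I) (PiE I (\<lambda>j. if j = i then {0} else UNIV)) = 0"
      using assms by (subst lb.emeasure_PiM) (auto intro!: bexI[of _ i])
    show "PiE I (\<lambda>j. if j = i then {0} else UNIV) \<in> sets (lebp I)"
      using assms by (intro sets_PiM_I_finite) auto
  qed
  then show ?thesis
    by (rule AE_I') (auto simp: space_PiM PiE_iff extensional_def)
qed

text \<open>Division by zero returns 0, so the zero vector is sent to itself and not to the sphere;
  therefore membership in the sphere holds only almost surely.\<close>

lemma L2_set_to_sphere: "L2_set (to_sphere k u) {..k} = (if L2_set u {..k} = 0 then 0 else 1)"
proof -
  have "to_sphere k u = (\<lambda>i\<in>{..k}. (1 / L2_set u {..k}) * u i)" by simp
  then show ?thesis by (simp only: L2_set_scale) simp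
qed

lemma AE_gauss_L2_pos: "AE u in gauss {..k}. L2_set u {..k} > 0"
proof -
  have "AE u in gauss {..k}. u 0 \<noteq> 0"
    by (subst AE_gauss_iff) (auto intro: AE_lebp_coordinate_nonzero)
  then show ?thesis
  proof eventually_elim
    case (elim u)
    then have "L2_set u {..k} \<noteq> 0" by (subst L2_set_eq_0_iff) auto
    then show ?case using L2_set_nonneg[of u "{..k}"] by linarith
  qed
qed

lemma AE_sphere_unif_unit: "AE y in sphere_unif k. y \<in> unit_sphere k"
  unfolding sphere_unif_eq_gauss
proof (subst AE_distr_iff)
  show "to_sphere k \<in> measurable (gauss {..k}) (Rk k)" by measurable
  have "{x \<in> space (Rk k). x \<in> unit_sphere k} = {x \<in> space (Rk k). L2_set x {..k} = 1}"
    by (auto simp: unit_sphere_def space_PiM PiE_def)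
  then show "{x \<in> space (Rk k). x \<in> unit_sphere k} \<in> sets (Rk k)" by simp measurable
  show "AE u in gauss {..k}. to_sphere k u \<in> unit_sphere k"
    using AE_gauss_L2_pos by eventually_elim (auto simp: unit_sphere_def L2_set_to_sphere)
qed

text \<open>For fixed remaining coordinates, at most two values of the coordinate \<open>u 0\<close> lie on a given cone.\<close>

lemma AE_gauss_not_on_cone:
  assumes "k \<ge> 1"
  shows "AE u in gauss {..k}. u 0 \<noteq> s * L2_set u {..k}"
proof -
  let ?I = "{1..k}" let ?P = "\<lambda>u. u 0 = s * L2_set u {..k}"
  have I: "{..k} = insert 0 ?I" by auto
  have m: "Measurable.pred (Rk k) ?P" unfolding pred_def by (intro borel_measurable_eq) measurable
  then have [measurable]: "Measurable.pred (lebp {..k}) ?P"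
    by (simp cong: measurable_cong_sets add: sets_lebp)
  have "emeasure (lebp {..k}) {u \<in> space (lebp {..k}). ?P u} = (\<integral>\<^sup>+u. indicator {u. ?P u} u \<partial>lebp {..k})"
    by (subst nn_integral_indicator[symmetric], measurable) (intro nn_integral_cong, simp add: indicator_def)
  also have "\<dots> = (\<integral>\<^sup>+x. \<integral>\<^sup>+y. indicator {u. ?P u} (x(0 := y)) \<partial>lborel \<partial>lebp ?I)"
  proof -
    have "indicator {u. ?P u} \<in> borel_measurable (lebp (insert 0 ?I))"
      unfolding I[symmetric] indicator_def[abs_def] by simp
    then show ?thesis unfolding I by (intro lb.product_nn_integral_insert) (auto simp flip: I)
  qed
  also have "\<dots> = (\<integral>\<^sup>+x. 0 \<partial>lebp ?I)"
  proof (rule nn_integral_cong_AE)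
    \<comment> \<open>By \<open>k \<ge> 1\<close> there is a coordinate besides \<open>u 0\<close>;
      it being nonzero makes \<open>R\<close> positive below.\<close>
    have "AE x in lebp ?I. x k \<noteq> 0"
      using assms by (intro AE_lebp_coordinate_nonzero) auto
    then show "AE x in lebp ?I. (\<integral>\<^sup>+y. indicator {u. ?P u} (x(0 := y)) \<partial>lborel) = 0"
    proof eventually_elim
    fix x :: "nat \<Rightarrow> real" assume xk: "x k \<noteq> 0"
    define R where "R = (\<Sum>i\<in>?I. (x i)\<^sup>2)"
    have "(x k)\<^sup>2 \<le> R" unfolding R_def using assms by (intro member_le_sum) auto
    moreover have "0 < (x k)\<^sup>2" using xk by simp
    ultimately have R: "R > 0" by linarith
    have L: "L2_set (x(0 := y)) {..k} = sqrt (y\<^sup>2 + R)" for y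
      unfolding L2_set_def I by (simp add: R_def)
    \<comment> \<open>Squaring \<open>y = s sqrt (y^2 + R)\<close> gives
      \<open>y^2 (1 - s^2) = s^2 R\<close>; since \<open>R > 0\<close>, the case
      \<open>s^2 = 1\<close> is impossible and \<open>y^2 = q\<close>.\<close>
    define q where "q = s\<^sup>2 * R / (1 - s\<^sup>2)"
    have "y \<in> {sqrt q, - sqrt q}" if "y = s * sqrt (y\<^sup>2 + R)" for y
    proof -
      have "y\<^sup>2 = s\<^sup>2 * (y\<^sup>2 + R)" using R
        by (subst that) (simp add: power_mult_distrib)
      then have *: "y\<^sup>2 * (1 - s\<^sup>2) = s\<^sup>2 * R" by (simp add: algebra_simps)
      have "s\<^sup>2 \<noteq> 1" using * R by auto
      then have "y\<^sup>2 = q" using * by (simp add: q_def field_simps)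
      then have "sqrt q = \<bar>y\<bar>" by (metis real_sqrt_abs)
      then show ?thesis by auto
    qed
    then have "{y. ?P (x(0 := y))} \<subseteq> {sqrt q, - sqrt q}" by (auto simp: L)
    then have "emeasure lborel {y. ?P (x(0 := y))} = 0"
      by (intro emeasure_lborel_countable) (meson countable_finite finite.intros finite_subset)
    moreover have "indicator {u. ?P u} (x(0 := y)) = (indicator {y. ?P (x(0 := y))} y :: ennreal)" for y
      by (simp add: indicator_def)
    moreover have "{y. ?P (x(0 := y))} \<in> sets lborel" unfolding L by simp
    ultimately show "(\<integral>\<^sup>+y. indicator {u. ?P u} (x(0 := y)) \<partial>lborel) = 0" by simp
    qed
  qed
  finally have "AE u in lebp {..k}. u 0 \<noteq> s * L2_set u {..k}"
    by (subst AE_iff_measurable[OF _ refl]) (auto intro: pred_sets1)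
  then show ?thesis using m by (subst AE_gauss_iff) (auto simp: pred_intros_logic)
qed

text \<open>With the other coordinates fixed, the admissible values of \<open>u 0\<close> form an
  open set. An explicit element shows that it is nonempty, hence not negligible. This gives the
  uniqueness of the quantile.\<close>

lemma gauss_between_cones_pos:
  assumes "k \<ge> 1" "- 1 \<le> s" "s < t" "t \<le> 0"
  shows "\<not> (AE u in gauss {..k}. \<not> (s * L2_set u {..k} < u 0 \<and> u 0 < t * L2_set u {..k}))"
proof
  assume ae: "AE u in gauss {..k}. \<not> (s * L2_set u {..k} < u 0 \<and> u 0 < t * L2_set u {..k})"
  let ?I = "{1..k}" let ?P = "\<lambda>u. s * L2_set u {..k} < u 0 \<and> u 0 < t * L2_set u {..k}"
  have I: "{..k} = insert 0 ?I" by auto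
  have [measurable]: "Measurable.pred (lebp {..k}) ?P" by measurable
  have mi: "indicator {u. ?P u} \<in> borel_measurable (lebp (insert 0 ?I))"
    unfolding I[symmetric] indicator_def[abs_def] by simp
  have "AE u in lebp {..k}. \<not> ?P u" using ae by (subst (asm) AE_gauss_iff) auto
  then have "AE u in lebp {..k}. indicator {u. ?P u} u = (0::ennreal)"
    by eventually_elim (simp add: indicator_def)
  then have "(\<integral>\<^sup>+u. indicator {u. ?P u} u \<partial>lebp (insert 0 ?I)) = 0"
    unfolding I[symmetric] using mi by (subst nn_integral_0_iff_AE) (auto simp flip: I)
  then have "(\<integral>\<^sup>+x. \<integral>\<^sup>+y. indicator {u. ?P u} (x(0 := y)) \<partial>lborel \<partial>lebp ?I) = 0"
    using mi by (subst (asm) lb.product_nn_integral_insert) auto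
  moreover have "(\<lambda>x. \<integral>\<^sup>+y. indicator {u. ?P u} (x(0 := y)) \<partial>lborel) \<in> borel_measurable (lebp ?I)"
  proof -
    have "(\<lambda>(x, y). indicator {u. ?P u} (x(0 := y)) :: ennreal) \<in> borel_measurable (lebp ?I \<Otimes>\<^sub>M lborel)"
      using measurable_compose[OF measurable_add_dim mi] by (simp add: split_beta')
    then show ?thesis by (intro lborel.borel_measurable_nn_integral) simp
  qed
  ultimately have "AE x in lebp ?I. (\<integral>\<^sup>+y. indicator {u. ?P u} (x(0 := y)) \<partial>lborel) = 0"
    by (subst (asm) nn_integral_0_iff_AE) auto
  moreover have "AE x in lebp ?I. x k \<noteq> 0"
    using assms by (intro AE_lebp_coordinate_nonzero) auto
  ultimately have "AE x in lebp ?I. False"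
  proof eventually_elim
    fix x :: "nat \<Rightarrow> real" assume int: "(\<integral>\<^sup>+y. indicator {u. ?P u} (x(0 := y)) \<partial>lborel) = 0" and xk: "x k \<noteq> 0"
    define R where "R = (\<Sum>i\<in>?I. (x i)\<^sup>2)"
    have "(x k)\<^sup>2 \<le> R" unfolding R_def using assms by (intro member_le_sum) auto
    moreover have "0 < (x k)\<^sup>2" using xk by simp
    ultimately have R: "R > 0" by linarith
    have L: "L2_set (x(0 := y)) {..k} = sqrt (y\<^sup>2 + R)" for y
      unfolding L2_set_def I by (simp add: R_def)
    define S where "S = {y. s * sqrt (y\<^sup>2 + R) < y \<and> y < t * sqrt (y\<^sup>2 + R)}"
    have "open S" unfolding S_def by (intro open_Collect_conj open_Collect_less continuous_intros)
    have "indicator {u. ?P u} (x(0 := y)) = (indicator S y :: ennreal)" for y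
      by (simp add: indicator_def S_def L)
    with int \<open>open S\<close> have "emeasure lborel S = 0" by simp
    then have "negligible S" using \<open>open S\<close>
      by (subst negligible_iff_null_sets) (auto simp: null_sets_completionI null_sets_def)
    then have "S = {}" using \<open>open S\<close> open_not_negligible by blast
    define a where "a = - (s + t) / 2"
    have a: "0 < a" "a < 1" "s < - a" "- a < t" using assms by (auto simp: a_def field_simps)
    then have a2: "a\<^sup>2 < 1" by (simp add: power_less_one_iff)
    \<comment> \<open>Solves \<open>y = - a sqrt (y^2 + R)\<close>, where \<open>- a\<close> is the
      midpoint of \<open>s\<close> and \<open>t\<close>.\<close>
    define y where "y = - a * sqrt (R / (1 - a\<^sup>2))"
    have "y\<^sup>2 + R = R / (1 - a\<^sup>2)" using a2 R
      by (simp add: y_def power_mult_distrib) (simp add: field_simps)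
    moreover have "sqrt (R / (1 - a\<^sup>2)) > 0" using a2 R by simp
    moreover have "s * q < - a * q \<and> - a * q < t * q" if "q > 0" for q
      using a that by (intro conjI mult_strict_right_mono) auto
    ultimately have "y \<in> S" unfolding S_def by (simp only: mem_Collect_eq y_def)
    with \<open>S = {}\<close> show False by simp
  qed
  then have "emeasure (lebp ?I) (space (lebp ?I)) = 0" by (simp add: AE_iff_null null_sets_def)
  moreover have "space (lebp ?I) = PiE ?I (\<lambda>_. UNIV)" by (simp add: space_PiM)
  ultimately show False using lb.emeasure_PiM[of ?I "\<lambda>_. UNIV"] by simp
qed

section \<open>Norm tails and the threshold\<close>

lemma measure_exp_Markov:
  assumes "prob_space M" and [measurable]: "h \<in> borel_measurable M"
    and b: "(\<integral>\<^sup>+x. ennreal (exp (h x)) \<partial>M) \<le> ennreal b" "b \<ge> 0"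
  shows "measure M {x \<in> space M. a \<le> h x} \<le> exp (- a) * b"
proof -
  interpret prob_space M by fact
  have "emeasure M {x \<in> space M. a \<le> h x} = (\<integral>\<^sup>+x. indicator {x \<in> space M. a \<le> h x} x \<partial>M)"
    by simp
  also have "\<dots> \<le> (\<integral>\<^sup>+x. ennreal (exp (- a)) * ennreal (exp (h x)) \<partial>M)"
    by (intro nn_integral_mono)
      (auto simp: indicator_def ennreal_mult[symmetric] simp flip: exp_add)
  also have "\<dots> = ennreal (exp (- a)) * (\<integral>\<^sup>+x. ennreal (exp (h x)) \<partial>M)"
    by (intro nn_integral_cmult) measurable
  also have "\<dots> \<le> ennreal (exp (- a)) * ennreal b"
    using b by (intro mult_left_mono) auto
  finally show ?thesis
    using b(2) by (simp add: emeasure_eq_measure flip: ennreal_mult)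
qed

lemma L2_set_square: "(L2_set u I)\<^sup>2 = (\<Sum>i\<in>I. (u i)\<^sup>2)"
  by (simp add: L2_set_def sum_nonneg)

text \<open>Markov for \<open>exp (- |u|^2 / 2)\<close>, whose mean is
  \<open>2 powr (- (k + 1) / 2)\<close>. The resulting rate \<open>1/4 - ln 2 / 2\<close> is below
  \<open>- 1/20\<close> since \<open>ln 2 \<ge> 2/3\<close>.\<close>

lemma gauss_norm_lower_tail:
  "measure (gauss {..k}) {u \<in> space (gauss {..k}). (L2_set u {..k})\<^sup>2 \<le> real k / 2} \<le> exp (- real k / 20)"
proof -
  have eq: "(L2_set u {..k})\<^sup>2 \<le> real k / 2 \<longleftrightarrow> - real k / 4 \<le> - (1/2) * (\<Sum>i\<le>k. (u i)\<^sup>2)" for u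
    by (auto simp: L2_set_square)
  have "measure (gauss {..k}) {u \<in> space (gauss {..k}). - real k / 4 \<le> - (1/2) * (\<Sum>i\<le>k. (u i)\<^sup>2)}
     \<le> exp (- (- real k / 4)) * (1 / sqrt 2) ^ (k + 1)"
    using nn_integral_gauss_exp_square[of "{..k}" "-(1/2)"]
    by (intro measure_exp_Markov prob_space_gauss) auto
  also have "(1 / sqrt 2) ^ (k + 1) \<le> (1 / sqrt 2 :: real) ^ k"
    by (intro power_decreasing) auto
  also have "1 / sqrt 2 = exp (- ln 2 / 2)"
    by (simp add: exp_minus inverse_eq_divide ln_sqrt[symmetric])
  also have "exp (- ln 2 / 2) ^ k = exp (real k * (- ln 2 / 2))"
    using exp_of_nat_mult[of k "- ln 2 / 2 :: real"] by simp
  also have "exp (- (- real k / 4)) * exp (real k * (- ln 2 / 2)) = exp (real k * (1/4 - ln 2 / 2))"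
    by (simp add: algebra_simps flip: exp_add)
  also have "\<dots> \<le> exp (real k * (- 1/20))"
    using ln2_ge_two_thirds by (intro exp_le_cancel_iff[THEN iffD2] mult_left_mono) auto
  finally show ?thesis unfolding eq by simp
qed

text \<open>Markov for \<open>exp (|u|^2 / 4)\<close> gives the rate \<open>ln 2 - 1\<close>. It is
  rounded to the same \<open>- 1/20\<close> as in the lower tail, so that one error term serves
  both.\<close>

lemma gauss_norm_upper_tail:
  assumes "k \<ge> 1"
  shows "measure (gauss {..k}) {u \<in> space (gauss {..k}). (L2_set u {..k})\<^sup>2 \<ge> 4 * real k} \<le> exp (- real k / 20)"
proof -
  have eq: "(L2_set u {..k})\<^sup>2 \<ge> 4 * real k \<longleftrightarrow> real k \<le> 1/4 * (\<Sum>i\<le>k. (u i)\<^sup>2)" for u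
    by (auto simp: L2_set_square)
  have s2: "1 / sqrt (1 - 2 * (1/4)) = sqrt (2::real)" by (simp add: real_sqrt_divide)
  have "measure (gauss {..k}) {u \<in> space (gauss {..k}). real k \<le> 1/4 * (\<Sum>i\<le>k. (u i)\<^sup>2)}
     \<le> exp (- real k) * sqrt 2 ^ (k + 1)"
    using nn_integral_gauss_exp_square[of "{..k}" "1/4"] unfolding s2
    by (intro measure_exp_Markov prob_space_gauss) auto
  also have "sqrt 2 ^ (k + 1) \<le> (sqrt 2 :: real) ^ (2 * k)"
    using assms by (intro power_increasing) auto
  also have "sqrt 2 ^ (2 * k) = (2::real) ^ k" by (simp add: power_mult)
  also have "(2::real) ^ k = exp (real k * ln 2)" by (simp add: exp_of_nat_mult)
  also have "exp (- real k) * exp (real k * ln 2) = exp (real k * (ln 2 - 1))"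
    by (simp add: algebra_simps flip: exp_add)
  also have "\<dots> \<le> exp (real k * (- 1/20))"
    using ln2_le_25_over_36 by (intro exp_le_cancel_iff[THEN iffD2] mult_left_mono) auto
  finally show ?thesis unfolding eq by simp
qed

lemma dot_e_zero: "dot k x (e_zero k) = x 0"
  unfolding dot_def e_zero_def by (subst sum.mono_neutral_cong_right[of _ "{0}"]) auto

abbreviation first_coord_le :: "nat \<Rightarrow> real \<Rightarrow> (nat \<Rightarrow> real) set" where
  "first_coord_le k t \<equiv> {y \<in> space (sphere_unif k). y 0 \<le> t}"

lemma sphere_first_coord_eq_gauss:
  "measure (sphere_unif k) (first_coord_le k t) =
    measure (gauss {..k}) {u \<in> space (gauss {..k}). u 0 / L2_set u {..k} \<le> t}"
proof -
  have "first_coord_le k t \<in> sets (sphere_unif k)" by measurable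
  then have "first_coord_le k t \<in> sets (Rk k)" by (simp add: sets_sphere_unif)
  then show ?thesis
    by (subst measure_sphere_unif)
      (auto simp: space_gauss space_sphere_unif intro!: arg_cong[where f="measure _"])
qed

lemma measure_gauss_reflect:
  "measure (gauss {..k}) {u \<in> space (gauss {..k}). u 0 \<le> 0} =
   measure (gauss {..k}) {u \<in> space (gauss {..k}). 0 \<le> u 0}"
proof -
  have e: "emeasure (gauss {..k}) {u \<in> space (gauss {..k}). P (u 0)} =
    (\<integral>\<^sup>+u. ennreal (\<Prod>i\<le>k. std_normal_density (u i)) * indicator {x. P x} (u 0) \<partial>lebp {..k})"
    if [measurable]: "Measurable.pred borel P" for P
  proof -
    have "emeasure (gauss {..k}) {u \<in> space (gauss {..k}). P (u 0)} =
      (\<integral>\<^sup>+u. indicator {x. P x} (u 0) \<partial>gauss {..k})"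
      by (subst nn_integral_indicator[symmetric], measurable) (intro nn_integral_cong, simp add: indicator_def)
    then show ?thesis by (subst (asm) nn_integral_gauss) auto
  qed
  have "emeasure (gauss {..k}) {u \<in> space (gauss {..k}). u 0 \<le> 0} =
    (\<integral>\<^sup>+u. ennreal (\<Prod>i\<le>k. std_normal_density (u i)) * indicator {x. x \<le> 0} (u 0) \<partial>lebp {..k})"
    by (intro e) measurable
  also have "\<dots> = (\<integral>\<^sup>+u. ennreal (\<Prod>i\<le>k. std_normal_density (- u i)) * indicator {x. x \<le> 0} (- u 0) \<partial>lebp {..k})"
    by (subst nn_integral_lebp_affine[of _ "-1" _ "\<lambda>_. 0"]) auto
  also have "\<dots> = emeasure (gauss {..k}) {u \<in> space (gauss {..k}). 0 \<le> u 0}"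
    by (subst e) (auto simp: normal_density_def indicator_def intro!: nn_integral_cong)
  finally show ?thesis by (simp add: measure_def)
qed

text \<open>The threshold is a definite description. Existence: the first coordinate has no atoms
  because cones are null sets, so its distribution function is continuous. Uniqueness: the part of
  the sphere between two cones has positive mass.\<close>

lemma ex_sphere_quantile:
  assumes k: "k \<ge> 1" and p: "0 < p" "p < 1/2"
  shows "\<exists>!c. 0 \<le> c \<and> measure (sphere_unif k) (first_coord_le k (- c / sqrt (real k))) = p"
proof -
  interpret S: prob_space "sphere_unif k" by (rule prob_space_sphere_unif)
  interpret G: prob_space "gauss {..k}" by (rule prob_space_gauss) simp
  define X where "X = distr (sphere_unif k) borel (\<lambda>y. y 0)"
  have Xm[measurable]: "(\<lambda>y. y 0) \<in> borel_measurable (sphere_unif k)" by measurable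
  interpret X: real_distribution X
    unfolding X_def real_distribution_def real_distribution_axioms_def
    by (auto intro: S.prob_space_distr)
  have cdf: "cdf X t = measure (sphere_unif k) (first_coord_le k t)" for t
    unfolding cdf_def X_def by (subst measure_distr) (auto intro!: arg_cong[where f="measure _"])
  have "AE y in sphere_unif k. y 0 \<noteq> t" for t
    unfolding sphere_unif_eq_gauss
  proof (subst AE_distr_iff)
    show "AE u in gauss {..k}. to_sphere k u 0 \<noteq> t"
      using AE_gauss_not_on_cone[OF k, of t] AE_gauss_L2_pos[of k]
      by eventually_elim (auto simp: field_simps)
  qed auto
  then have "AE y in X. y \<noteq> t" for t unfolding X_def by (subst AE_distr_iff) auto
  then have "measure X {t} = 0" for t
    by (subst X.prob_eq_0) auto
  then have cont: "continuous_on A (cdf X)" for A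
    by (auto simp: X.isCont_cdf intro!: continuous_at_imp_continuous_on)
  have unit: "AE y in sphere_unif k. - 1 \<le> y 0"
    using AE_sphere_unif_unit
  proof eventually_elim
    case (elim y)
    have "(y 0)\<^sup>2 \<le> (L2_set y {..k})\<^sup>2"
      unfolding L2_set_square by (intro member_le_sum) auto
    then have "\<bar>y 0\<bar> \<le> 1" using elim by (simp add: unit_sphere_def abs_square_le_1)
    then show ?case by linarith
  qed
  have zero: "cdf X t = 0" if "t < - 1" for t
    unfolding cdf using unit that by (subst S.prob_eq_0) (auto elim: eventually_mono)
  \<comment> \<open>The half-spaces on both sides of 0 have equal mass and cover the space. With
    \<open>p < 1/2\<close> this puts the quantile to the left of 0, hence
    \<open>0 \<le> c\<close>.\<close>
  have half: "cdf X 0 \<ge> 1/2"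
  proof -
    have eq: "u 0 / L2_set u {..k} \<le> 0 \<longleftrightarrow> u 0 \<le> 0" for u
    proof (cases "L2_set u {..k} = 0")
      case True
      then have "u 0 = 0" by (subst (asm) L2_set_eq_0_iff) auto
      then show ?thesis by simp
    next
      case False
      then have "L2_set u {..k} > 0" using L2_set_nonneg[of u "{..k}"] by linarith
      then show ?thesis by (simp add: divide_le_0_iff)
    qed
    have "1 = measure (gauss {..k}) ({u \<in> space (gauss {..k}). u 0 \<le> 0} \<union> {u \<in> space (gauss {..k}). 0 \<le> u 0})"
      by (subst G.prob_space[symmetric]) (auto intro!: arg_cong[where f="measure _"])
    also have "\<dots> \<le> measure (gauss {..k}) {u \<in> space (gauss {..k}). u 0 \<le> 0} + measure (gauss {..k}) {u \<in> space (gauss {..k}). 0 \<le> u 0}"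
      by (intro measure_Un_le) measurable
    finally show ?thesis
      unfolding cdf sphere_first_coord_eq_gauss eq by (simp add: measure_gauss_reflect)
  qed
  have sk: "sqrt (real k) > 0" using k by simp
  have "\<exists>t\<ge>-2. t \<le> 0 \<and> cdf X t = p"
    using zero[of "-2"] half p by (intro IVT' cont) auto
  then obtain t where t: "t \<le> 0" "cdf X t = p" by blast
  have ex: "0 \<le> - t * sqrt (real k) \<and> cdf X (- (- t * sqrt (real k)) / sqrt (real k)) = p"
    using t sk by (simp add: mult_nonpos_nonneg)
  have less: False if c: "0 \<le> c" "c < d" "cdf X (- c / sqrt (real k)) = p" "cdf X (- d / sqrt (real k)) = p" for c d
  proof -
    let ?s = "- d / sqrt (real k)" let ?t = "- c / sqrt (real k)"
    have st: "?s < ?t" "?t \<le> 0" using c sk by (auto simp: divide_strict_right_mono)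
    \<comment> \<open>To the left of \<open>- 1\<close> the distribution function is 0, which
      differs from \<open>p\<close>.\<close>
    have s: "- 1 \<le> ?s" using zero[of ?s] c p by fastforce
    have "measure X {?s<..?t} = 0" using X.cdf_diff_eq[OF st(1)] c by simp
    then have "AE y in X. \<not> (y \<in> {?s<..?t})"
      by (subst (asm) X.prob_eq_0) auto
    then have "AE y in sphere_unif k. \<not> (?s < y 0 \<and> y 0 \<le> ?t)"
      unfolding X_def by (subst (asm) AE_distr_iff) auto
    then have "AE u in gauss {..k}. \<not> (?s < to_sphere k u 0 \<and> to_sphere k u 0 \<le> ?t)"
      unfolding sphere_unif_eq_gauss by (subst (asm) AE_distr_iff) auto
    then have "AE u in gauss {..k}. \<not> (?s * L2_set u {..k} < u 0 \<and> u 0 < ?t * L2_set u {..k})"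
      using AE_gauss_L2_pos[of k]
    proof eventually_elim
      case (elim u)
      then show ?case by (auto simp: less_divide_eq divide_le_eq simp del: minus_divide_left)
    qed
    with gauss_between_cones_pos[OF k s st] show False by simp
  qed
  show ?thesis
    unfolding cdf[symmetric] using ex less by (metis linorder_neqE_linordered_idom)
qed

lemma c_thr:
  assumes "k \<ge> 1" "0 < p" "p < 1/2"
  shows "0 \<le> c_thr k p" "measure (sphere_unif k) (first_coord_le k (- c_thr k p / sqrt (real k))) = p"
  using theI'[OF ex_sphere_quantile[OF assms]] unfolding c_thr_def dot_e_zero by auto

text \<open>If the norm is at least \<open>sqrt (k / 2)\<close>, the cap forces
  \<open>u 0 \<le> - c / sqrt 2\<close>. The exponential Markov bound for this half-space gives
  \<open>exp (- s^2 / 2)\<close> with \<open>s = c / sqrt 2\<close>. Read backwards, the lemma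
  bounds the threshold from above in terms of \<open>p\<close>.\<close>

lemma c_thr_tail:
  assumes k: "k \<ge> 1" and p: "0 < p" "p < 1/2"
  shows "p \<le> exp (- (c_thr k p)\<^sup>2 / 4) + exp (- real k / 20)"
proof -
  interpret G: prob_space "gauss {..k}" by (rule prob_space_gauss) simp
  let ?c = "c_thr k p" let ?s = "c_thr k p / sqrt 2"
  let ?A = "{u \<in> space (gauss {..k}). (L2_set u {..k})\<^sup>2 \<le> real k / 2}"
  let ?B = "{u \<in> space (gauss {..k}). ?s\<^sup>2 \<le> (\<Sum>i\<le>k. (if i = 0 then - ?s else 0) * u i)}"
  note c = c_thr[OF assms]
  have lin: "(\<Sum>i\<le>k. (if i = 0 then - ?s else 0) * u i) = - ?s * u 0" for u :: "nat \<Rightarrow> real"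
    by (subst sum.mono_neutral_cong_right[of _ "{0}"]) auto
  have sq: "(\<Sum>i\<le>k. (if i = 0 then - ?s else 0)\<^sup>2) = ?s\<^sup>2"
    by (subst sum.mono_neutral_cong_right[of _ "{0}"]) auto
  have "p = measure (gauss {..k}) {u \<in> space (gauss {..k}). u 0 / L2_set u {..k} \<le> - ?c / sqrt (real k)}"
    using c(2) by (simp add: sphere_first_coord_eq_gauss)
  also have "\<dots> \<le> measure (gauss {..k}) (?B \<union> ?A)"
  proof (intro G.finite_measure_mono subsetI)
    fix u assume u: "u \<in> {u \<in> space (gauss {..k}). u 0 / L2_set u {..k} \<le> - ?c / sqrt (real k)}"
    show "u \<in> ?B \<union> ?A"
    proof (cases "(L2_set u {..k})\<^sup>2 \<le> real k / 2")
      case False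
      have "L2_set u {..k} > sqrt (real k / 2)"
        using False by (intro real_less_lsqrt) (auto simp: L2_set_nonneg)
      then have L: "L2_set u {..k} > 0" "sqrt (real k) / sqrt 2 \<le> L2_set u {..k}"
        by (auto simp: real_sqrt_divide intro: le_less_trans[rotated])
      have "u 0 \<le> - (?c / sqrt (real k)) * L2_set u {..k}"
        using u L by (simp add: divide_le_eq)
      also have "\<dots> \<le> - (?c / sqrt (real k)) * (sqrt (real k) / sqrt 2)"
        using c(1) L by (intro mult_left_mono_neg) auto
      also have "\<dots> = - ?s" using k by simp
      finally have "?s * ?s \<le> ?s * (- u 0)" using c(1) by (intro mult_left_mono) auto
      then show ?thesis using u unfolding lin by (simp add: power2_eq_square)
    qed (use u in simp)
  qed measurable
  also have "\<dots> \<le> measure (gauss {..k}) ?B + measure (gauss {..k}) ?A"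
    by (intro measure_Un_le) measurable
  also have "measure (gauss {..k}) ?B \<le> exp (- ?s\<^sup>2) * exp (?s\<^sup>2 / 2)"
    using nn_integral_gauss_exp_linear[of "{..k}" "\<lambda>i. if i = 0 then - ?s else 0"]
    unfolding sq by (intro measure_exp_Markov G.prob_space_axioms) auto
  also have "exp (- ?s\<^sup>2) * exp (?s\<^sup>2 / 2) = exp (- ?c\<^sup>2 / 4)"
    by (simp add: power_divide flip: exp_add)
  also note gauss_norm_lower_tail
  finally show ?thesis by simp
qed

section \<open>Projections of a Gaussian vector\<close>

lemma dot_commute: "dot k x y = dot k y x"
  by (simp add: dot_def mult.commute)

lemma dot_add: "dot k (\<lambda>j. x j + y j) z = dot k x z + dot k y z"
  by (simp add: dot_def algebra_simps sum.distrib)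

lemma dot_diff: "dot k (\<lambda>j. x j - y j) z = dot k x z - dot k y z"
  by (simp add: dot_def algebra_simps sum_subtractf)

lemma dot_scale: "dot k (\<lambda>j. c * x j) z = c * dot k x z"
  by (simp add: dot_def algebra_simps sum_distrib_left)

lemma dot_sum: "dot k (\<lambda>j. \<Sum>m\<in>J. f m j) z = (\<Sum>m\<in>J. dot k (f m) z)"
  unfolding dot_def sum_distrib_right by (rule sum.swap)

lemma dot_restrict: "dot k (\<lambda>j\<in>{..k}. x j) z = dot k x z"
  by (simp add: dot_def)

lemma dot_self: "dot k x x = (L2_set x {..k})\<^sup>2"
  unfolding dot_def L2_set_square by (simp add: power2_eq_square)

lemma measurable_dot [measurable (raw)]:
  assumes "\<And>j. j \<le> k \<Longrightarrow> (\<lambda>x. f x j) \<in> borel_measurable M" "\<And>j. j \<le> k \<Longrightarrow> (\<lambda>x. g x j) \<in> borel_measurable M"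
  shows "(\<lambda>x. dot k (f x) (g x)) \<in> borel_measurable M"
  unfolding dot_def using assms by measurable

text \<open>Zero vectors are allowed, because the Gram-Schmidt vectors of a linearly dependent
  sequence may vanish.\<close>

definition orthogonal_fam :: "nat \<Rightarrow> nat set \<Rightarrow> (nat \<Rightarrow> nat \<Rightarrow> real) \<Rightarrow> bool" where
  "orthogonal_fam k J v \<longleftrightarrow> (\<forall>m\<in>J. \<forall>n\<in>J. m \<noteq> n \<longrightarrow> dot k (v m) (v n) = 0)"

lemma dot_comb:
  assumes "orthogonal_fam k J v" "finite J" "n \<in> J"
  shows "dot k (\<lambda>j. \<Sum>m\<in>J. z m * v m j) (v n) = z n * dot k (v n) (v n)"
proof -
  have "dot k (\<lambda>j. \<Sum>m\<in>J. z m * v m j) (v n) = (\<Sum>m\<in>J. z m * dot k (v m) (v n))"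
    by (simp add: dot_sum dot_scale)
  also have "\<dots> = (\<Sum>m\<in>{n}. z m * dot k (v m) (v n))"
    using assms unfolding orthogonal_fam_def by (intro sum.mono_neutral_right) auto
  finally show ?thesis by simp
qed

lemma dot_comb_self:
  assumes "orthogonal_fam k J v" "finite J"
  shows "dot k (\<lambda>j. \<Sum>m\<in>J. z m * v m j) (\<lambda>j. \<Sum>m\<in>J. z m * v m j) = (\<Sum>m\<in>J. (z m)\<^sup>2 * dot k (v m) (v m))"
proof -
  have "dot k (\<lambda>j. \<Sum>m\<in>J. z m * v m j) (\<lambda>j. \<Sum>m\<in>J. z m * v m j)
    = (\<Sum>n\<in>J. z n * dot k (v n) (\<lambda>j. \<Sum>m\<in>J. z m * v m j))"
    by (simp add: dot_sum dot_scale)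
  also have "\<dots> = (\<Sum>n\<in>J. z n * (z n * dot k (v n) (v n)))"
    by (intro sum.cong refl, subst dot_commute) (simp add: dot_comb[OF assms])
  finally show ?thesis by (simp add: power2_eq_square mult.assoc)
qed

text \<open>Linearize the square by an independent Gaussian vector \<open>h\<close>: \<open>exp (a\<^sup>2 / 4) = E exp (h a / sqrt 2)\<close>.\<close>

lemma gauss_projection_exp:
  assumes v: "orthogonal_fam k J v" "finite J" "\<And>m. m \<in> J \<Longrightarrow> dot k (v m) (v m) \<le> 1"
  shows "(\<integral>\<^sup>+u. ennreal (exp ((\<Sum>m\<in>J. (dot k u (v m))\<^sup>2) / 4)) \<partial>gauss {..k}) \<le> ennreal (sqrt 2 ^ card J)"
proof -
  interpret G: prob_space "gauss {..k}" by (rule prob_space_gauss) simp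
  interpret H: prob_space "gauss J" by (rule prob_space_gauss) fact
  let ?r = "1 / sqrt 2 :: real"
  have inner: "(\<Sum>m\<in>J. h m * (dot k u (v m) * ?r)) = (\<Sum>j\<le>k. (?r * (\<Sum>m\<in>J. h m * v m j)) * u j)" for h u
    unfolding dot_def sum_distrib_left sum_distrib_right
    by (subst sum.swap) (intro sum.cong refl, simp add: mult_ac)
  have "(\<integral>\<^sup>+u. ennreal (exp ((\<Sum>m\<in>J. (dot k u (v m))\<^sup>2) / 4)) \<partial>gauss {..k})
    = (\<integral>\<^sup>+u. \<integral>\<^sup>+h. ennreal (exp (\<Sum>m\<in>J. (dot k u (v m) * ?r) * h m)) \<partial>gauss J \<partial>gauss {..k})"
    using v(2) by (subst nn_integral_gauss_exp_linear) (simp_all add: power_mult_distrib power_divide sum_divide_distrib)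
  also have "\<dots> = (\<integral>\<^sup>+h. \<integral>\<^sup>+u. ennreal (exp (\<Sum>m\<in>J. (dot k u (v m) * ?r) * h m)) \<partial>gauss {..k} \<partial>gauss J)"
  proof (rule pair_sigma_finite.Fubini')
    show "pair_sigma_finite (gauss J) (gauss {..k})"
      by (intro pair_sigma_finite.intro G.sigma_finite_measure_axioms H.sigma_finite_measure_axioms)
    have [measurable]: "(\<lambda>x. dot k (snd x) (v m)) \<in> borel_measurable (gauss J \<Otimes>\<^sub>M gauss {..k})" for m
      by (intro measurable_dot measurable_compose[OF measurable_snd]) auto
    have [measurable]: "m \<in> J \<Longrightarrow> (\<lambda>x. fst x m) \<in> borel_measurable (gauss J \<Otimes>\<^sub>M gauss {..k})" for m
      by (intro measurable_compose[OF measurable_fst]) auto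
    show "(\<lambda>(h, u). ennreal (exp (\<Sum>m\<in>J. (dot k u (v m) * ?r) * h m))) \<in> borel_measurable (gauss J \<Otimes>\<^sub>M gauss {..k})"
      unfolding split_beta' by measurable
  qed
  also have "\<dots> = (\<integral>\<^sup>+h. ennreal (exp (\<Sum>j\<le>k. (?r * (\<Sum>m\<in>J. h m * v m j))\<^sup>2 / 2)) \<partial>gauss J)"
    by (subst (2) mult.commute, subst inner, subst nn_integral_gauss_exp_linear)
      (simp_all add: sum_divide_distrib)
  \<comment> \<open>The exponent is a quarter of the squared norm of \<open>sum h m * v m\<close>.
    Orthogonality and length at most 1 bound it by a quarter of the squared norm of
    \<open>h\<close>, whose exponential moment costs \<open>sqrt 2\<close> per vector.\<close>
  also have "\<dots> \<le> (\<integral>\<^sup>+h. ennreal (exp (1/4 * (\<Sum>m\<in>J. (h m)\<^sup>2))) \<partial>gauss J)"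
  proof (intro nn_integral_mono ennreal_leI)
    fix h :: "nat \<Rightarrow> real"
    have sq: "(?r * S)\<^sup>2 / 2 = 1/4 * (S * S)" for S :: real by (simp add: power2_eq_square)
    have "(\<Sum>j\<le>k. (?r * (\<Sum>m\<in>J. h m * v m j))\<^sup>2 / 2) = 1/4 * dot k (\<lambda>j. \<Sum>m\<in>J. h m * v m j) (\<lambda>j. \<Sum>m\<in>J. h m * v m j)"
      unfolding dot_def sq by (rule sum_distrib_left[symmetric])
    also have "\<dots> = 1/4 * (\<Sum>m\<in>J. (h m)\<^sup>2 * dot k (v m) (v m))"
      using v by (simp add: dot_comb_self)
    also have "\<dots> \<le> 1/4 * (\<Sum>m\<in>J. (h m)\<^sup>2)"
      using v(3) by (intro mult_left_mono sum_mono mult_left_le) auto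
    finally show "exp (\<Sum>j\<le>k. (?r * (\<Sum>m\<in>J. h m * v m j))\<^sup>2 / 2) \<le> exp (1/4 * (\<Sum>m\<in>J. (h m)\<^sup>2))"
      by simp
  qed
  also have "\<dots> = ennreal (sqrt 2 ^ card J)"
    using v(2) by (subst nn_integral_gauss_exp_square) (auto simp: real_sqrt_divide)
  finally show ?thesis .
qed

lemma nn_integral_exp_quadratic:
  "(\<integral>\<^sup>+z. ennreal (exp (z * d - z\<^sup>2 / 2)) \<partial>lborel) = ennreal (sqrt (2 * pi) * exp (d\<^sup>2 / 2))"
proof -
  have "exp (z * d - z\<^sup>2 / 2) = sqrt (2 * pi) * exp (d\<^sup>2 / 2) * normal_density d 1 z" for z
    by (simp add: normal_density_def power2_eq_square field_simps flip: exp_add)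
  then have "(\<integral>\<^sup>+z. ennreal (exp (z * d - z\<^sup>2 / 2)) \<partial>lborel)
    = (\<integral>\<^sup>+z. ennreal (sqrt (2 * pi) * exp (d\<^sup>2 / 2)) * ennreal (normal_density d 1 z) \<partial>lborel)"
    by (intro nn_integral_cong) (simp add: ennreal_mult)
  also have "\<dots> = ennreal (sqrt (2 * pi) * exp (d\<^sup>2 / 2)) * 1"
    by (subst nn_integral_cmult) (simp_all add: nn_integral_normal_density)
  finally show ?thesis by simp
qed

text \<open>The average over all translates \<open>z\<close> of the probability that the coordinates of \<open>u\<close> with respect to \<open>v\<close>
  lie in the translated unit cube is 1.  Translating \<open>u\<close> instead turns this into an integral over the cube itself.\<close>

lemma gauss_box_lower:
  assumes v: "orthogonal_fam k J v" "finite J" "\<And>m. m \<in> J \<Longrightarrow> dot k (v m) (v m) = 1"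
    and M: "\<bar>a\<bar> \<le> M" "\<bar>a + 1\<bar> \<le> M"
  shows "measure (gauss {..k}) {u \<in> space (gauss {..k}). \<forall>m\<in>J. dot k u (v m) \<in> {a..a+1}}
    \<ge> (exp (- M\<^sup>2 / 2) / sqrt (2 * pi)) ^ card J"
proof -
  interpret G: prob_space "gauss {..k}" by (rule prob_space_gauss) simp
  let ?f = "\<lambda>u. \<Prod>j\<le>k. std_normal_density (u j)"
  let ?B = "\<lambda>u. \<forall>m\<in>J. dot k u (v m) \<in> {a..a+1}"
  let ?i = "\<lambda>z u. \<Prod>m\<in>J. indicator {a..a+1} (z m + dot k u (v m)) :: ennreal"
  \<comment> \<open>Price per coordinate: the integral over all translates of the weight that arises
    from shifting, at a point of the box.\<close>
  define K where "K = (sqrt (2 * pi) * exp (M\<^sup>2 / 2)) ^ card J"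
  have Kpos: "K > 0" by (simp add: K_def)
  have [measurable]: "m \<in> J \<Longrightarrow> (\<lambda>x. fst x m) \<in> borel_measurable (lebp J \<Otimes>\<^sub>M lebp {..k})" for m
    by (intro measurable_compose[OF measurable_fst]) auto
  have [measurable]: "j \<le> k \<Longrightarrow> (\<lambda>x. snd x j) \<in> borel_measurable (lebp J \<Otimes>\<^sub>M lebp {..k})" for j
    by (intro measurable_compose[OF measurable_snd]) auto
  have [measurable]: "(\<lambda>x. dot k (snd x) (v m)) \<in> borel_measurable (lebp J \<Otimes>\<^sub>M lebp {..k})" for m
    by measurable
  have psf: "pair_sigma_finite (lebp J) (lebp {..k})"
    by (intro pair_sigma_finite.intro lb.sigma_finite) (use v in auto)
  have psf2: "pair_sigma_finite (lebp {..k}) (lebp J)"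
    by (intro pair_sigma_finite.intro lb.sigma_finite) (use v in auto)
  have m1: "(\<lambda>(z, u). ennreal (?f u) * ?i z u) \<in> borel_measurable (lebp J \<Otimes>\<^sub>M lebp {..k})"
    unfolding split_beta' by measurable
  have "1 = emeasure (gauss {..k}) (space (gauss {..k}))" by (simp add: G.emeasure_space_1)
  also have "\<dots> = (\<integral>\<^sup>+u. 1 \<partial>gauss {..k})" by simp
  also have "\<dots> = (\<integral>\<^sup>+u. ennreal (?f u) * 1 \<partial>lebp {..k})"
    by (intro nn_integral_gauss) simp
  \<comment> \<open>The interval has length 1, so each factor integrates to 1 over its own translate
    \<open>z m\<close>.\<close>
  also have "\<dots> = (\<integral>\<^sup>+u. \<integral>\<^sup>+z. ennreal (?f u) * ?i z u \<partial>lebp J \<partial>lebp {..k})"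
  proof (intro nn_integral_cong)
    fix u :: "nat \<Rightarrow> real"
    have "(\<integral>\<^sup>+z. ?i z u \<partial>lebp J) = (\<Prod>m\<in>J. \<integral>\<^sup>+x. indicator {a..a+1} (x + dot k u (v m)) \<partial>lborel)"
      using v(2) by (intro lb.product_nn_integral_prod) auto
    also have "\<dots> = (\<Prod>m\<in>J. 1)"
    proof (intro prod.cong refl)
      fix m
      have "(\<integral>\<^sup>+x. indicator {a..a+1} (x + dot k u (v m)) \<partial>lborel) =
        (\<integral>\<^sup>+x. indicator {a - dot k u (v m)..a + 1 - dot k u (v m)} x \<partial>lborel)"
        by (intro nn_integral_cong) (auto simp: indicator_def)
      then show "(\<integral>\<^sup>+x. indicator {a..a+1} (x + dot k u (v m)) \<partial>lborel) = (1::ennreal)"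
        by simp
    qed
    finally have "(\<integral>\<^sup>+z. ?i z u \<partial>lebp J) = 1" by simp
    then show "ennreal (?f u) * 1 = (\<integral>\<^sup>+z. ennreal (?f u) * ?i z u \<partial>lebp J)"
      by (subst nn_integral_cmult) auto
  qed
  also have "\<dots> = (\<integral>\<^sup>+z. \<integral>\<^sup>+u. ennreal (?f u) * ?i z u \<partial>lebp {..k} \<partial>lebp J)"
    by (rule pair_sigma_finite.Fubini'[OF psf m1])
  \<comment> \<open>Shifting \<open>u\<close> by \<open>sum z m * v m\<close> removes
    \<open>z\<close> from the indicator and multiplies the density by the Cameron-Martin
    factor.\<close>
  also have "\<dots> = (\<integral>\<^sup>+z. \<integral>\<^sup>+u. ennreal (exp (\<Sum>m\<in>J. z m * dot k u (v m) - (z m)\<^sup>2 / 2)) * (ennreal (?f u) * indicator {u. ?B u} u) \<partial>lebp {..k} \<partial>lebp J)"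
  proof (rule nn_integral_cong)
    fix z :: "nat \<Rightarrow> real"
    let ?w = "\<lambda>j. \<Sum>m\<in>J. z m * v m j"
    let ?T = "\<lambda>u. \<lambda>j\<in>{..k}. - ?w j + 1 * u j"
    have dT: "dot k (?T u) y = dot k u y - dot k ?w y" for u y
      unfolding dot_restrict by (simp add: dot_diff[symmetric])
    have "(\<integral>\<^sup>+u. ennreal (?f u) * ?i z u \<partial>lebp {..k}) =
      ennreal (\<bar>1\<bar> ^ card {..k}) * (\<integral>\<^sup>+u. ennreal (?f (?T u)) * ?i z (?T u) \<partial>lebp {..k})"
      by (intro nn_integral_lebp_affine) auto
    also have "\<dots> = (\<integral>\<^sup>+u. ennreal (?f (?T u)) * ?i z (?T u) \<partial>lebp {..k})" by simp
    also have "\<dots> = (\<integral>\<^sup>+u. ennreal (exp (\<Sum>m\<in>J. z m * dot k u (v m) - (z m)\<^sup>2 / 2)) * (ennreal (?f u) * indicator {u. ?B u} u) \<partial>lebp {..k})"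
    proof (intro nn_integral_cong)
      fix u :: "nat \<Rightarrow> real"
      have 1: "?i z (?T u) = indicator {u. ?B u} u"
      proof -
        have "?i z (?T u) = (\<Prod>m\<in>J. indicator {a..a+1} (dot k u (v m)))"
          unfolding dT by (intro prod.cong refl) (simp add: dot_comb[OF v(1,2)] v(3))
        also have "\<dots> = indicator {u. ?B u} u"
          using v(2) by (auto simp: indicator_def prod_zero_iff)
        finally show ?thesis .
      qed
      have w: "dot k ?w u = (\<Sum>m\<in>J. z m * dot k u (v m))"
        by (simp add: dot_sum dot_scale dot_commute[of k u])
      have ww: "dot k ?w ?w = (\<Sum>m\<in>J. (z m)\<^sup>2)"
        using v by (simp add: dot_comb_self)
      have "(L2_set (?T u) {..k})\<^sup>2 = dot k (?T u) (?T u)" by (simp add: dot_self)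
      also have "\<dots> = dot k u u - 2 * dot k ?w u + dot k ?w ?w"
        unfolding dT[of u "?T u"] dot_commute[of k u "?T u"] dot_commute[of k ?w "?T u"] dT[of u u] dT[of u ?w]
          dot_commute[of k u ?w] by simp
      also have "\<dots> = (L2_set u {..k})\<^sup>2 - 2 * (\<Sum>m\<in>J. z m * dot k u (v m) - (z m)\<^sup>2 / 2)"
        unfolding w ww by (simp add: dot_self sum_subtractf sum_distrib_left algebra_simps sum_divide_distrib[symmetric])
      finally have "exp (- (L2_set (?T u) {..k})\<^sup>2 / 2) =
        exp (\<Sum>m\<in>J. z m * dot k u (v m) - (z m)\<^sup>2 / 2) * exp (- (L2_set u {..k})\<^sup>2 / 2)"
        by (simp add: field_simps flip: exp_add)
      then have 2: "?f (?T u) = exp (\<Sum>m\<in>J. z m * dot k u (v m) - (z m)\<^sup>2 / 2) * ?f u"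
        by (simp only: prod_std_normal_density finite_atMost mult_ac)
      show "ennreal (?f (?T u)) * ?i z (?T u) =
        ennreal (exp (\<Sum>m\<in>J. z m * dot k u (v m) - (z m)\<^sup>2 / 2)) * (ennreal (?f u) * indicator {u. ?B u} u)"
        unfolding 1 2 by (subst ennreal_mult) (auto intro!: prod_nonneg simp: mult.assoc)
    qed
    finally show "(\<integral>\<^sup>+u. ennreal (?f u) * ?i z u \<partial>lebp {..k}) =
      (\<integral>\<^sup>+u. ennreal (exp (\<Sum>m\<in>J. z m * dot k u (v m) - (z m)\<^sup>2 / 2)) * (ennreal (?f u) * indicator {u. ?B u} u) \<partial>lebp {..k})" .
  qed
  also have "\<dots> = (\<integral>\<^sup>+u. \<integral>\<^sup>+z. ennreal (exp (\<Sum>m\<in>J. z m * dot k u (v m) - (z m)\<^sup>2 / 2)) * (ennreal (?f u) * indicator {u. ?B u} u) \<partial>lebp J \<partial>lebp {..k})"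
  proof (rule pair_sigma_finite.Fubini'[OF psf2])
    have [measurable]: "m \<in> J \<Longrightarrow> (\<lambda>x. snd x m) \<in> borel_measurable (lebp {..k} \<Otimes>\<^sub>M lebp J)" for m
      by (intro measurable_compose[OF measurable_snd]) auto
    have [measurable]: "j \<le> k \<Longrightarrow> (\<lambda>x. fst x j) \<in> borel_measurable (lebp {..k} \<Otimes>\<^sub>M lebp J)" for j
      by (intro measurable_compose[OF measurable_fst]) auto
    have [measurable]: "(\<lambda>x. dot k (fst x) (v m)) \<in> borel_measurable (lebp {..k} \<Otimes>\<^sub>M lebp J)" for m
      by measurable
    have ind: "indicator {u. ?B u} u = (\<Prod>m\<in>J. indicator {a..a+1} (dot k u (v m)) :: ennreal)" for u
      using v(2) by (auto simp: indicator_def prod_zero_iff)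
    show "(\<lambda>(u, z). ennreal (exp (\<Sum>m\<in>J. z m * dot k u (v m) - (z m)\<^sup>2 / 2)) * (ennreal (?f u) * indicator {u. ?B u} u))
      \<in> borel_measurable (lebp {..k} \<Otimes>\<^sub>M lebp J)"
      unfolding split_beta' ind by measurable
  qed
  also have "\<dots> \<le> (\<integral>\<^sup>+u. ennreal K * (ennreal (?f u) * indicator {u. ?B u} u) \<partial>lebp {..k})"
  proof (intro nn_integral_mono)
    fix u :: "nat \<Rightarrow> real"
    let ?c = "ennreal (?f u) * indicator {u. ?B u} u"
    have "(\<integral>\<^sup>+z. ennreal (exp (\<Sum>m\<in>J. z m * dot k u (v m) - (z m)\<^sup>2 / 2)) \<partial>lebp J)
      = (\<integral>\<^sup>+z. (\<Prod>m\<in>J. ennreal (exp (z m * dot k u (v m) - (z m)\<^sup>2 / 2))) \<partial>lebp J)"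
      using v(2) by (simp add: exp_sum prod_ennreal)
    also have "\<dots> = (\<Prod>m\<in>J. \<integral>\<^sup>+x. ennreal (exp (x * dot k u (v m) - x\<^sup>2 / 2)) \<partial>lborel)"
      using v(2) by (intro lb.product_nn_integral_prod) auto
    also have "\<dots> = ennreal (\<Prod>m\<in>J. sqrt (2 * pi) * exp ((dot k u (v m))\<^sup>2 / 2))"
      by (simp add: nn_integral_exp_quadratic prod_ennreal)
    finally have int: "(\<integral>\<^sup>+z. ennreal (exp (\<Sum>m\<in>J. z m * dot k u (v m) - (z m)\<^sup>2 / 2)) \<partial>lebp J)
      = ennreal (\<Prod>m\<in>J. sqrt (2 * pi) * exp ((dot k u (v m))\<^sup>2 / 2))" .
    have "(\<integral>\<^sup>+z. ennreal (exp (\<Sum>m\<in>J. z m * dot k u (v m) - (z m)\<^sup>2 / 2)) * ?c \<partial>lebp J)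
      = ennreal (\<Prod>m\<in>J. sqrt (2 * pi) * exp ((dot k u (v m))\<^sup>2 / 2)) * ?c"
      unfolding int[symmetric] by (intro nn_integral_multc) measurable
    also have "\<dots> \<le> ennreal K * ?c"
    proof (cases "?B u")
      case True
      have "(\<Prod>m\<in>J. sqrt (2 * pi) * exp ((dot k u (v m))\<^sup>2 / 2)) \<le> (\<Prod>m\<in>J. sqrt (2 * pi) * exp (M\<^sup>2 / 2))"
      proof (intro prod_mono conjI)
        fix m assume "m \<in> J"
        then have "\<bar>dot k u (v m)\<bar> \<le> \<bar>M\<bar>" using True M by force
        then have "(dot k u (v m))\<^sup>2 \<le> M\<^sup>2" by (simp only: abs_le_square_iff)
        then show "sqrt (2 * pi) * exp ((dot k u (v m))\<^sup>2 / 2) \<le> sqrt (2 * pi) * exp (M\<^sup>2 / 2)" by simp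
      qed simp
      then show ?thesis by (intro mult_right_mono ennreal_leI) (auto simp: K_def)
    qed simp
    finally show "(\<integral>\<^sup>+z. ennreal (exp (\<Sum>m\<in>J. z m * dot k u (v m) - (z m)\<^sup>2 / 2)) * ?c \<partial>lebp J) \<le> ennreal K * ?c" .
  qed
  also have "\<dots> = ennreal K * (\<integral>\<^sup>+u. ennreal (?f u) * indicator {u. ?B u} u \<partial>lebp {..k})"
  proof (intro nn_integral_cmult)
    have ind: "indicator {u. ?B u} u = (\<Prod>m\<in>J. indicator {a..a+1} (dot k u (v m)) :: ennreal)" for u
      using v(2) by (auto simp: indicator_def prod_zero_iff)
    show "(\<lambda>u. ennreal (?f u) * indicator {u. ?B u} u) \<in> borel_measurable (lebp {..k})"
      unfolding ind by measurable
  qed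
  also have "(\<integral>\<^sup>+u. ennreal (?f u) * indicator {u. ?B u} u \<partial>lebp {..k}) = (\<integral>\<^sup>+u. indicator {u. ?B u} u \<partial>gauss {..k})"
  proof (intro nn_integral_gauss[symmetric])
    have ind: "indicator {u. ?B u} u = (\<Prod>m\<in>J. indicator {a..a+1} (dot k u (v m)) :: ennreal)" for u
      using v(2) by (auto simp: indicator_def prod_zero_iff)
    show "(\<lambda>u. indicator {u. ?B u} u :: ennreal) \<in> borel_measurable (PiM {..k} (\<lambda>_. borel))"
      unfolding ind by measurable
  qed
  also have "\<dots> = emeasure (gauss {..k}) {u \<in> space (gauss {..k}). ?B u}"
  proof -
    have [measurable]: "{u \<in> space (gauss {..k}). ?B u} \<in> sets (gauss {..k})"
      using v(2) by measurable
    show ?thesis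
      by (subst nn_integral_indicator[symmetric], measurable) (intro nn_integral_cong, simp add: indicator_def)
  qed
  finally have "1 \<le> ennreal (K * measure (gauss {..k}) {u \<in> space (gauss {..k}). ?B u})"
    using Kpos by (simp add: G.emeasure_eq_measure ennreal_mult)
  then have "1 \<le> K * measure (gauss {..k}) {u \<in> space (gauss {..k}). ?B u}"
    using Kpos by simp
  then have "1 / K \<le> measure (gauss {..k}) {u \<in> space (gauss {..k}). ?B u}"
    using Kpos by (simp add: divide_le_eq mult.commute)
  moreover have "1 / K = (exp (- M\<^sup>2 / 2) / sqrt (2 * pi)) ^ card J"
    by (simp add: K_def exp_minus power_divide power_mult_distrib field_simps)
  ultimately show ?thesis by simp
qed

section \<open>Gram-Schmidt\<close>

text \<open>A vanishing residual is normalised to the zero vector, since division by zero returns 0.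
  Thus the recursion makes sense for dependent sequences too.\<close>

fun gs :: "nat \<Rightarrow> (nat \<Rightarrow> nat \<Rightarrow> real) \<Rightarrow> nat \<Rightarrow> nat \<Rightarrow> real" where
  "gs k x m = (let w = (\<lambda>j. x m j - (\<Sum>n\<in>{1..<m}. dot k (x m) (gs k x n) * gs k x n j))
     in (\<lambda>j. w j / L2_set w {..k}))"

declare gs.simps [simp del]

definition gs_res :: "nat \<Rightarrow> (nat \<Rightarrow> nat \<Rightarrow> real) \<Rightarrow> nat \<Rightarrow> nat \<Rightarrow> real" where
  "gs_res k x m = (\<lambda>j. x m j - (\<Sum>n\<in>{1..<m}. dot k (x m) (gs k x n) * gs k x n j))"

lemma gs_eq: "gs k x m = (\<lambda>j. gs_res k x m j / L2_set (gs_res k x m) {..k})"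
  by (subst gs.simps) (simp add: gs_res_def Let_def)

lemma gs_cong:
  "(\<And>n. n \<in> {1..m} \<Longrightarrow> x n = x' n) \<Longrightarrow> m \<ge> 1 \<Longrightarrow> gs k x m = gs k x' m"
proof (induction m rule: less_induct)
  case (less m)
  have "gs k x n = gs k x' n" if "n \<in> {1..<m}" for n using less that by auto
  moreover have "x m = x' m" using less.prems by auto
  ultimately have "gs_res k x m = gs_res k x' m" by (simp add: gs_res_def)
  then show ?case by (simp only: gs_eq)
qed

text \<open>\<open>proj\<close> is a definite description from which measurability in the points
  cannot be read off. The explicit recursion provides it.\<close>

lemma measurable_gs:
  assumes "\<And>n j. n \<in> {1..m} \<Longrightarrow> j \<le> k \<Longrightarrow> (\<lambda>\<omega>. f \<omega> n j) \<in> borel_measurable M" "m \<ge> 1"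
  shows "j \<le> k \<Longrightarrow> (\<lambda>\<omega>. gs k (f \<omega>) m j) \<in> borel_measurable M"
  using assms
proof (induction m arbitrary: j rule: less_induct)
  case (less m)
  have [measurable]: "(\<lambda>\<omega>. gs k (f \<omega>) n i) \<in> borel_measurable M" if "n \<in> {1..<m}" "i \<le> k" for n i
    using less that by auto
  have [measurable]: "(\<lambda>\<omega>. f \<omega> m i) \<in> borel_measurable M" if "i \<le> k" for i
    using less that by auto
  have [measurable]: "(\<lambda>\<omega>. gs_res k (f \<omega>) m i) \<in> borel_measurable M" if "i \<le> k" for i
    using that unfolding gs_res_def by measurable
  show ?case using less.prems(1) unfolding gs_eq by measurable
qed

lemma dot_eq_0_self:
  assumes "dot k y y = 0"
  shows "\<And>j. j \<le> k \<Longrightarrow> y j = 0"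
  using assms by (simp add: dot_self L2_set_eq_0_iff)

lemma dot_self_0_right: "dot k y y = 0 \<Longrightarrow> dot k x y = 0"
  unfolding dot_def[of k x] using dot_eq_0_self[of k y] by simp

text \<open>The value 0 belongs to a vanishing residual. Carrying both cases makes the projection
  formulas valid without linear independence.\<close>

lemma dot_gs_self: "dot k (gs k x m) (gs k x m) = 0 \<or> dot k (gs k x m) (gs k x m) = 1"
proof -
  let ?L = "L2_set (gs_res k x m) {..k}"
  have "dot k (gs k x m) (gs k x m) = dot k (\<lambda>j. (1 / ?L) * gs_res k x m j) (\<lambda>j. (1 / ?L) * gs_res k x m j)"
    by (simp add: gs_eq)
  also have "\<dots> = (1 / ?L) * ((1 / ?L) * ?L\<^sup>2)"
    by (simp only: dot_scale dot_commute[of k "gs_res k x m" "\<lambda>j. (1 / ?L) * gs_res k x m j"] dot_self)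
  finally show ?thesis by (auto simp: power2_eq_square)
qed

lemma dot_gs_gs: "1 \<le> n \<Longrightarrow> n < m \<Longrightarrow> dot k (gs k x m) (gs k x n) = 0"
proof (induction m arbitrary: n rule: less_induct)
  case (less m)
  let ?g = "gs k x" let ?L = "L2_set (gs_res k x m) {..k}"
  have orth: "orthogonal_fam k {1..<m} ?g"
    unfolding orthogonal_fam_def
  proof (intro ballI impI)
    fix a b assume "a \<in> {1..<m}" "b \<in> {1..<m}" "a \<noteq> b"
    then show "dot k (?g a) (?g b) = 0"
      using less.IH[of a b] less.IH[of b a] by (cases "a < b") (auto simp: dot_commute[of k "?g a" "?g b"])
  qed
  have "dot k (gs_res k x m) (?g n) = dot k (x m) (?g n) - dot k (\<lambda>j. \<Sum>i\<in>{1..<m}. dot k (x m) (?g i) * ?g i j) (?g n)"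
    unfolding gs_res_def by (rule dot_diff)
  also have "\<dots> = dot k (x m) (?g n) - dot k (x m) (?g n) * dot k (?g n) (?g n)"
    using less.prems by (subst dot_comb[OF orth]) auto
  also have "\<dots> = 0" using dot_gs_self[of k x n] dot_self_0_right[of k "?g n" "x m"] by auto
  finally have "dot k (\<lambda>j. (1 / ?L) * gs_res k x m j) (?g n) = 0" by (simp only: dot_scale)
  then show ?case by (simp add: gs_eq[of k x m])
qed

lemma orthogonal_fam_gs: "J \<subseteq> {1..} \<Longrightarrow> orthogonal_fam k J (gs k x)"
  unfolding orthogonal_fam_def
proof (intro ballI impI)
  fix a b assume J: "J \<subseteq> {1..}" "a \<in> J" "b \<in> J" "a \<noteq> b"
  then show "dot k (gs k x a) (gs k x b) = 0"
    using dot_gs_gs[of a b k x] dot_gs_gs[of b a k x]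
    by (cases "a < b") (auto simp: dot_commute[of k "gs k x a" "gs k x b"])
qed

lemma gs_expand:
  assumes "j \<le> k"
  shows "x m j = L2_set (gs_res k x m) {..k} * gs k x m j + (\<Sum>n\<in>{1..<m}. dot k (x m) (gs k x n) * gs k x n j)"
proof -
  have "L2_set (gs_res k x m) {..k} * gs k x m j = gs_res k x m j"
    using assms unfolding gs_eq by (auto simp: L2_set_eq_0_iff)
  then show ?thesis by (simp add: gs_res_def)
qed

lemma dot_gs_expand:
  "dot k u (x m) = L2_set (gs_res k x m) {..k} * dot k u (gs k x m)
     + (\<Sum>n\<in>{1..<m}. dot k (x m) (gs k x n) * dot k u (gs k x n))"
proof -
  have "dot k (x m) u = dot k (\<lambda>j. L2_set (gs_res k x m) {..k} * gs k x m j +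
      (\<Sum>n\<in>{1..<m}. dot k (x m) (gs k x n) * gs k x n j)) u"
    unfolding dot_def[of k "x m" u] dot_def[of k "\<lambda>j. _ j + _ j" u]
    by (intro sum.cong refl, subst gs_expand[of _ k x m]) auto
  then show ?thesis
    unfolding dot_add dot_scale dot_sum by (simp add: dot_commute[of k u])
qed

lemma span_of_linear:
  assumes "\<And>m. m \<in> J \<Longrightarrow> (\<lambda>j\<in>{..k}. f m j) \<in> span_of k x i"
  shows "(\<lambda>j\<in>{..k}. \<Sum>m\<in>J. c m * f m j) \<in> span_of k x i"
proof -
  have "\<forall>m\<in>J. \<exists>a. (\<lambda>j\<in>{..k}. f m j) = (\<lambda>j\<in>{..k}. \<Sum>n=1..i. a n * x n j)"
    using assms unfolding span_of_def by auto
  then obtain a where a: "\<And>m. m \<in> J \<Longrightarrow> (\<lambda>j\<in>{..k}. f m j) = (\<lambda>j\<in>{..k}. \<Sum>n=1..i. a m n * x n j)"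
    by metis
  have "f m j = (\<Sum>n=1..i. a m n * x n j)" if "m \<in> J" "j \<le> k" for m j
    using fun_cong[OF a[OF that(1)], of j] that(2) by simp
  then have "(\<lambda>j\<in>{..k}. \<Sum>m\<in>J. c m * f m j) = (\<lambda>j\<in>{..k}. \<Sum>m\<in>J. c m * (\<Sum>n=1..i. a m n * x n j))"
    by (intro restrict_ext sum.cong) auto
  also have "\<dots> = (\<lambda>j\<in>{..k}. \<Sum>n=1..i. (\<Sum>m\<in>J. c m * a m n) * x n j)"
    unfolding sum_distrib_left sum_distrib_right
    by (intro restrict_ext, subst sum.swap) (simp add: mult_ac)
  finally show ?thesis unfolding span_of_def by auto
qed

lemma gs_in_span: "m \<in> {1..i} \<Longrightarrow> (\<lambda>j\<in>{..k}. gs k x m j) \<in> span_of k x i"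
proof (induction m rule: less_induct)
  case (less m)
  let ?L = "L2_set (gs_res k x m) {..k}"
  \<comment> \<open>Puts \<open>x m\<close> in the place of index \<open>m\<close> next to the
    earlier Gram-Schmidt vectors, so that the new vector is a single linear combination of elements
    of the span.\<close>
  define f where "f n = (if n = m then x m else gs k x n)" for n
  define c where "c n = (if n = m then 1 / ?L else - dot k (x m) (gs k x n) / ?L)" for n
  have xm: "(\<lambda>j\<in>{..k}. x m j) \<in> span_of k x i"
  proof -
    have "(\<Sum>n=1..i. (if n = m then 1 else 0) * x n j) = x m j" for j
      using less.prems by (subst sum.mono_neutral_cong_right[of _ "{m}"]) auto
    then show ?thesis unfolding span_of_def by (auto intro!: exI[of _ "\<lambda>n. if n = m then 1 else 0"])
  qed
  have "(\<lambda>j\<in>{..k}. f n j) \<in> span_of k x i" if "n \<in> {1..m}" for n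
  proof (cases "n = m")
    case True
    then have "f n = x m" by (simp add: f_def)
    then show ?thesis using xm by (simp only:)
  next
    case False
    then have "f n = gs k x n" "n < m" "n \<in> {1..i}" using that less.prems by (auto simp: f_def)
    then show ?thesis using less.IH[of n] by (simp only:)
  qed
  then have "(\<lambda>j\<in>{..k}. \<Sum>n\<in>{1..m}. c n * f n j) \<in> span_of k x i" by (rule span_of_linear)
  also have "(\<lambda>j\<in>{..k}. \<Sum>n\<in>{1..m}. c n * f n j) = (\<lambda>j\<in>{..k}. gs k x m j)"
  proof (intro restrict_ext)
    fix j
    have "{1..m} = insert m {1..<m}" using less.prems by auto
    then have "(\<Sum>n\<in>{1..m}. c n * f n j) = x m j / ?L + (\<Sum>n\<in>{1..<m}. - (dot k (x m) (gs k x n) * gs k x n j) / ?L)"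
      by (simp add: c_def f_def)
    also have "\<dots> = gs k x m j"
      by (simp add: gs_eq[of k x m] gs_res_def diff_divide_distrib sum_divide_distrib sum_negf)
    finally show "(\<Sum>n\<in>{1..m}. c n * f n j) = gs k x m j" .
  qed
  finally show ?case .
qed

text \<open>The Gram-Schmidt expansion lies in the span and leaves a remainder orthogonal to every
  \<open>x m\<close>. Uniqueness: the difference of two candidates lies in the span and is
  orthogonal to itself.\<close>

lemma proj_eq: "proj k x i v = (\<lambda>j\<in>{..k}. \<Sum>m\<in>{1..i}. dot k v (gs k x m) * gs k x m j)"
  unfolding proj_def
proof (rule the_equality)
  let ?y = "\<lambda>j\<in>{..k}. \<Sum>m\<in>{1..i}. dot k v (gs k x m) * gs k x m j"
  have y: "?y \<in> span_of k x i" by (intro span_of_linear gs_in_span)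
  have yg: "dot k ?y (gs k x n) = dot k v (gs k x n)" if "n \<in> {1..i}" for n
  proof -
    have "dot k ?y (gs k x n) = dot k v (gs k x n) * dot k (gs k x n) (gs k x n)"
      unfolding dot_restrict using that by (intro dot_comb orthogonal_fam_gs) auto
    then show ?thesis using dot_gs_self[of k x n] dot_self_0_right[of k "gs k x n" v] by auto
  qed
  define w where "w = (\<lambda>j. v j - ?y j)"
  have w: "dot k w (gs k x n) = 0" if "n \<in> {1..i}" for n
    unfolding w_def dot_diff yg[OF that] by simp
  have wx: "dot k w (x m) = 0" if "m \<in> {1..i}" for m
    using that w by (simp add: dot_gs_expand[of k w x m])
  have ort: "dot k (\<lambda>j. v j - ?y j) z = 0" if z: "z \<in> span_of k x i" for z
  proof -
    obtain a where "z = (\<lambda>j\<in>{..k}. \<Sum>m=1..i. a m * x m j)" using z unfolding span_of_def by auto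
    then have "dot k z w = (\<Sum>m=1..i. a m * dot k w (x m))"
      by (simp only: dot_restrict dot_sum dot_scale dot_commute[of k w])
    then have "dot k w z = 0" using wx by (simp add: dot_commute[of k w])
    then show ?thesis unfolding w_def .
  qed
  show "?y \<in> span_of k x i \<and> (\<forall>z\<in>span_of k x i. dot k (\<lambda>j. v j - ?y j) z = 0)"
    using y ort by blast
  fix y' assume y': "y' \<in> span_of k x i \<and> (\<forall>z\<in>span_of k x i. dot k (\<lambda>j. v j - y' j) z = 0)"
  \<comment> \<open>The difference of the two candidates, written as a linear combination indexed by
    the booleans so that closure of the span applies.\<close>
  define f where "f b = (if b then ?y else y')" for b
  define c where "c b = (if b then 1 else - 1 :: real)" for b
  define d where "d = (\<lambda>j\<in>{..k}. \<Sum>b\<in>UNIV. c b * f b j)"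
  have ext: "y' \<in> extensional {..k}" using y' unfolding span_of_def by auto
  have r: "restrict y' {..k} = y'" using ext by (rule extensional_restrict)
  have "d \<in> span_of k x i"
    unfolding d_def using y y' by (intro span_of_linear) (auto simp: f_def r)
  then have "dot k (\<lambda>j. v j - ?y j) d = 0" "dot k (\<lambda>j. v j - y' j) d = 0" using ort y' by auto
  then have "dot k (\<lambda>j. ?y j - y' j) d = 0" by (simp only: dot_diff)
  moreover have "dot k (\<lambda>j. ?y j - y' j) d = dot k d d"
    unfolding dot_def[of k _ d] by (intro sum.cong refl) (simp add: d_def UNIV_bool c_def f_def)
  ultimately have "dot k d d = 0" by simp
  then have "d j = 0" if "j \<le> k" for j using that by (rule dot_eq_0_self)
  then have "y' j = ?y j" if "j \<le> k" for j
    using that by (auto simp: d_def UNIV_bool c_def f_def)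
  then show "y' = ?y" using ext by (intro extensionalityI[of _ "{..k}"]) auto
qed

text \<open>Pythagoras; vanishing Gram-Schmidt vectors contribute 0 on both sides. It turns
  perfection into an inequality between sums of squares.\<close>

lemma L2_set_proj: "(L2_set (proj k x i v) {..k})\<^sup>2 = (\<Sum>m\<in>{1..i}. (dot k v (gs k x m))\<^sup>2)"
proof -
  have "(L2_set (proj k x i v) {..k})\<^sup>2 = dot k (\<lambda>j. \<Sum>m\<in>{1..i}. dot k v (gs k x m) * gs k x m j) (\<lambda>j. \<Sum>m\<in>{1..i}. dot k v (gs k x m) * gs k x m j)"
    unfolding dot_self[symmetric] proj_eq dot_restrict
    by (subst dot_commute) (simp add: dot_restrict)
  also have "\<dots> = (\<Sum>m\<in>{1..i}. (dot k v (gs k x m))\<^sup>2 * dot k (gs k x m) (gs k x m))"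
    by (intro dot_comb_self orthogonal_fam_gs) auto
  also have "\<dots> = (\<Sum>m\<in>{1..i}. (dot k v (gs k x m))\<^sup>2)"
  proof (intro sum.cong refl)
    fix m
    show "(dot k v (gs k x m))\<^sup>2 * dot k (gs k x m) (gs k x m) = (dot k v (gs k x m))\<^sup>2"
      using dot_gs_self[of k x m] dot_self_0_right[of k "gs k x m" v] by auto
  qed
  finally show ?thesis .
qed

lemma L2_set_gs_res:
  "(L2_set (gs_res k x m) {..k})\<^sup>2 = dot k (x m) (x m) - (\<Sum>n\<in>{1..<m}. (dot k (x m) (gs k x n))\<^sup>2)"
proof -
  define p where "p = (\<lambda>j. \<Sum>n\<in>{1..<m}. dot k (x m) (gs k x n) * gs k x n j)"
  let ?q = "\<Sum>n\<in>{1..<m}. (dot k (x m) (gs k x n))\<^sup>2"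
  have px: "dot k p (x m) = ?q"
    unfolding p_def dot_sum dot_scale by (simp add: power2_eq_square dot_commute[of k _ "x m"])
  have "dot k p p = (\<Sum>n\<in>{1..<m}. (dot k (x m) (gs k x n))\<^sup>2 * dot k (gs k x n) (gs k x n))"
    unfolding p_def by (intro dot_comb_self orthogonal_fam_gs) auto
  also have "\<dots> = ?q"
  proof (intro sum.cong refl)
    fix n
    show "(dot k (x m) (gs k x n))\<^sup>2 * dot k (gs k x n) (gs k x n) = (dot k (x m) (gs k x n))\<^sup>2"
      using dot_gs_self[of k x n] dot_self_0_right[of k "gs k x n" "x m"] by auto
  qed
  finally have pp: "dot k p p = ?q" .
  let ?r = "\<lambda>j. x m j - p j"
  have "dot k ?r ?r = dot k (x m) (x m) - dot k p (x m) - (dot k p (x m) - dot k p p)"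
    unfolding dot_diff[of k "x m" p ?r] dot_commute[of k "x m" ?r] dot_commute[of k p ?r] dot_diff
    by (simp add: dot_commute[of k "x m" p])
  then have "dot k ?r ?r = dot k (x m) (x m) - ?q" unfolding px pp by simp
  moreover have "gs_res k x m = ?r" unfolding gs_res_def p_def ..
  ultimately show ?thesis by (simp only: dot_self[symmetric])
qed

text \<open>By Pythagoras the squared residual is at least \<open>1 - 19/100 = (9/10)^2\<close>. In
  particular no residual vanishes and all Gram-Schmidt vectors have length 1.\<close>

lemma gs_near_orthonormal:
  assumes x: "\<And>m. m \<in> {1..n} \<Longrightarrow> dot k (x m) (x m) = 1"
    and proj: "\<And>m. m \<in> {1..n} \<Longrightarrow> (\<Sum>i\<in>{1..<m}. (dot k (x m) (gs k x i))\<^sup>2) \<le> \<eta>\<^sup>2"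
    and eta: "\<eta>\<^sup>2 \<le> 19/100" and m: "m \<in> {1..n}"
  shows "9/10 \<le> L2_set (gs_res k x m) {..k}" "dot k (gs k x m) (gs k x m) = 1"
proof -
  have "(9/10)\<^sup>2 \<le> (L2_set (gs_res k x m) {..k})\<^sup>2"
    unfolding L2_set_gs_res using x[OF m] proj[OF m] eta by (simp add: power2_eq_square)
  then show L: "9/10 \<le> L2_set (gs_res k x m) {..k}"
    by (rule power2_le_imp_le) (rule L2_set_nonneg)
  have "dot k (gs k x m) (gs k x m) \<noteq> 0"
  proof
    assume "dot k (gs k x m) (gs k x m) = 0"
    then have "gs k x m j = 0" if "j \<le> k" for j using that by (rule dot_eq_0_self)
    then have "gs_res k x m j = 0" if "j \<le> k" for j
      using that L by (simp add: gs_eq[of k x m])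
    then have "L2_set (gs_res k x m) {..k} = 0" by (subst L2_set_eq_0_iff) auto
    then show False using L by simp
  qed
  then show "dot k (gs k x m) (gs k x m) = 1" using dot_gs_self by blast
qed

text \<open>In the expansion of \<open>x m\<close>, its own Gram-Schmidt vector contributes at least
  \<open>9/10 * a\<close>. By Cauchy-Schwarz the earlier ones contribute at most
  \<open>\<eta>\<close> times the length \<open>(a + 1) sqrt n\<close> of the coordinate vector. The
  sign \<open>\<sigma>\<close> selects the colour.\<close>

lemma dot_large_of_box:
  assumes x: "\<And>m. m \<in> {1..n} \<Longrightarrow> dot k (x m) (x m) = 1"
    and proj: "\<And>m. m \<in> {1..n} \<Longrightarrow> (\<Sum>i\<in>{1..<m}. (dot k (x m) (gs k x i))\<^sup>2) \<le> \<eta>\<^sup>2"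
    and eta: "0 \<le> \<eta>" "\<eta>\<^sup>2 \<le> 19/100" "\<eta> * ((a + 1) * sqrt (real n)) \<le> 1/2"
    and a: "0 \<le> a" and \<sigma>: "\<sigma> = 1 \<or> \<sigma> = - 1"
    and box: "\<And>m. m \<in> {1..n} \<Longrightarrow> \<sigma> * dot k u (gs k x m) \<in> {a..a+1}"
    and m: "m \<in> {1..n}"
  shows "9/10 * a - 1/2 \<le> \<sigma> * dot k u (x m)"
proof -
  let ?J = "{1..<m}" let ?L = "L2_set (gs_res k x m) {..k}"
  let ?b = "\<lambda>i. dot k (x m) (gs k x i)" let ?d = "\<lambda>i. dot k u (gs k x i)"
  have "\<bar>\<Sum>i\<in>?J. ?b i * ?d i\<bar> \<le> (\<Sum>i\<in>?J. \<bar>?b i\<bar> * \<bar>?d i\<bar>)"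
    unfolding abs_mult[symmetric] by (rule sum_abs)
  also have "\<dots> \<le> L2_set ?b ?J * L2_set ?d ?J" by (rule L2_set_mult_ineq)
  also have "\<dots> \<le> \<eta> * ((a + 1) * sqrt (real n))"
  proof (intro mult_mono)
    show "L2_set ?b ?J \<le> \<eta>"
      using proj[OF m] eta(1) by (rule_tac power2_le_imp_le) (simp_all add: L2_set_square)
    have "(?d i)\<^sup>2 \<le> (a + 1)\<^sup>2" if "i \<in> ?J" for i
    proof -
      have "\<bar>?d i\<bar> \<le> \<bar>a + 1\<bar>" using box[of i] that m a \<sigma> by auto
      then show ?thesis by (simp only: abs_le_square_iff)
    qed
    then have "(\<Sum>i\<in>?J. (?d i)\<^sup>2) \<le> (\<Sum>i\<in>?J. (a + 1)\<^sup>2)" by (rule sum_mono)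
    also have "\<dots> = real (m - 1) * (a + 1)\<^sup>2" by simp
    also have "\<dots> \<le> real n * (a + 1)\<^sup>2" using m by (intro mult_right_mono) auto
    finally show "L2_set ?d ?J \<le> (a + 1) * sqrt (real n)"
      using a by (rule_tac power2_le_imp_le) (simp_all add: L2_set_square power_mult_distrib mult.commute)
  qed (use eta in \<open>auto simp: L2_set_nonneg\<close>)
  also have "\<dots> \<le> 1/2" by fact
  finally have "\<bar>\<sigma> * (\<Sum>i\<in>?J. ?b i * ?d i)\<bar> \<le> 1/2" using \<sigma> by auto
  moreover have "9/10 * a \<le> ?L * (\<sigma> * ?d m)"
    using gs_near_orthonormal(1)[OF x proj eta(2) m] box[OF m] a by (intro mult_mono) auto
  moreover have "\<sigma> * dot k u (x m) = ?L * (\<sigma> * ?d m) + \<sigma> * (\<Sum>i\<in>?J. ?b i * ?d i)"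
    by (subst dot_gs_expand) (simp add: algebra_simps)
  ultimately show ?thesis by linarith
qed

section \<open>The induction over cliques\<close>

text \<open>One abstract process covers both colours: \<open>S\<close> is the law of a point,
  \<open>E\<close> the edge relation of one colour, and \<open>good i y z\<close> says that
  \<open>z\<close> has a short projection onto the span of the first \<open>i\<close> points of
  \<open>y\<close>. The bound \<open>bad_le\<close> must hold for arbitrary predecessors, since they
  come from cliques that need not be perfect; \<open>extend_ge\<close> is asked only for perfect
  prefixes in the set \<open>U\<close> of full measure.\<close>

locale clique_process = prob_space S for S :: "(nat \<Rightarrow> real) measure" +
  fixes E :: "(nat \<Rightarrow> real) \<Rightarrow> (nat \<Rightarrow> real) \<Rightarrow> bool"
    and good :: "nat \<Rightarrow> (nat \<Rightarrow> nat \<Rightarrow> real) \<Rightarrow> (nat \<Rightarrow> real) \<Rightarrow> bool"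
    and U :: "(nat \<Rightarrow> real) set" and x :: "nat \<Rightarrow> nat \<Rightarrow> real" and s :: nat and R :: nat
    and \<epsilon> \<delta> \<tau> :: real
  assumes measurable_E: "Measurable.pred (S \<Otimes>\<^sub>M S) (\<lambda>(y, z). E y z)"
    and E_sym: "\<And>y z. E y z \<Longrightarrow> E z y"
    and measurable_good: "\<And>i f g M. (\<And>m. m \<in> {1..i} \<Longrightarrow> (\<lambda>\<xi>. f \<xi> m) \<in> measurable M S) \<Longrightarrow> g \<in> measurable M S \<Longrightarrow>
      Measurable.pred (M :: (nat \<Rightarrow> nat \<Rightarrow> real) measure) (\<lambda>\<xi>. good i (f \<xi>) (g \<xi>))"
    and measurable_good_last: "\<And>i y. (\<And>m. m \<in> {1..i} \<Longrightarrow> y m \<in> space S) \<Longrightarrow> Measurable.pred S (\<lambda>z. good i y z)"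
    and good_cong: "\<And>i y y' z. (\<And>m. m \<in> {1..i} \<Longrightarrow> y m = y' m) \<Longrightarrow> good i y z = good i y' z"
    and AE_U: "AE y in S. y \<in> U"
    and x_in: "\<And>m. m \<in> {1..s} \<Longrightarrow> x m \<in> U \<inter> space S"
    and x_good: "\<And>i. i < s \<Longrightarrow> good i x (x (Suc i))"
    and bad_le: "\<And>i y. i < R \<Longrightarrow> (\<And>m. m \<in> {1..i} \<Longrightarrow> y m \<in> space S) \<Longrightarrow>
      prob {z \<in> space S. \<not> good i y z} \<le> \<epsilon>"
    and extend_ge: "\<And>n y. n < R \<Longrightarrow> (\<And>m. m \<in> {1..n} \<Longrightarrow> y m \<in> U \<inter> space S) \<Longrightarrow>
      (\<And>i. i < n \<Longrightarrow> good i y (y (Suc i))) \<Longrightarrow>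
      \<delta> \<le> prob {z \<in> space S. (\<forall>m\<in>{1..n}. E (y m) z) \<and> good n y z}"
    and params: "0 \<le> \<epsilon>" "0 < \<delta>" "0 \<le> \<tau>" "real R * \<epsilon> * (1 + \<tau>) \<le> \<tau> * \<delta>"
begin

text \<open>The index set is arbitrary because deleting a point leaves a gap.\<close>

definition clique :: "nat set \<Rightarrow> (nat \<Rightarrow> nat \<Rightarrow> real) \<Rightarrow> bool" where
  "clique J y \<longleftrightarrow> (\<forall>i\<in>J. \<forall>j\<in>J. i \<noteq> j \<longrightarrow> E (y i) (y j))"

definition perf :: "nat \<Rightarrow> (nat \<Rightarrow> nat \<Rightarrow> real) \<Rightarrow> bool" where
  "perf n y \<longleftrightarrow> (\<forall>i<n. good i y (y (Suc i)))"

abbreviation law :: "nat set \<Rightarrow> (nat \<Rightarrow> nat \<Rightarrow> real) measure" where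
  "law J \<equiv> PiM J (\<lambda>_. S)"

definition cliques :: "nat \<Rightarrow> (nat \<Rightarrow> nat \<Rightarrow> real) set" where
  "cliques n = {\<xi> \<in> space (law {s+1..n}). clique {1..n} (extend s x \<xi>)}"

definition perfect_cliques :: "nat \<Rightarrow> (nat \<Rightarrow> nat \<Rightarrow> real) set" where
  "perfect_cliques n = {\<xi> \<in> space (law {s+1..n}). clique {1..n} (extend s x \<xi>) \<and> perf n (extend s x \<xi>)}"

text \<open>Any bad index \<open>j\<close> counts, so these sets may overlap; only a union bound
  over them is taken.\<close>

definition bad_cliques :: "nat \<Rightarrow> nat \<Rightarrow> (nat \<Rightarrow> nat \<Rightarrow> real) set" where
  "bad_cliques n j = {\<xi> \<in> space (law {s+1..n}). clique {1..n} (extend s x \<xi>) \<and>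
     \<not> good j (extend s x \<xi>) (extend s x \<xi> (Suc j))}"

sublocale P: product_prob_space "\<lambda>_::nat. S" J for J by standard

lemma finite_measure_law: "finite_measure (law J)"
  by (intro prob_space.axioms(1) prob_space_PiM prob_space_axioms)

lemma measurable_ext:
  assumes "m \<in> {1..s} \<or> m \<in> J \<and> s < m"
  shows "(\<lambda>\<xi>. extend s x \<xi> m) \<in> measurable (law J) S"
proof (cases "m \<le> s")
  case True
  then show ?thesis using x_in[of m] assms by (auto simp: extend_def)
next
  case False
  then have "m \<in> J" using assms by auto
  then show ?thesis using False by (simp add: extend_def)
qed

lemma measurable_clique:
  assumes "finite K" "\<And>m. m \<in> K \<Longrightarrow> m \<in> {1..s} \<or> m \<in> J \<and> s < m"
  shows "Measurable.pred (law J) (\<lambda>\<xi>. clique K (extend s x \<xi>))"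
proof -
  have [measurable]: "Measurable.pred (law J) (\<lambda>\<xi>. E (extend s x \<xi> a) (extend s x \<xi> b))" if "a \<in> K" "b \<in> K" for a b
  proof -
    have "(\<lambda>\<xi>. (extend s x \<xi> a, extend s x \<xi> b)) \<in> measurable (law J) (S \<Otimes>\<^sub>M S)"
      using assms(2) that by (intro measurable_Pair measurable_ext) auto
    from measurable_compose[OF this measurable_E] show ?thesis by simp
  qed
  show ?thesis unfolding clique_def using assms(1) by measurable
qed

lemma measurable_good_ext:
  assumes "Suc i \<le> n"
  shows "Measurable.pred (law {s+1..n}) (\<lambda>\<xi>. good i (extend s x \<xi>) (extend s x \<xi> (Suc i)))"
  using assms by (intro measurable_good measurable_ext) auto

lemma sets_cliques: "cliques n \<in> sets (law {s+1..n})"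
proof -
  have [measurable]: "Measurable.pred (law {s+1..n}) (\<lambda>\<xi>. clique {1..n} (extend s x \<xi>))"
    by (intro measurable_clique) auto
  show ?thesis unfolding cliques_def by measurable
qed

lemma sets_perfect_cliques: "perfect_cliques n \<in> sets (law {s+1..n})"
proof -
  have [measurable]: "Measurable.pred (law {s+1..n}) (\<lambda>\<xi>. clique {1..n} (extend s x \<xi>))"
    by (intro measurable_clique) auto
  have "Measurable.pred (law {s+1..n}) (\<lambda>\<xi>. \<forall>i\<in>{..<n}. good i (extend s x \<xi>) (extend s x \<xi> (Suc i)))"
    by (intro pred_intros_finite measurable_good_ext) auto
  then have [measurable]: "Measurable.pred (law {s+1..n}) (\<lambda>\<xi>. perf n (extend s x \<xi>))"
    by (simp only: perf_def Ball_def lessThan_iff)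
  show ?thesis unfolding perfect_cliques_def by measurable
qed

lemma sets_bad_cliques: "Suc j \<le> n \<Longrightarrow> bad_cliques n j \<in> sets (law {s+1..n})"
proof -
  assume "Suc j \<le> n"
  then have [measurable]: "Measurable.pred (law {s+1..n}) (\<lambda>\<xi>. good j (extend s x \<xi>) (extend s x \<xi> (Suc j)))"
    by (rule measurable_good_ext)
  have [measurable]: "Measurable.pred (law {s+1..n}) (\<lambda>\<xi>. clique {1..n} (extend s x \<xi>))"
    by (intro measurable_clique) auto
  show ?thesis unfolding bad_cliques_def by measurable
qed

text \<open>Fubini with an arbitrary coordinate integrated innermost, which allows a point in the
  middle of the sequence to be removed.\<close>

lemma emeasure_insert:
  assumes "finite J" "i \<notin> J" "X \<in> sets (law (insert i J))"
  shows "emeasure (law (insert i J)) X = (\<integral>\<^sup>+\<xi>. emeasure S {z \<in> space S. \<xi>(i := z) \<in> X} \<partial>law J)"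
proof -
  have "emeasure (law (insert i J)) X = (\<integral>\<^sup>+\<xi>. indicator X \<xi> \<partial>law (insert i J))"
    using assms by simp
  also have "\<dots> = (\<integral>\<^sup>+\<xi>. \<integral>\<^sup>+z. indicator X (\<xi>(i := z)) \<partial>S \<partial>law J)"
    using assms by (intro P.product_nn_integral_insert) auto
  also have "\<dots> = (\<integral>\<^sup>+\<xi>. emeasure S {z \<in> space S. \<xi>(i := z) \<in> X} \<partial>law J)"
  proof (intro nn_integral_cong)
    fix \<xi> assume w: "\<xi> \<in> space (law J)"
    have "(\<lambda>z. \<xi>(i := z)) \<in> measurable S (law (insert i J))"
      using assms(2) w by (rule measurable_component_update[rotated])
    from measurable_sets[OF this assms(3)]
    have "{z \<in> space S. \<xi>(i := z) \<in> X} \<in> sets S" by (simp add: vimage_def Int_def conj_commute)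
    moreover have "(\<integral>\<^sup>+z. indicator X (\<xi>(i := z)) \<partial>S) = (\<integral>\<^sup>+z. indicator {z \<in> space S. \<xi>(i := z) \<in> X} z \<partial>S)"
      by (intro nn_integral_cong) (auto simp: indicator_def)
    ultimately show "(\<integral>\<^sup>+z. indicator X (\<xi>(i := z)) \<partial>S) = emeasure S {z \<in> space S. \<xi>(i := z) \<in> X}"
      by simp
  qed
  finally show ?thesis .
qed

text \<open>The points after \<open>s\<close> are exchangeable, so any of them may be the deleted one.\<close>

lemma clique_delete_le:
  assumes i: "i \<in> {s+1..Suc n}"
  shows "emeasure (law ({s+1..Suc n} - {i})) {\<xi> \<in> space (law ({s+1..Suc n} - {i})). clique ({1..Suc n} - {i}) (extend s x \<xi>)}
    \<le> emeasure (law {s+1..n}) (cliques n)"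
proof -
  let ?J = "{s+1..Suc n} - {i}" let ?K = "{s+1..n}"
  let ?X = "{\<xi> \<in> space (law ?J). clique ({1..Suc n} - {i}) (extend s x \<xi>)}"
  \<comment> \<open>\<open>f\<close> closes the gap at \<open>i\<close> and \<open>g\<close> reopens
    it; pulling back along \<open>f\<close> preserves the product law because \<open>f\<close> is
    injective away from \<open>i\<close>.\<close>
  define f where "f m = (if m < i then m else m - 1)" for m :: nat
  define g where "g m = (if m < i then m else m + 1)" for m :: nat
  let ?T = "\<lambda>\<xi>. \<lambda>m\<in>?J. \<xi> (f m)"
  have d: "distr (law ?K) (law ?J) ?T = law ?J"
    using i by (intro distr_PiM_reindex prob_space_axioms) (auto simp: inj_on_def f_def split: if_splits)
  have X: "?X \<in> sets (law ?J)"
  proof -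
    have [measurable]: "Measurable.pred (law ?J) (\<lambda>\<xi>. clique ({1..Suc n} - {i}) (extend s x \<xi>))"
      by (intro measurable_clique) auto
    show ?thesis by measurable
  qed
  have T: "?T \<in> measurable (law ?K) (law ?J)"
    using i by (intro measurable_restrict measurable_component_singleton) (auto simp: f_def)
  have "emeasure (law ?J) ?X = emeasure (law ?K) (?T -` ?X \<inter> space (law ?K))"
    using emeasure_distr[OF T X] unfolding d .
  also have "\<dots> \<le> emeasure (law ?K) (cliques n)"
  proof (intro emeasure_mono subsetI sets_cliques)
    fix \<xi> assume w: "\<xi> \<in> ?T -` ?X \<inter> space (law ?K)"
    have e: "extend s x (?T \<xi>) (g m) = extend s x \<xi> m" if "m \<in> {1..n}" for m
      using that i by (auto simp: extend_def g_def f_def)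
    have "E (extend s x \<xi> a) (extend s x \<xi> b)" if "a \<in> {1..n}" "b \<in> {1..n}" "a \<noteq> b" for a b
    proof -
      have "g a \<in> {1..Suc n} - {i}" "g b \<in> {1..Suc n} - {i}" "g a \<noteq> g b"
        using that by (auto simp: g_def)
      then show ?thesis using w that unfolding clique_def by (auto simp flip: e)
    qed
    then show "\<xi> \<in> cliques n" using w by (auto simp: cliques_def clique_def)
  qed
  finally show ?thesis .
qed

text \<open>All other points, also the later ones, are held fixed while point \<open>Suc j\<close>
  is integrated. Its edges are dropped; the clique on the remaining points does not involve it, and
  its badness depends only on it and the first \<open>j\<close> points.\<close>

lemma bad_cliques_le:
  assumes j: "s \<le> j" "j \<le> n" and n: "n < R"
  shows "measure (law {s+1..Suc n}) (bad_cliques (Suc n) j) \<le> \<epsilon> * measure (law {s+1..n}) (cliques n)"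
proof -
  let ?i = "Suc j" let ?J = "{s+1..Suc n} - {?i}"
  let ?c = "\<lambda>\<xi>. clique ({1..Suc n} - {?i}) (extend s x \<xi>)"
  have ins: "{s+1..Suc n} = insert ?i ?J" using j by auto
  have [measurable]: "Measurable.pred (law ?J) ?c" by (intro measurable_clique) auto
  have "emeasure (law {s+1..Suc n}) (bad_cliques (Suc n) j) =
     (\<integral>\<^sup>+\<xi>. emeasure S {z \<in> space S. \<xi>(?i := z) \<in> bad_cliques (Suc n) j} \<partial>law ?J)"
    using sets_bad_cliques[of j "Suc n"] j by (subst (1) ins, intro emeasure_insert) (simp_all add: insert_absorb)
  also have "\<dots> \<le> (\<integral>\<^sup>+\<xi>. ennreal \<epsilon> * indicator {\<xi> \<in> space (law ?J). ?c \<xi>} \<xi> \<partial>law ?J)"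
  proof (intro nn_integral_mono)
    fix \<xi> assume w: "\<xi> \<in> space (law ?J)"
    let ?Z = "{z \<in> space S. \<xi>(?i := z) \<in> bad_cliques (Suc n) j}"
    have ext: "extend s x (\<xi>(?i := z)) m = extend s x \<xi> m" if "m \<noteq> ?i" for z m
      using that by (auto simp: extend_def)
    have exti: "extend s x (\<xi>(?i := z)) ?i = z" for z using j by (simp add: extend_def)
    show "emeasure S ?Z \<le> ennreal \<epsilon> * indicator {\<xi> \<in> space (law ?J). ?c \<xi>} \<xi>"
    proof (cases "?c \<xi>")
      case False
      have "\<not> clique {1..Suc n} (extend s x (\<xi>(?i := z)))" for z
      proof
        assume cl: "clique {1..Suc n} (extend s x (\<xi>(?i := z)))"
        have "?c \<xi>" unfolding clique_def
        proof (intro ballI impI)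
          fix a b assume ab: "a \<in> {1..Suc n} - {?i}" "b \<in> {1..Suc n} - {?i}" "a \<noteq> b"
          then have "E (extend s x (\<xi>(?i := z)) a) (extend s x (\<xi>(?i := z)) b)"
            using cl unfolding clique_def by blast
          then show "E (extend s x \<xi> a) (extend s x \<xi> b)" using ab ext[of a z] ext[of b z] by simp
        qed
        with False show False by simp
      qed
      then have "?Z = {}" by (auto simp: bad_cliques_def)
      then show ?thesis by (simp only: emeasure_empty) simp
    next
      case True
      have sp: "extend s x \<xi> m \<in> space S" if "m \<in> {1..j}" for m
        using that x_in[of m] w j by (auto simp: extend_def space_PiM PiE_iff)
      have m: "{z \<in> space S. \<not> good j (extend s x \<xi>) z} \<in> sets S"
      proof -
        have "Measurable.pred S (\<lambda>z. good j (extend s x \<xi>) z)"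
          using sp by (intro measurable_good_last) auto
        then show ?thesis by measurable
      qed
      have gc: "good j (extend s x (\<xi>(?i := z))) z = good j (extend s x \<xi>) z" for z
        by (intro good_cong ext) auto
      have "?Z \<subseteq> {z \<in> space S. \<not> good j (extend s x \<xi>) z}"
        by (auto simp: bad_cliques_def exti gc)
      then have "emeasure S ?Z \<le> emeasure S {z \<in> space S. \<not> good j (extend s x \<xi>) z}"
        by (rule emeasure_mono) (rule m)
      also have "\<dots> \<le> ennreal \<epsilon>"
        using bad_le[of j "extend s x \<xi>"] sp n j by (simp add: emeasure_eq_measure ennreal_leI)
      finally show ?thesis using True w by simp
    qed
  qed
  also have "\<dots> = ennreal \<epsilon> * emeasure (law ?J) {\<xi> \<in> space (law ?J). ?c \<xi>}"
    by (subst nn_integral_cmult_indicator) measurable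
  also have "\<dots> \<le> ennreal \<epsilon> * emeasure (law {s+1..n}) (cliques n)"
    using j by (intro mult_left_mono clique_delete_le) auto
  finally show ?thesis
    using params(1) by (simp add: finite_measure.emeasure_eq_measure[OF finite_measure_law] flip: ennreal_mult)
qed

text \<open>\<open>extend_ge\<close> is applied to each fixed perfect clique and integrated over the
  last point. The new points lie in \<open>U\<close> only almost surely, so the comparison of
  integrands is almost sure as well.\<close>

lemma perfect_cliques_Suc_ge:
  assumes n: "s \<le> n" "n < R"
  shows "\<delta> * measure (law {s+1..n}) (perfect_cliques n) \<le> measure (law {s+1..Suc n}) (perfect_cliques (Suc n))"
proof -
  let ?J = "{s+1..n}" let ?i = "Suc n"
  have ins: "{s+1..Suc n} = insert ?i ?J" using n by auto
  have "ennreal \<delta> * emeasure (law ?J) (perfect_cliques n) = (\<integral>\<^sup>+\<xi>. ennreal \<delta> * indicator (perfect_cliques n) \<xi> \<partial>law ?J)"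
    by (rule nn_integral_cmult_indicator[OF sets_perfect_cliques, symmetric])
  also have "\<dots> \<le> (\<integral>\<^sup>+\<xi>. emeasure S {z \<in> space S. \<xi>(?i := z) \<in> perfect_cliques (Suc n)} \<partial>law ?J)"
  proof (rule nn_integral_mono_AE)
    have "AE \<xi> in law ?J. \<forall>m\<in>?J. \<xi> m \<in> U"
    proof (rule AE_finite_allI)
      fix m assume "m \<in> ?J"
      then show "AE \<xi> in law ?J. \<xi> m \<in> U"
        by (intro AE_PiM_component[where P="\<lambda>y. y \<in> U"] AE_U prob_space_axioms)
    qed simp
    moreover have "AE \<xi> in law ?J. \<xi> \<in> space (law ?J)" by (rule AE_space)
    ultimately show "AE \<xi> in law ?J. ennreal \<delta> * indicator (perfect_cliques n) \<xi> \<le> emeasure S {z \<in> space S. \<xi>(?i := z) \<in> perfect_cliques (Suc n)}"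
    proof eventually_elim
      fix \<xi> assume U: "\<forall>m\<in>?J. \<xi> m \<in> U" and w: "\<xi> \<in> space (law ?J)"
      show "ennreal \<delta> * indicator (perfect_cliques n) \<xi> \<le> emeasure S {z \<in> space S. \<xi>(?i := z) \<in> perfect_cliques (Suc n)}"
      proof (cases "\<xi> \<in> perfect_cliques n")
        case True
        let ?y = "extend s x \<xi>"
        let ?Z = "{z \<in> space S. \<xi>(?i := z) \<in> perfect_cliques (Suc n)}"
        have ext: "extend s x (\<xi>(?i := z)) m = ?y m" if "m \<noteq> ?i" for z m
          using that by (auto simp: extend_def)
        have exti: "extend s x (\<xi>(?i := z)) ?i = z" for z using n by (simp add: extend_def)
        have gc: "good i (extend s x (\<xi>(?i := z))) y = good i ?y y" if "i \<le> n" for z i y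
          using that by (intro good_cong ext) auto
        have sp: "?y m \<in> U \<inter> space S" if "m \<in> {1..n}" for m
          using that x_in[of m] w U by (auto simp: extend_def space_PiM PiE_iff)
        have "\<delta> \<le> prob {z \<in> space S. (\<forall>m\<in>{1..n}. E (?y m) z) \<and> good n ?y z}"
          using True sp n by (intro extend_ge) (auto simp: perfect_cliques_def perf_def)
        also have "\<dots> \<le> prob ?Z"
        proof (rule finite_measure_mono)
          show "{z \<in> space S. (\<forall>m\<in>{1..n}. E (?y m) z) \<and> good n ?y z} \<subseteq> ?Z"
          proof (intro subsetI CollectI conjI)
            fix z assume z: "z \<in> {z \<in> space S. (\<forall>m\<in>{1..n}. E (?y m) z) \<and> good n ?y z}"
            then show zs: "z \<in> space S" by simp
            have "\<xi>(?i := z) \<in> space (law {s+1..Suc n})"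
              using w zs unfolding ins by (auto simp: space_PiM PiE_iff extensional_def)
            moreover have "clique {1..Suc n} (extend s x (\<xi>(?i := z)))"
              unfolding clique_def
            proof (intro ballI impI)
              fix a b assume ab: "a \<in> {1..Suc n}" "b \<in> {1..Suc n}" "a \<noteq> b"
              show "E (extend s x (\<xi>(?i := z)) a) (extend s x (\<xi>(?i := z)) b)"
              proof (cases "a = ?i \<or> b = ?i")
                case True
                then show ?thesis using ab z by (auto simp: ext exti intro: E_sym)
              next
                case False
                then show ?thesis using ab \<open>\<xi> \<in> perfect_cliques n\<close> by (auto simp: ext perfect_cliques_def clique_def)
              qed
            qed
            moreover have "perf (Suc n) (extend s x (\<xi>(?i := z)))"
              unfolding perf_def
            proof (intro allI impI)
              fix i assume "i < Suc n"
              then show "good i (extend s x (\<xi>(?i := z))) (extend s x (\<xi>(?i := z)) (Suc i))"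
                using \<open>\<xi> \<in> perfect_cliques n\<close> z by (cases "i = n") (auto simp: gc ext exti perfect_cliques_def perf_def)
            qed
            ultimately show "\<xi>(?i := z) \<in> perfect_cliques (Suc n)" by (simp add: perfect_cliques_def)
          qed
          have "(\<lambda>z. \<xi>(?i := z)) \<in> measurable S (law {s+1..Suc n})"
            unfolding ins using w by (intro measurable_component_update) auto
          from measurable_sets[OF this sets_perfect_cliques] show "?Z \<in> events"
            by (simp add: vimage_def Int_def conj_commute)
        qed
        finally show ?thesis using True by (simp add: emeasure_eq_measure ennreal_leI)
      qed simp
    qed
  qed
  also have "\<dots> = emeasure (law {s+1..Suc n}) (perfect_cliques (Suc n))"
    using sets_perfect_cliques[of "Suc n"] unfolding ins by (intro emeasure_insert[symmetric]) auto
  finally show ?thesis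
    using params(2) by (simp add: finite_measure.emeasure_eq_measure[OF finite_measure_law] flip: ennreal_mult)
qed

text \<open>The prescribed prefix is perfect, so the first \<open>s\<close> points are never bad.
  Hence every bad index is at least \<open>s\<close> and belongs to a random point, as the deletion
  bound requires.\<close>

lemma cliques_subset: "cliques (Suc n) \<subseteq> perfect_cliques (Suc n) \<union> (\<Union>j\<in>{s..n}. bad_cliques (Suc n) j)"
proof
  fix \<xi> assume w: "\<xi> \<in> cliques (Suc n)"
  show "\<xi> \<in> perfect_cliques (Suc n) \<union> (\<Union>j\<in>{s..n}. bad_cliques (Suc n) j)"
  proof (cases "\<xi> \<in> perfect_cliques (Suc n)")
    case False
    then obtain i where i: "i < Suc n" "\<not> good i (extend s x \<xi>) (extend s x \<xi> (Suc i))"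
      using w by (auto simp: perfect_cliques_def cliques_def perf_def)
    have "s \<le> i"
    proof (rule ccontr)
      assume "\<not> s \<le> i"
      then have "good i (extend s x \<xi>) (extend s x \<xi> (Suc i)) = good i x (x (Suc i))"
        by (subst good_cong[of i _ x]) (auto simp: extend_def)
      then show False using i x_good \<open>\<not> s \<le> i\<close> by simp
    qed
    then show ?thesis using i w by (auto simp: bad_cliques_def cliques_def intro!: bexI[of _ i])
  qed simp
qed

text \<open>At \<open>n = s\<close> all points are prescribed and the prefix is perfect, so both
  events coincide.\<close>

lemma clique_le_perfect_clique:
  "s \<le> n \<Longrightarrow> n \<le> R \<Longrightarrow> measure (law {s+1..n}) (cliques n) \<le> (1 + \<tau>) * measure (law {s+1..n}) (perfect_cliques n)"
proof (induction n rule: dec_induct)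
  case base
  have "cliques s = perfect_cliques s"
  proof -
    have "good i (extend s x \<xi>) (extend s x \<xi> (Suc i))" if "i < s" for i \<xi>
      using that x_good[OF that] by (subst good_cong[of i _ x]) (auto simp: extend_def)
    then show ?thesis by (auto simp: cliques_def perfect_cliques_def perf_def)
  qed
  then show ?case using params(3) by (simp add: algebra_simps)
next
  case (step n)
  let ?M = "law {s+1..Suc n}" let ?q = "measure (law {s+1..n}) (perfect_cliques n)"
  have "measure ?M (cliques (Suc n)) \<le> measure ?M (perfect_cliques (Suc n) \<union> (\<Union>j\<in>{s..n}. bad_cliques (Suc n) j))"
    by (intro finite_measure.finite_measure_mono[OF finite_measure_law] cliques_subset sets.Un sets_perfect_cliques sets.finite_UN sets_bad_cliques) auto
  also have "\<dots> \<le> measure ?M (perfect_cliques (Suc n)) + measure ?M (\<Union>j\<in>{s..n}. bad_cliques (Suc n) j)"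
    by (intro measure_Un_le sets_perfect_cliques sets.finite_UN sets_bad_cliques) auto
  also have "measure ?M (\<Union>j\<in>{s..n}. bad_cliques (Suc n) j) \<le> (\<Sum>j\<in>{s..n}. measure ?M (bad_cliques (Suc n) j))"
    by (intro measure_UNION_le sets_bad_cliques) auto
  also have "\<dots> \<le> (\<Sum>j\<in>{s..n}. \<epsilon> * measure (law {s+1..n}) (cliques n))"
    using step by (intro sum_mono bad_cliques_le) auto
  also have "\<dots> = real (Suc n - s) * (\<epsilon> * measure (law {s+1..n}) (cliques n))" by simp
  \<comment> \<open>At most \<open>R\<close> indices are bad, and the induction hypothesis replaces
    cliques by perfect cliques. The condition on the parameters then leaves exactly the factor
    \<open>\<delta>\<close> that adding a point consumes.\<close>
  also have "\<dots> \<le> real R * (\<epsilon> * ((1 + \<tau>) * ?q))"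
    using step params by (intro mult_mono mult_left_mono) auto
  also have "\<dots> = real R * \<epsilon> * (1 + \<tau>) * ?q" by simp
  also have "\<dots> \<le> \<tau> * \<delta> * ?q" using params(4) by (intro mult_right_mono) auto
  also have "\<tau> * \<delta> * ?q \<le> \<tau> * measure ?M (perfect_cliques (Suc n))"
    using perfect_cliques_Suc_ge[of n] step params(3) by (simp add: mult.assoc mult_left_mono)
  finally show ?case by (simp add: algebra_simps)
qed

end

section \<open>Projections and caps on the sphere\<close>

lemma dot_to_sphere: "dot k (to_sphere k u) v = dot k u v / L2_set u {..k}"
  by (simp add: dot_def sum_divide_distrib)

text \<open>Outside the event of a small norm, a projection longer than \<open>\<eta>\<close> on the
  sphere means a Gaussian projection with square above \<open>\<eta>^2 k / 2\<close>. The
  exponential moment with factor \<open>1/4\<close> then gives the exponent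
  \<open>\<eta>^2 k / 8\<close>.\<close>

lemma sphere_projection_tail:
  "measure (sphere_unif k) {z \<in> space (sphere_unif k). \<not> (\<Sum>m\<in>{1..i}. (dot k z (gs k y m))\<^sup>2) \<le> \<eta>\<^sup>2}
    \<le> sqrt 2 ^ i * exp (- (\<eta>\<^sup>2 * real k / 8)) + exp (- real k / 20)"
proof -
  interpret G: prob_space "gauss {..k}" by (rule prob_space_gauss) simp
  let ?q = "\<lambda>z. \<Sum>m\<in>{1..i}. (dot k z (gs k y m))\<^sup>2"
  let ?A = "{u \<in> space (gauss {..k}). (L2_set u {..k})\<^sup>2 \<le> real k / 2}"
  let ?B = "{u \<in> space (gauss {..k}). \<eta>\<^sup>2 * real k / 8 \<le> ?q u / 4}"
  have "{z \<in> space (sphere_unif k). \<not> ?q z \<le> \<eta>\<^sup>2} \<in> sets (sphere_unif k)" by measurable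
  then have "measure (sphere_unif k) {z \<in> space (sphere_unif k). \<not> ?q z \<le> \<eta>\<^sup>2} =
    measure (gauss {..k}) {u \<in> space (gauss {..k}). to_sphere k u \<in> {z \<in> space (sphere_unif k). \<not> ?q z \<le> \<eta>\<^sup>2}}"
    by (intro measure_sphere_unif) (simp add: sets_sphere_unif)
  also have "\<dots> \<le> measure (gauss {..k}) (?B \<union> ?A)"
  proof (intro G.finite_measure_mono subsetI)
    fix u assume u: "u \<in> {u \<in> space (gauss {..k}). to_sphere k u \<in> {z \<in> space (sphere_unif k). \<not> ?q z \<le> \<eta>\<^sup>2}}"
    show "u \<in> ?B \<union> ?A"
    proof (cases "(L2_set u {..k})\<^sup>2 \<le> real k / 2")
      case False
      then have L: "(L2_set u {..k})\<^sup>2 > real k / 2" "(L2_set u {..k})\<^sup>2 > 0"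
        using less_le_trans[of _ "real k / 2"] by (auto intro: le_less_trans[rotated])
      have "\<eta>\<^sup>2 < ?q (to_sphere k u)" using u by simp
      also have "?q (to_sphere k u) = ?q u / (L2_set u {..k})\<^sup>2"
        by (simp only: dot_to_sphere power_divide sum_divide_distrib)
      finally have "\<eta>\<^sup>2 * (L2_set u {..k})\<^sup>2 < ?q u" using L(2) by (simp add: less_divide_eq)
      moreover have "\<eta>\<^sup>2 * (real k / 2) \<le> \<eta>\<^sup>2 * (L2_set u {..k})\<^sup>2"
        using L(1) by (intro mult_left_mono) auto
      ultimately have "\<eta>\<^sup>2 * real k / 8 \<le> ?q u / 4" by linarith
      then show ?thesis using u by blast
    qed (use u in simp)
  qed measurable
  also have "\<dots> \<le> measure (gauss {..k}) ?B + measure (gauss {..k}) ?A"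
    by (intro measure_Un_le) measurable
  also have "measure (gauss {..k}) ?B \<le> exp (- (\<eta>\<^sup>2 * real k / 8)) * sqrt 2 ^ i"
  proof (intro measure_exp_Markov G.prob_space_axioms)
    have "dot k (gs k y m) (gs k y m) \<le> 1" for m using dot_gs_self[of k y m] by auto
    then show "(\<integral>\<^sup>+u. ennreal (exp (?q u / 4)) \<partial>gauss {..k}) \<le> ennreal (sqrt 2 ^ i)"
      using gauss_projection_exp[of k "{1..i}" "gs k y"] orthogonal_fam_gs[of "{1..i}" k y] by auto
  qed auto
  also note gauss_norm_lower_tail
  finally show ?thesis by (simp add: mult.commute)
qed

text \<open>On the box every signed inner product is at least \<open>2 * c\<close>, and outside the
  upper norm tail dividing by a norm of at most \<open>2 * sqrt k\<close> leaves
  \<open>c / sqrt k\<close>.\<close>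

lemma sphere_common_cap:
  assumes y: "\<And>m. m \<in> {1..n} \<Longrightarrow> dot k (y m) (y m) = 1"
    and proj: "\<And>m. m \<in> {1..n} \<Longrightarrow> (\<Sum>i\<in>{1..<m}. (dot k (y m) (gs k y i))\<^sup>2) \<le> \<eta>\<^sup>2"
    and eta: "0 \<le> \<eta>" "\<eta>\<^sup>2 \<le> 19/100" "\<eta> * ((a + 1) * sqrt (real n)) \<le> 1/2"
    and a: "0 \<le> a" "0 < c" "2 * c \<le> 9/10 * a - 1/2" and \<sigma>: "\<sigma> = 1 \<or> \<sigma> = - 1" and k: "k \<ge> 1"
  shows "(exp (- (a + 1)\<^sup>2 / 2) / sqrt (2 * pi)) ^ n - exp (- real k / 20)
    \<le> measure (sphere_unif k) {z \<in> space (sphere_unif k). \<forall>m\<in>{1..n}. c / sqrt (real k) \<le> \<sigma> * dot k z (y m)}"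
proof -
  interpret G: prob_space "gauss {..k}" by (rule prob_space_gauss) simp
  \<comment> \<open>Lower end of the unit interval: for \<open>\<sigma> = - 1\<close> the interval
    is the reflected \<open>[- (a + 1), - a]\<close>.\<close>
  define b where "b = (if \<sigma> = 1 then a else - (a + 1))"
  let ?S = "{z \<in> space (sphere_unif k). \<forall>m\<in>{1..n}. c / sqrt (real k) \<le> \<sigma> * dot k z (y m)}"
  let ?A = "{u \<in> space (gauss {..k}). (L2_set u {..k})\<^sup>2 \<ge> 4 * real k}"
  let ?B = "{u \<in> space (gauss {..k}). \<forall>m\<in>{1..n}. dot k u (gs k y m) \<in> {b..b+1}}"
  let ?T = "{u \<in> space (gauss {..k}). to_sphere k u \<in> ?S}"
  have sS: "?S \<in> sets (sphere_unif k)" by measurable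
  have "(exp (- (a + 1)\<^sup>2 / 2) / sqrt (2 * pi)) ^ card {1..n} \<le> measure (gauss {..k}) ?B"
    using gs_near_orthonormal(2)[OF y proj eta(2)] a
    by (intro gauss_box_lower orthogonal_fam_gs) (auto simp: b_def)
  also have "\<dots> \<le> measure (gauss {..k}) (?T \<union> ?A)"
  proof (intro G.finite_measure_mono subsetI)
    fix u assume u: "u \<in> ?B"
    show "u \<in> ?T \<union> ?A"
    proof (cases "(L2_set u {..k})\<^sup>2 \<ge> 4 * real k")
      case False
      have box: "\<sigma> * dot k u (gs k y m) \<in> {a..a+1}" if "m \<in> {1..n}" for m
      proof -
        have "dot k u (gs k y m) \<in> {b..b+1}" using u that by blast
        then show ?thesis using \<sigma> by (auto simp: b_def)
      qed
      have L: "L2_set u {..k} \<le> 2 * sqrt (real k)"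
        using False by (rule_tac power2_le_imp_le) (auto simp: power_mult_distrib)
      have "c / sqrt (real k) \<le> \<sigma> * dot k (to_sphere k u) (y m)" if m: "m \<in> {1..n}" for m
      proof -
        have d: "2 * c \<le> \<sigma> * dot k u (y m)"
          using dot_large_of_box[OF y proj eta a(1) \<sigma> box m] a(3) by linarith
        \<comment> \<open>The zero vector, which has no direction, is excluded because all its inner
          products vanish while \<open>c > 0\<close>.\<close>
        have "L2_set u {..k} \<noteq> 0"
        proof
          assume "L2_set u {..k} = 0"
          then have "dot k u (y m) = 0" by (simp add: L2_set_eq_0_iff dot_def)
          with d a(2) show False by simp
        qed
        then have Lp: "L2_set u {..k} > 0" using L2_set_nonneg[of u "{..k}"] by linarith
        have "c / sqrt (real k) = 2 * c / (2 * sqrt (real k))" by simp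
        also have "\<dots> \<le> 2 * c / L2_set u {..k}"
          using a(2) L Lp k by (intro divide_left_mono) auto
        also have "\<dots> \<le> \<sigma> * dot k u (y m) / L2_set u {..k}"
          using d Lp by (intro divide_right_mono) auto
        finally show ?thesis by (simp only: dot_to_sphere times_divide_eq_right)
      qed
      then show ?thesis using u by (simp add: space_sphere_unif)
    qed (use u in simp)
  next
    have "?T \<in> sets (gauss {..k})"
    proof -
      have "?T = to_sphere k -` ?S \<inter> space (gauss {..k})" by auto
      then show ?thesis using measurable_sets[OF _ sS, of "to_sphere k" "gauss {..k}"] by (simp cong: measurable_cong_sets)
    qed
    then show "?T \<union> ?A \<in> G.events" by measurable
  qed
  also have "\<dots> \<le> measure (gauss {..k}) ?T + measure (gauss {..k}) ?A"
  proof (intro measure_Un_le)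
    have "?T = to_sphere k -` ?S \<inter> space (gauss {..k})" by auto
    then show "?T \<in> sets (gauss {..k})" using measurable_sets[OF _ sS, of "to_sphere k" "gauss {..k}"] by (simp cong: measurable_cong_sets)
  qed measurable
  also have "measure (gauss {..k}) ?A \<le> exp (- real k / 20)" by (rule gauss_norm_upper_tail[OF k])
  also have "measure (gauss {..k}) ?T = measure (sphere_unif k) ?S"
    using sS by (intro measure_sphere_unif[symmetric]) (simp add: sets_sphere_unif)
  finally show ?thesis by simp
qed

text \<open>In \<open>\<delta>\<close> the term \<open>\<epsilon>\<close> is subtracted once more
  because the new point must also keep the sequence perfect. The power \<open>r\<close> covers all
  prefixes of length \<open>n < r\<close>.\<close>

lemma sphere_clique_bound:
  fixes k r s :: nat and x :: "nat \<Rightarrow> nat \<Rightarrow> real" and \<eta> a c \<sigma> \<tau> \<epsilon> \<delta> :: real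
  defines "\<epsilon> \<equiv> sqrt 2 ^ r * exp (- (\<eta>\<^sup>2 * real k / 8)) + exp (- real k / 20)"
    and "\<delta> \<equiv> (exp (- (a + 1)\<^sup>2 / 2) / sqrt (2 * pi)) ^ r - exp (- real k / 20) - \<epsilon>"
    and "good \<equiv> \<lambda>i y z. (\<Sum>m\<in>{1..i}. (dot k z (gs k y m))\<^sup>2) \<le> \<eta>\<^sup>2"
  assumes mE: "Measurable.pred (sphere_unif k \<Otimes>\<^sub>M sphere_unif k) (\<lambda>(y, z). E y z)"
    and symE: "\<And>y z. E y z \<Longrightarrow> E z y"
    and EI: "\<And>y z. c / sqrt (real k) \<le> \<sigma> * dot k z y \<Longrightarrow> E y z"
    and eta: "0 \<le> \<eta>" "\<eta>\<^sup>2 \<le> 19/100" "\<eta> * ((a + 1) * sqrt (real r)) \<le> 1/2"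
    and a: "0 \<le> a" "0 < c" "2 * c \<le> 9/10 * a - 1/2" and \<sigma>: "\<sigma> = 1 \<or> \<sigma> = - 1" and k: "k \<ge> 1"
    and x: "\<And>m. m \<in> {1..s} \<Longrightarrow> x m \<in> unit_sphere k" "\<And>i. i < s \<Longrightarrow> good i x (x (Suc i))"
    and s: "s \<le> r"
    and par: "0 < \<delta>" "0 \<le> \<tau>" "real r * \<epsilon> * (1 + \<tau>) \<le> \<tau> * \<delta>"
  shows "measure (points_law k s r) {\<omega> \<in> space (points_law k s r).
      \<forall>i\<in>{1..r}. \<forall>j\<in>{1..r}. i \<noteq> j \<longrightarrow> E (extend s x \<omega> i) (extend s x \<omega> j)}
    \<le> (1 + \<tau>) * measure (points_law k s r) {\<omega> \<in> space (points_law k s r).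
      (\<forall>i\<in>{1..r}. \<forall>j\<in>{1..r}. i \<noteq> j \<longrightarrow> E (extend s x \<omega> i) (extend s x \<omega> j)) \<and>
      (\<forall>i<r. good i (extend s x \<omega>) (extend s x \<omega> (Suc i)))}"
proof -
  interpret S: prob_space "sphere_unif k" by (rule prob_space_sphere_unif)
  have dist1: "dot k y y = 1" if "y \<in> unit_sphere k" for y
    using that by (simp add: unit_sphere_def dot_self)
  have sets_good: "{z \<in> space (sphere_unif k). good i y z} \<in> sets (sphere_unif k)" for i y
    unfolding good_def by measurable
  interpret cp: clique_process "sphere_unif k" E good "unit_sphere k" x s r \<epsilon> \<delta> \<tau>
  proof
    show "Measurable.pred M (\<lambda>\<omega>. good i (f \<omega>) (g \<omega>))"
      if f: "\<And>m. m \<in> {1..i} \<Longrightarrow> (\<lambda>\<omega>. f \<omega> m) \<in> measurable M (sphere_unif k)" and g: "g \<in> measurable M (sphere_unif k)"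
      for i f g and M :: "(nat \<Rightarrow> nat \<Rightarrow> real) measure"
    proof -
      have comp: "(\<lambda>y. y j) \<in> borel_measurable (sphere_unif k)" if "j \<le> k" for j
        using that by (subst measurable_cong_sets[OF sets_sphere_unif refl]) simp
      have [measurable]: "(\<lambda>\<omega>. gs k (f \<omega>) m j) \<in> borel_measurable M" if "m \<in> {1..i}" "j \<le> k" for m j
        using that by (intro measurable_gs measurable_compose[OF f comp]) auto
      have [measurable]: "(\<lambda>\<omega>. g \<omega> j) \<in> borel_measurable M" if "j \<le> k" for j
        using that by (intro measurable_compose[OF g comp])
      show ?thesis unfolding good_def by measurable
    qed
    show "Measurable.pred (sphere_unif k) (\<lambda>z. good i y z)" for i y
      using sets_good[of i y] by (simp add: pred_def)
    show "good i y z = good i y' z" if "\<And>m. m \<in> {1..i} \<Longrightarrow> y m = y' m" for i y y' z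
    proof -
      have "gs k y m = gs k y' m" if m: "m \<in> {1..i}" for m
        using m by (intro gs_cong \<open>\<And>m. m \<in> {1..i} \<Longrightarrow> y m = y' m\<close>) auto
      then show ?thesis by (simp add: good_def)
    qed
    show "AE y in sphere_unif k. y \<in> unit_sphere k" by (rule AE_sphere_unif_unit)
    show "x m \<in> unit_sphere k \<inter> space (sphere_unif k)" if "m \<in> {1..s}" for m
      using x(1)[OF that] by (auto simp: unit_sphere_def space_sphere_unif)
    have bad: "S.prob {z \<in> space (sphere_unif k). \<not> good i y z} \<le> \<epsilon>" if "i < r" for i y
    proof -
      have "S.prob {z \<in> space (sphere_unif k). \<not> good i y z} \<le> sqrt 2 ^ i * exp (- (\<eta>\<^sup>2 * real k / 8)) + exp (- real k / 20)"
        unfolding good_def by (rule sphere_projection_tail)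
      also have "\<dots> \<le> \<epsilon>"
        unfolding \<epsilon>_def using that by (intro add_right_mono mult_right_mono power_increasing) auto
      finally show ?thesis .
    qed
    then show "S.prob {z \<in> space (sphere_unif k). \<not> good i y z} \<le> \<epsilon>" if "i < r" for i y
      using that .
    show "\<delta> \<le> S.prob {z \<in> space (sphere_unif k). (\<forall>m\<in>{1..n}. E (y m) z) \<and> good n y z}"
      if n: "n < r" and y: "\<And>m. m \<in> {1..n} \<Longrightarrow> y m \<in> unit_sphere k \<inter> space (sphere_unif k)"
        and yg: "\<And>i. i < n \<Longrightarrow> good i y (y (Suc i))" for n y
    proof -
      let ?cap = "{z \<in> space (sphere_unif k). \<forall>m\<in>{1..n}. c / sqrt (real k) \<le> \<sigma> * dot k z (y m)}"
      let ?ext = "{z \<in> space (sphere_unif k). (\<forall>m\<in>{1..n}. E (y m) z) \<and> good n y z}"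
      let ?bad = "{z \<in> space (sphere_unif k). \<not> good n y z}"
      let ?q = "exp (- (a + 1)\<^sup>2 / 2) / sqrt (2 * pi)"
      have "?q \<le> 1 / sqrt (2 * pi)" by (intro divide_right_mono) auto
      also have "\<dots> \<le> 1" using pi_ge_two by (simp add: divide_le_eq_1)
      finally have "?q ^ r \<le> ?q ^ n" using n by (intro power_decreasing) auto
      moreover have "?q ^ n - exp (- real k / 20) \<le> S.prob ?cap"
      proof (rule sphere_common_cap)
        show "dot k (y m) (y m) = 1" if "m \<in> {1..n}" for m using y[OF that] dist1 by auto
        show "(\<Sum>i\<in>{1..<m}. (dot k (y m) (gs k y i))\<^sup>2) \<le> \<eta>\<^sup>2" if m: "m \<in> {1..n}" for m
        proof -
          \<comment> \<open>\<open>good i\<close> concerns point \<open>Suc i\<close>, so the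
            statement about point \<open>m\<close> is \<open>good\<close> at
            \<open>m - 1\<close>.\<close>
          have "{1..<m} = {1..m - 1}" "Suc (m - 1) = m" using m by auto
          then show ?thesis using yg[of "m - 1"] m unfolding good_def by auto
        qed
        have "\<eta> * ((a + 1) * sqrt (real n)) \<le> \<eta> * ((a + 1) * sqrt (real r))"
          using eta(1) a(1) n by (intro mult_left_mono) auto
        then show "\<eta> * ((a + 1) * sqrt (real n)) \<le> 1/2" using eta(3) by linarith
      qed (use eta a \<sigma> k in auto)
      \<comment> \<open>A point of the common cap has all required edges, so it either extends the
        clique perfectly or is bad.\<close>
      moreover have "S.prob ?cap \<le> S.prob ?ext + S.prob ?bad"
      proof -
        have mExt: "?ext \<in> S.events"
        proof -
          have [measurable]: "Measurable.pred (sphere_unif k) (\<lambda>z. E (y m) z)" if "m \<in> {1..n}" for m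
          proof -
            have "(\<lambda>z. (y m, z)) \<in> measurable (sphere_unif k) (sphere_unif k \<Otimes>\<^sub>M sphere_unif k)"
              using y[OF that] by (intro measurable_Pair) auto
            from measurable_compose[OF this mE] show ?thesis by simp
          qed
          have [measurable]: "Measurable.pred (sphere_unif k) (good n y)"
            using sets_good[of n y] by (simp add: pred_def)
          show ?thesis by measurable
        qed
        have mBad: "?bad \<in> S.events" using sets_good[of n y] by (rule sets.sets_Collect_neg)
        have "S.prob ?cap \<le> S.prob (?ext \<union> ?bad)"
          using mExt mBad EI by (intro S.finite_measure_mono) auto
        also have "\<dots> \<le> S.prob ?ext + S.prob ?bad"
          using mExt mBad by (rule measure_Un_le)
        finally show ?thesis .
      qed
      ultimately show ?thesis using bad[OF n, of y] unfolding \<delta>_def by linarith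
    qed
    show "0 \<le> \<epsilon>" unfolding \<epsilon>_def by simp
  qed (use mE symE par x in auto)
  show ?thesis
    using cp.clique_le_perfect_clique[OF s order_refl]
    unfolding cp.cliques_def cp.perfect_cliques_def cp.clique_def cp.perf_def points_law_def .
qed

section \<open>Choice of the parameters and proof of the theorem\<close>

text \<open>All quantities are measured in powers of \<open>Y\<close>. The left side of the second
  claim is at most \<open>4 * Y ^ 48\<close> and the right side at least
  \<open>Y ^ 20 - 3 * Y ^ 50\<close>; the wide gap between the exponents 19 and 49 absorbs the
  constants, as \<open>Y ^ 3 \<le> 1/8\<close>.\<close>

lemma bound_parameters:
  fixes Y \<epsilon> g q \<tau> B r :: real
  assumes Y: "0 < Y" "Y \<le> 1/2" and e: "0 \<le> \<epsilon>" "\<epsilon> \<le> 2 * Y ^ 49" and g: "g \<le> Y ^ 49" and q: "Y ^ 19 \<le> q"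
    and r: "0 \<le> r" "r \<le> B" "B * Y \<le> 1" and t: "Y \<le> \<tau>" "\<tau> \<le> 1"
  shows "0 < q - g - \<epsilon>" "r * \<epsilon> * (1 + \<tau>) \<le> \<tau> * (q - g - \<epsilon>)"
proof -
  have Y3: "Y ^ 3 \<le> 1/8" using power_mono[of Y "1/2" 3] Y by (simp add: power_divide)
  have small: "8 * Y ^ (n + 3) \<le> Y ^ n" for n
    using mult_left_mono[OF Y3, of "Y ^ n"] Y by (simp add: power_add)
  have dec: "Y ^ m \<le> Y ^ n" if "n \<le> m" for m n using that Y by (intro power_decreasing) auto
  have pos: "Y ^ n > 0" for n using Y by simp
  have d: "q - g - \<epsilon> \<ge> Y ^ 19 - 3 * Y ^ 49" using e g q by linarith
  have "8 * Y ^ 49 \<le> Y ^ 19" using small[of 19] dec[of 22 49] by simp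
  with d pos[of 49] show *: "0 < q - g - \<epsilon>" by linarith
  have "r * \<epsilon> * (1 + \<tau>) \<le> B * (2 * Y ^ 49) * 2"
    using r e t Y by (intro mult_mono) auto
  also have "\<dots> = 4 * (B * Y) * Y ^ 48" by (simp add: eval_nat_numeral)
  also have "\<dots> \<le> 4 * 1 * Y ^ 48" using r Y by (intro mult_right_mono mult_left_mono) auto
  also have "\<dots> \<le> Y ^ 20 - 3 * Y ^ 50"
  proof -
    have "8 * Y ^ 23 \<le> Y ^ 20" using small[of 20] by simp
    moreover have "Y ^ 48 \<le> Y ^ 23" "Y ^ 50 \<le> Y ^ 23" by (auto intro: dec)
    ultimately show ?thesis using pos[of 23] by linarith
  qed
  also have "\<dots> = Y * (Y ^ 19 - 3 * Y ^ 49)" by (simp add: eval_nat_numeral algebra_simps)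
  also have "\<dots> \<le> Y * (q - g - \<epsilon>)" using d Y by (intro mult_left_mono) auto
  also have "\<dots> \<le> \<tau> * (q - g - \<epsilon>)" using t * by (intro mult_right_mono) auto
  finally show "r * \<epsilon> * (1 + \<tau>) \<le> \<tau> * (q - g - \<epsilon>)" .
qed

lemma perfect_iff:
  fixes C :: real and l k :: nat
  defines "\<eta> \<equiv> alpha_of C * sqrt (real l) / sqrt (real k)"
  assumes "0 \<le> \<eta>"
  shows "perfect C l k n y \<longleftrightarrow> (\<forall>i<n. (\<Sum>m\<in>{1..i}. (dot k (y (Suc i)) (gs k y m))\<^sup>2) \<le> \<eta>\<^sup>2)"
proof -
  have eq: "L2_set (proj k y i z) {..k} \<le> \<eta> \<longleftrightarrow> (\<Sum>m\<in>{1..i}. (dot k z (gs k y m))\<^sup>2) \<le> \<eta>\<^sup>2" for i z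
    unfolding L2_set_proj[symmetric] using assms(2) by (simp add: L2_set_nonneg)
  show ?thesis
  proof
    assume p: "perfect C l k n y"
    show "\<forall>i<n. (\<Sum>m\<in>{1..i}. (dot k (y (Suc i)) (gs k y m))\<^sup>2) \<le> \<eta>\<^sup>2"
    proof (intro allI impI)
      fix i assume "i < n"
      then show "(\<Sum>m\<in>{1..i}. (dot k (y (Suc i)) (gs k y m))\<^sup>2) \<le> \<eta>\<^sup>2"
        \<comment> \<open>Perfection says nothing about the first point; at \<open>i = 0\<close> the
          sum is empty and the inequality is trivial.\<close>
        using p unfolding perfect_def \<eta>_def[symmetric] eq by (cases "i = 0") auto
    qed
  next
    assume "\<forall>i<n. (\<Sum>m\<in>{1..i}. (dot k (y (Suc i)) (gs k y m))\<^sup>2) \<le> \<eta>\<^sup>2"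
    then show "perfect C l k n y" unfolding perfect_def \<eta>_def[symmetric] eq by auto
  qed
qed

text \<open>The choice of \<open>L\<close> gives \<open>exp (- L) \<le> q / 10\<close>, so the error
  term is far below \<open>p\<close> and \<open>exp (- c^2 / 4)\<close> is still at least
  \<open>exp (- L)\<close>. With \<open>q = p_C\<close> the bound is uniform in
  \<open>p\<close>.\<close>

lemma c_thr_le:
  assumes k: "k \<ge> 1" and q: "0 < q" "q < p" "p < 1/2" and l: "ln (10 / q) \<le> L" and e: "exp (- real k / 20) \<le> exp (- L)"
  shows "c_thr k p \<le> 2 * sqrt L"
proof -
  let ?c = "c_thr k p"
  have q10: "q / 10 \<ge> exp (- L)"
  proof -
    have "exp (- L) \<le> exp (- ln (10 / q))" using l by simp
    also have "\<dots> = q / 10" using q by (simp add: exp_minus)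
    finally show ?thesis .
  qed
  have "p \<le> exp (- ?c\<^sup>2 / 4) + exp (- real k / 20)" using k q by (intro c_thr_tail) auto
  then have "exp (- L) \<le> exp (- ?c\<^sup>2 / 4)" using q10 e q by linarith
  then have "?c\<^sup>2 \<le> 4 * L" by simp
  then have "?c \<le> sqrt (4 * L)" by (rule real_le_rsqrt)
  then show ?thesis by (simp add: real_sqrt_mult)
qed

theorem theorem7p5:
  fixes C :: real
  assumes "C > 1"
  shows "\<exists>D0::real. \<forall>D\<ge>D0. \<exists>l0::nat. \<forall>l\<ge>l0. \<forall>k::nat. real k = D\<^sup>2 * (real l)\<^sup>2 \<longrightarrow>
    (\<forall>p. p_of C < p \<and> p < 1/2 \<longrightarrow>
      (\<forall>r s. \<forall>x :: nat \<Rightarrow> nat \<Rightarrow> real.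
        2 \<le> r \<and> real r \<le> C * real l \<and> s \<le> r - 1 \<and>
        (\<forall>i\<in>{1..s}. x i \<in> unit_sphere k) \<and> perfect C l k s x \<longrightarrow>
          P_red k p r s x \<le> (1 + 2 powr (- (C * real l))) * P_red_per C l k p r s x \<and>
          P_blue k p r s x \<le> (1 + 2 powr (- (C * real l))) * P_blue_per C l k p r s x))"
proof -
  define L where "L = ln (10 / p_of C)"
  note pC = p_of_bounds[OF assms]
  \<comment> \<open>\<open>exp L\<close> is \<open>10 / p_C\<close> and \<open>p_C < 1/2\<close>.
    The value 20 later absorbs \<open>sqrt (2 * pi)\<close>.\<close>
  have expL: "20 \<le> exp L" using pC by (simp add: L_def le_divide_eq)
  have L1: "1 \<le> L"
  proof -
    have "exp 1 \<le> exp L" using expL exp_le by linarith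
    then show ?thesis by simp
  qed
  \<comment> \<open>Upper end of the box \<open>[M - 1, M]\<close>; the factor 6 makes the inner
    products large enough for a threshold of up to \<open>2 * sqrt L\<close>.\<close>
  define M where "M = 6 * sqrt L"
  have M: "6 \<le> M" using L1 by (simp add: M_def)
  define \<alpha> where "\<alpha> = alpha_of C"
  have \<alpha>: "1000 \<le> \<alpha>" "20 * sqrt (C * L) \<le> \<alpha>" by (auto simp: \<alpha>_def alpha_of_def L_def)
  \<comment> \<open>Chosen so that \<open>\<eta> * (M * sqrt B) = \<alpha> * M * sqrt C / D\<close>
    is at most \<open>1/2\<close>; here \<open>l\<close> cancels.\<close>
  define D0 where "D0 = 2 * \<alpha> * M * sqrt C"
  \<comment> \<open>\<open>980 = 20 * 49\<close>: since \<open>k \<ge> l^2\<close>, the norm tails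
    \<open>exp (- k / 20)\<close> are then at most \<open>Y ^ 49\<close>.\<close>
  define l0 where "l0 = nat \<lceil>980 * L * C\<rceil> + 1"
  have "2 * 1000 * 6 * 1 \<le> D0"
    unfolding D0_def using \<alpha>(1) M assms by (intro mult_mono) auto
  then have D0: "1 \<le> D0" by simp
  show ?thesis
  proof (intro exI[of _ D0] exI[of _ l0] allI impI)
    fix D :: real and l k :: nat and p :: real and r s :: nat and x :: "nat \<Rightarrow> nat \<Rightarrow> real"
    assume D: "D0 \<le> D" and l: "l0 \<le> l" and k: "real k = D\<^sup>2 * (real l)\<^sup>2"
      and p: "p_of C < p \<and> p < 1/2"
      and H: "2 \<le> r \<and> real r \<le> C * real l \<and> s \<le> r - 1 \<and>
        (\<forall>i\<in>{1..s}. x i \<in> unit_sphere k) \<and> perfect C l k s x"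
    define B where "B = C * real l"
    define Y where "Y = exp (- (L * B))"
    define \<eta> where "\<eta> = \<alpha> * sqrt (real l) / sqrt (real k)"
    define \<tau> where "\<tau> = 2 powr (- B)"
    define \<epsilon> where "\<epsilon> = sqrt 2 ^ r * exp (- (\<eta>\<^sup>2 * real k / 8)) + exp (- real k / 20)"
    define q where "q = (exp (- (M - 1 + 1)\<^sup>2 / 2) / sqrt (2 * pi)) ^ r"
    have lpos: "1 \<le> real l" "980 * L * C \<le> real l"
      using l by (auto simp: l0_def) linarith
    have D1: "1 \<le> D" using D D0 by simp
    have "1 * 1 \<le> D\<^sup>2 * (real l)\<^sup>2" using D1 lpos by (intro mult_mono) auto
    then have k1: "k \<ge> 1" using k by linarith
    have sk: "sqrt (real k) = D * real l" using D1 by (simp add: k real_sqrt_mult)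
    have B1: "1 \<le> B" unfolding B_def using assms lpos mult_mono[of 1 C 1 "real l"] by simp
    have LB: "B \<le> L * B" "1 \<le> L * B" using L1 B1 mult_mono[of 1 L 1 B] mult_right_mono[of 1 L B] by auto
    have rB: "real r \<le> B" using H by (simp add: B_def)
    have Yn: "Y ^ n = exp (- (real n * (L * B)))" for n
      unfolding Y_def using exp_of_nat_mult[of n "- (L * B)"] by simp
    have g: "exp (- real k / 20) \<le> Y ^ 49"
    proof -
      have "49 * (L * B) * 20 = 980 * L * C * real l" by (simp add: B_def)
      also have "\<dots> \<le> real l * real l" using lpos by (intro mult_right_mono) auto
      also have "\<dots> \<le> D\<^sup>2 * (real l)\<^sup>2"
        using D1 mult_right_mono[of 1 "D\<^sup>2" "(real l)\<^sup>2"] by (simp add: power2_eq_square[of "real l"])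
      finally show ?thesis unfolding Yn k[symmetric] by simp
    qed
    have \<eta>0: "0 \<le> \<eta>" using \<alpha> by (simp add: \<eta>_def)
    have "\<eta> * (M * sqrt B) = \<alpha> * M * sqrt C / D"
    proof -
      have "sqrt (real l) * sqrt (real l) = real l" by simp
      then show ?thesis using lpos D1
        by (simp add: \<eta>_def sk B_def real_sqrt_mult field_simps)
    qed
    also have "\<dots> \<le> 1/2" using D D1 unfolding D0_def by (simp add: divide_le_eq)
    finally have \<eta>M: "\<eta> * (M * sqrt B) \<le> 1/2" .
    have \<eta>r: "\<eta> * ((M - 1 + 1) * sqrt (real r)) \<le> 1/2"
    proof -
      have "\<eta> * ((M - 1 + 1) * sqrt (real r)) \<le> \<eta> * (M * sqrt B)"
        using \<eta>0 M rB by (intro mult_left_mono mult_mono) auto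
      with \<eta>M show ?thesis by linarith
    qed
    have "6 * 1 \<le> M * sqrt B" using M B1 by (intro mult_mono) auto
    then have "\<eta> * 6 \<le> 1/2" using \<eta>M \<eta>0 mult_left_mono[of 6 "M * sqrt B" \<eta>] by linarith
    then have "\<eta>\<^sup>2 \<le> (1/12)\<^sup>2" using \<eta>0 by (intro power_mono) auto
    then have \<eta>2: "\<eta>\<^sup>2 \<le> 19/100" by (simp add: power_divide)
    \<comment> \<open>\<open>50 = 20^2 / 8\<close>, from the term \<open>20 * sqrt (C * L)\<close>
      in \<open>\<alpha>\<close>. One unit is spent on \<open>sqrt 2 ^ r\<close>, which leaves the
      exponent 49.\<close>
    have \<eta>k: "\<eta>\<^sup>2 * real k / 8 \<ge> 50 * (L * B)"
    proof -
      have "\<eta>\<^sup>2 * real k = \<alpha>\<^sup>2 * real l" using k1 by (simp add: \<eta>_def power_mult_distrib power_divide)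
      moreover have "(20 * sqrt (C * L))\<^sup>2 \<le> \<alpha>\<^sup>2" using \<alpha> assms L1 by (intro power_mono) auto
      then have "400 * (C * L) \<le> \<alpha>\<^sup>2" using assms L1 by (simp add: power_mult_distrib)
      then have "400 * (C * L) * real l \<le> \<alpha>\<^sup>2 * real l" by (intro mult_right_mono) auto
      ultimately show ?thesis by (simp add: B_def mult_ac)
    qed
    have s2: "sqrt 2 ^ r \<le> exp (L * B)"
    proof -
      have "sqrt 2 \<le> exp (1::real)" using exp_ge_add_one_self[of 1] sqrt2_less_2 by linarith
      then have "sqrt 2 ^ r \<le> exp (1::real) ^ r" by (intro power_mono) auto
      also have "\<dots> = exp (real r)" by (simp flip: exp_of_nat_mult)
      also have "\<dots> \<le> exp (L * B)" using rB LB by simp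
      finally show ?thesis .
    qed
    have "sqrt 2 ^ r * exp (- (\<eta>\<^sup>2 * real k / 8)) \<le> exp (L * B) * exp (- (50 * (L * B)))"
      using s2 \<eta>k by (intro mult_mono) auto
    also have "\<dots> = Y ^ 49" unfolding Yn by (simp flip: exp_add)
    finally have \<epsilon>: "0 \<le> \<epsilon>" "\<epsilon> \<le> 2 * Y ^ 49" using g by (auto simp: \<epsilon>_def)
    \<comment> \<open>\<open>19 = 18 + 1\<close>: the box contributes
      \<open>M^2 / 2 = 18 * L\<close> per coordinate, and
      \<open>sqrt (2 * pi) \<le> 20 \<le> exp L\<close> contributes one more
      \<open>L\<close>.\<close>
    have q: "Y ^ 19 \<le> q"
    proof -
      have "2 * pi \<le> 20\<^sup>2" using pi_less_4 by simp
      then have "sqrt (2 * pi) \<le> 20" by (intro real_le_lsqrt) auto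
      then have "sqrt (2 * pi) \<le> exp L" using expL by linarith
      then have "exp (- (18 * L)) / exp L \<le> exp (- (18 * L)) / sqrt (2 * pi)"
        by (intro divide_left_mono) auto
      moreover have "exp (- (M - 1 + 1)\<^sup>2 / 2) = exp (- (18 * L))"
        using L1 by (simp add: M_def power_mult_distrib)
      ultimately have "exp (- (19 * L)) \<le> exp (- (M - 1 + 1)\<^sup>2 / 2) / sqrt (2 * pi)"
        by (simp flip: exp_diff)
      then have "exp (- (19 * L)) ^ r \<le> q" unfolding q_def by (intro power_mono) auto
      moreover have "Y ^ 19 \<le> exp (- (19 * L)) ^ r"
      proof -
        have "real r * (19 * L) \<le> B * (19 * L)" using rB L1 by (intro mult_right_mono) auto
        then show ?thesis
          unfolding Yn exp_of_nat_mult[symmetric] by (simp add: mult_ac)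
      qed
      ultimately show ?thesis by linarith
    qed
    have Y: "0 < Y" "Y \<le> 1/2" "B * Y \<le> 1"
    proof -
      show "0 < Y" by (simp add: Y_def)
      have e: "1 + L * B \<le> exp (L * B)" by (rule exp_ge_add_one_self)
      then have "2 \<le> exp (L * B)" using LB by linarith
      then have "1 / exp (L * B) \<le> 1 / 2" by (intro divide_left_mono) auto
      then show "Y \<le> 1/2" by (simp add: Y_def exp_minus inverse_eq_divide)
      have "B \<le> exp (L * B)" using e LB by linarith
      then show "B * Y \<le> 1" by (simp add: Y_def exp_minus field_simps)
    qed
    have \<tau>: "Y \<le> \<tau>" "\<tau> \<le> 1" "0 \<le> \<tau>"
    proof -
      have "B * ln 2 \<le> B * L" using ln_2_less_1 L1 B1 by (intro mult_left_mono) auto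
      then show "Y \<le> \<tau>" by (simp add: Y_def \<tau>_def powr_def mult_ac)
      have "(2::real) powr (- B) \<le> 2 powr 0" using B1 by (intro powr_mono) auto
      then show "\<tau> \<le> 1" by (simp add: \<tau>_def)
    qed (simp add: \<tau>_def)
    note par = bound_parameters[OF Y(1,2) \<epsilon> g q _ rB Y(3) \<tau>(1,2), simplified]
    define c where "c = 2 * sqrt L"
    have c: "0 < c" "0 \<le> M - 1" "2 * c \<le> 9/10 * (M - 1) - 1/2"
    proof -
      have "1 \<le> sqrt L" using L1 by simp
      \<comment> \<open>With \<open>t = sqrt L\<close> the last inequality reads
        \<open>4 t \<le> 5.4 t - 1.4\<close>, with equality at \<open>t = 1\<close>.\<close>
      moreover have "0 < 2 * t" "0 \<le> 6 * t - 1" "2 * (2 * t) \<le> 9/10 * (6 * t - 1) - 1/2" if "1 \<le> t" for t :: real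
        using that by (auto simp: field_simps)
      ultimately show "0 < c" "0 \<le> M - 1" "2 * c \<le> 9/10 * (M - 1) - 1/2" unfolding c_def M_def by blast+
    qed
    have thr: "0 \<le> c_thr k p" "c_thr k p \<le> c"
    proof -
      show "0 \<le> c_thr k p" using c_thr(1)[OF k1] p pC by auto
      have "Y ^ 49 \<le> exp (- L)"
      proof -
        have "L \<le> L * B" using B1 L1 mult_left_mono[of 1 B L] by simp
        then show ?thesis unfolding Yn using LB by simp
      qed
      with g have "exp (- real k / 20) \<le> exp (- L)" by linarith
      then show "c_thr k p \<le> c"
        unfolding c_def using k1 pC p by (intro c_thr_le[of k "p_of C"]) (simp_all only: L_def order_refl)
    qed
    have xg: "\<And>i. i < s \<Longrightarrow> (\<Sum>m\<in>{1..i}. (dot k (x (Suc i)) (gs k x m))\<^sup>2) \<le> \<eta>\<^sup>2"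
      using H \<eta>0 perfect_iff[of C l k s x] by (simp add: \<eta>_def \<alpha>_def)
    have perf: "perfect C l k r y \<longleftrightarrow> (\<forall>i<r. (\<Sum>m\<in>{1..i}. (dot k (y (Suc i)) (gs k y m))\<^sup>2) \<le> \<eta>\<^sup>2)" for y
      using \<eta>0 perfect_iff[of C l k r y] by (simp add: \<eta>_def \<alpha>_def)
    \<comment> \<open>Replaces the unknown threshold by the constant \<open>c\<close>: an inner
      product of at most \<open>- c / sqrt k\<close> forces red, and one of at least
      \<open>c / sqrt k\<close> is positive and forces blue.\<close>
    have thr_k: "- c / sqrt (real k) \<le> - c_thr k p / sqrt (real k)" "- c_thr k p / sqrt (real k) \<le> 0"
      "0 < c / sqrt (real k)"
      using thr c k1 by (auto simp: divide_right_mono)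
    let ?red = "\<lambda>y z. dot k y z \<le> - c_thr k p / sqrt (real k)"
    have [measurable]: "(\<lambda>\<omega>. dot k (fst \<omega>) (snd \<omega>)) \<in> borel_measurable (sphere_unif k \<Otimes>\<^sub>M sphere_unif k)"
    proof -
      have comp: "(\<lambda>y. y j) \<in> borel_measurable (sphere_unif k)" if "j \<le> k" for j
        using that by (subst measurable_cong_sets[OF sets_sphere_unif refl]) simp
      show ?thesis
        by (intro measurable_dot measurable_compose[OF measurable_fst comp] measurable_compose[OF measurable_snd comp])
    qed
    have clique: "measure (points_law k s r) {\<omega> \<in> space (points_law k s r).
        \<forall>i\<in>{1..r}. \<forall>j\<in>{1..r}. i \<noteq> j \<longrightarrow> E (extend s x \<omega> i) (extend s x \<omega> j)}
      \<le> (1 + \<tau>) * measure (points_law k s r) {\<omega> \<in> space (points_law k s r).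
        (\<forall>i\<in>{1..r}. \<forall>j\<in>{1..r}. i \<noteq> j \<longrightarrow> E (extend s x \<omega> i) (extend s x \<omega> j)) \<and> perfect C l k r (extend s x \<omega>)}"
      if "Measurable.pred (sphere_unif k \<Otimes>\<^sub>M sphere_unif k) (\<lambda>(y, z). E y z)"
        "\<And>y z. E y z \<Longrightarrow> E z y" "\<And>y z. c / sqrt (real k) \<le> \<sigma> * dot k z y \<Longrightarrow> E y z" "\<sigma> = 1 \<or> \<sigma> = - 1" for E \<sigma>
      unfolding perf
      using H xg par \<tau>(3) unfolding q_def \<epsilon>_def
      by (intro sphere_clique_bound[OF that(1-3) \<eta>0 \<eta>2 \<eta>r c(2,1,3) that(4) k1]) auto
    have "P_red k p r s x \<le> (1 + \<tau>) * P_red_per C l k p r s x"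
      unfolding P_red_def P_red_per_def red_clique_def red_edge_def
    proof (rule clique[of ?red "- 1"])
      show "Measurable.pred (sphere_unif k \<Otimes>\<^sub>M sphere_unif k) (\<lambda>(y, z). ?red y z)"
        unfolding split_beta' by measurable
      show "?red y z" if "c / sqrt (real k) \<le> - 1 * dot k z y" for y z
        using that thr_k(1) dot_commute[of k y z] by simp
    qed (simp_all add: dot_commute)
    moreover have "P_blue k p r s x \<le> (1 + \<tau>) * P_blue_per C l k p r s x"
      unfolding P_blue_def P_blue_per_def blue_clique_def red_edge_def
    proof (rule clique[of "\<lambda>y z. \<not> ?red y z" 1])
      show "Measurable.pred (sphere_unif k \<Otimes>\<^sub>M sphere_unif k) (\<lambda>(y, z). \<not> ?red y z)"
        unfolding split_beta' by measurable
      show "\<not> ?red y z" if "c / sqrt (real k) \<le> 1 * dot k z y" for y z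
        using that thr_k(2,3) dot_commute[of k y z] by linarith
    qed (simp_all add: dot_commute)
    ultimately show "P_red k p r s x \<le> (1 + 2 powr (- (C * real l))) * P_red_per C l k p r s x \<and>
        P_blue k p r s x \<le> (1 + 2 powr (- (C * real l))) * P_blue_per C l k p r s x"
      by (simp add: \<tau>_def B_def)
  qed
qed

end
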